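(* For each of the following fifteen functions $f(q)$ (with $q$-expansion $f(q)=\sum_{n\ge 1} a_n q^n$), the value $L(f,1)$ is as stated: \begin{enumerate} \item[(i)] $f(q)=\tfrac12\theta_2(q^4)\theta_3^4(q^4)\theta_4(q^8)$: $\displaystyle L(f,1)=\frac{\sqrt{\sqrt2+1}\,\Gamma^2(\frac14)}{8\sqrt{\pi}}\,{}_3F_2\!\left[\begin{matrix}\frac14,\frac12,\frac12\\ \frac38,1\end{matrix}\,\middle|\,1\right]$. \item[(ii)] $f(q)=\tfrac12\theta_2(q^4)\theta_3^3(q^4)\theta_4^2(q^4)$: $\displaystyle L(f,1)=\frac{\Gamma^2(\frac14)}{8\sqrt{2\pi}}\,{}_3F_2\!\left[\begin{matrix}\frac14,\frac12,\frac12\\ \frac34,1\end{matrix}\,\middle|\,1\right]$. \item[(iii)] $f(q)=\tfrac12\theta_2(q^4)\theta_3^2(q^4)\theta_4^3(q^4)$: $\displaystyle L(f,1)=\frac{\pi}{4\sqrt2}\,{}_3F_2\!\left[\begin{matrix}\frac14,\frac12,\frac12\\ 1,1\end{matrix}\,\middle|\,1\right]$. \item[(iv)] $f(q)=\tfrac12\theta_2(q^4)\theta_4^5(q^4)$: $\displaystyle L(f,1)=\frac{\Gamma^2(\frac14)}{16\sqrt{\pi}}\,{}_3F_2\!\left[\begin{matrix}\frac14,\frac12,\frac12\\ \frac32,1\end{matrix}\,\middle|\,1\right]$. \item[(v)] $f(q)=\tfrac12\theta_2(q^4)\theta_4^5(q^8)$: $\displaystyle L(f,1)=\frac{\sqrt{\sqrt2-1}\,\Gamma^4(\frac14)}{16\pi^2}$.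 \item[(vi)] $f(q)=\tfrac14\theta_2^2(q^2)\theta_3^3(q^2)\theta_4(q^2)$: $\displaystyle L(f,1)=\frac{\Gamma^2(\frac14)}{8\sqrt{2\pi}}\,{}_3F_2\!\left[\begin{matrix}\frac12,\frac12,\frac12\\ \frac34,1\end{matrix}\,\middle|\,1\right]$. \item[(vii)] $f(q)=\tfrac14\theta_2^2(q^2)\theta_3(q^2)\theta_4^3(q^2)$: $\displaystyle L(f,1)=\frac{\Gamma^2(\frac34)}{2\sqrt{2\pi}}\,{}_3F_2\!\left[\begin{matrix}\frac12,\frac12,\frac12\\ \frac54,1\end{matrix}\,\middle|\,1\right]$. \item[(viii)] $f(q)=\tfrac14\theta_2^2(q^2)\theta_4^4(q^2)$: $\displaystyle L(f,1)=\frac14\,{}_3F_2\!\left[\begin{matrix}\frac12,\frac12,\frac12\\ \frac32,1\end{matrix}\,\middle|\,1\right]$. \item[(ix)] $f(q)=\tfrac18\theta_2^3(q^4)\theta_3^2(q^4)\theta_4(q^4)$: $\displaystyle L(f,1)=\frac{\pi}{16\sqrt2}\,{}_3F_2\!\left[\begin{matrix}\frac34,\frac12,\frac12\\ 1,1\end{matrix}\,\middle|\,1\right]$. \item[(x)] $f(q)=\tfrac18\theta_2^3(q^4)\theta_3(q^4)\theta_4^2(q^4)$: $\displaystyle L(f,1)=\frac{\Gamma^2(\frac34)}{8\sqrt{2\pi}}\,{}_3F_2\!\left[\begin{matrix}\frac34,\frac12,\frac12\\ \frac54,1\end{matrix}\,\middle|\,1\right]$. \item[(xi)] $f(q)=\tfrac18\theta_2^3(q^4)\theta_4^3(q^4)$: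 $\displaystyle L(f,1)=\frac{\pi}{32\sqrt2}$. \item[(xii)] $f(q)=\tfrac18\theta_2^3(q^4)\theta_4^3(q^8)$: $\displaystyle L(f,1)=\frac{\Gamma(\frac18)\Gamma(\frac14)\Gamma^3(\frac38)}{128\,\pi^{5/2}}$. \item[(xiii)] $f(q)=\tfrac1{16}\theta_2^4(q)\theta_4^2(q)$: $\displaystyle L(f,1)=\frac{\pi}{16}$. \item[(xiv)] $f(q)=\tfrac1{32}\theta_2^5(q^4)\theta_4(q^4)$: $\displaystyle L(f,1)=\frac{\Gamma^2(\frac14)}{256\sqrt{\pi}}\,{}_3F_2\!\left[\begin{matrix}\frac54,\frac12,\frac12\\ \frac32,1\end{matrix}\,\middle|\,1\right]$. \item[(xv)] $f(q)=\tfrac1{32}\theta_2^5(q^4)\theta_4(q^8)$: $\displaystyle L(f,1)=\frac{\sqrt{\sqrt2+1}\,\Gamma^4(\frac14)}{128\pi^2}$. \end{enumerate}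
   Context: The Jacobi theta series are $\theta_2(q)=\sum_{n\in\mathbb Z} q^{(n+1/2)^2}$, $\theta_3(q)=\sum_{n\in\mathbb Z}q^{n^2}$, $\theta_4(q)=\sum_{n\in\mathbb Z}(-1)^n q^{n^2}$, for $0<q<1$ (each listed $f$ is a modular form of weight $3$ whose $q$-expansion has only positive integral powers of $q$). For a modular form $f(q)=\sum_{n\ge1}a_nq^n$ of weight $k$, its $L$-function is $L(f,s)=\sum_{n\ge1}a_n n^{-s}$ for $\mathrm{Re}(s)>k+1$, extended meromorphically to $\mathbb C$; $L(f,1)$ denotes the value at $s=1$ of this continuation, which equals $\int_0^1 f(q)\,\frac{dq}{q}$. The generalized hypergeometric function is ${}_{p+1}F_p\!\left[\begin{matrix}a_1,\dots,a_{p+1}\\ b_1,\dots,b_p\end{matrix}\middle| z\right]=\sum_{n\ge0}\frac{(a_1)_n\cdots(a_{p+1})_n}{(b_1)_n\cdots(b_p)_n}\frac{z^n}{n!}$, where $(a)_n=\Gamma(a+n)/\Gamma(a)$; $\Gamma$ is the gamma function. *)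

theory Defs
  imports "HOL-Complex_Analysis.Complex_Analysis"
begin

definition theta2 :: "real \<Rightarrow> real" where
  "theta2 q = (\<Sum>\<^sub>\<infinity>n\<in>(UNIV :: int set). q powr ((of_int n + 1/2) ^ 2))"

definition theta3 :: "real \<Rightarrow> real" where
  "theta3 q = (\<Sum>\<^sub>\<infinity>n\<in>(UNIV :: int set). q powr ((of_int n) ^ 2))"

definition theta4 :: "real \<Rightarrow> real" where
  "theta4 q = (\<Sum>\<^sub>\<infinity>n\<in>(UNIV :: int set). (-1) powi n * q powr ((of_int n) ^ 2))"

text \<open>The value \<^term>\<open>a 0\<close> plays no role: only positive powers of the variable occur.\<close>

definition q_expansion :: "(real \<Rightarrow> real) \<Rightarrow> (nat \<Rightarrow> real) \<Rightarrow> bool" where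
  "q_expansion f a \<longleftrightarrow> (\<forall>q. 0 < q \<and> q < 1 \<longrightarrow> (\<lambda>n. a (Suc n) * q ^ Suc n) sums f q)"

text \<open>
  The \<open>L\<close>-function of a weight \<open>k\<close> form \<open>f\<close> is the Dirichlet series of its \<open>q\<close>-expansion for
  \<open>Re s > k + 1\<close>, continued meromorphically to the whole plane. Using \<open>nicely_meromorphic_on\<close>
  excludes arbitrary values at isolated points, which makes the continuation unique as a
  function (see \<open>is_L_function_unique\<close>).
\<close>

definition is_L_function :: "nat \<Rightarrow> (real \<Rightarrow> real) \<Rightarrow> (complex \<Rightarrow> complex) \<Rightarrow> bool" where
  "is_L_function k f L \<longleftrightarrow>
     L nicely_meromorphic_on UNIV \<and>
     (\<exists>a. q_expansion f a \<and>
          (\<forall>s. Re s > real k + 1 \<longrightarrow>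
               (\<lambda>n. of_real (a (Suc n)) * of_nat (Suc n) powr (- s)) sums L s))"

definition has_L_value :: "nat \<Rightarrow> (real \<Rightarrow> real) \<Rightarrow> complex \<Rightarrow> complex \<Rightarrow> bool" where
  "has_L_value k f s v \<longleftrightarrow> (\<exists>L. is_L_function k f L \<and> \<not> is_pole L s \<and> L s = v)"

definition hypergeo :: "real list \<Rightarrow> real list \<Rightarrow> real \<Rightarrow> real" where
  "hypergeo as bs z = eval_fps (fps_hypergeo as bs 1) z"

lemma hypergeo_3F2:
  "hypergeo [a, b, c] [d, e] z =
     (\<Sum>n. pochhammer a n * pochhammer b n * pochhammer c n /
           (pochhammer d n * pochhammer e n) * z ^ n / fact n)"
  by (simp add: hypergeo_def eval_fps_def)

lemma q_expansion_unique:
  assumes "q_expansion f a" "q_expansion f b"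
  shows   "a (Suc n) = b (Suc n)"
proof (rule ccontr)
  assume ne: "a (Suc n) \<noteq> b (Suc n)"
  define d where "d = (\<lambda>m. if m = 0 then 0 else a m - b m)"
  define F where "F = (\<lambda>x. \<Sum>m. d m * x ^ m)"
  have zero: "(\<lambda>m. d m * q ^ m) sums 0" if "0 < q" "q < 1" for q :: real
  proof -
    have "(\<lambda>m. a (Suc m) * q ^ Suc m - b (Suc m) * q ^ Suc m) sums (f q - f q)"
      using assms that unfolding q_expansion_def by (intro sums_diff) auto
    hence "(\<lambda>m. d (Suc m) * q ^ Suc m) sums 0"
      by (simp add: d_def algebra_simps)
    thus ?thesis
      by (subst (asm) sums_Suc_iff) (simp add: d_def)
  qed
  have "summable (\<lambda>m. d m * x ^ m)" if "\<bar>x\<bar> < 1" for x :: real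
  proof -
    define q where "q = (\<bar>x\<bar> + 1) / 2"
    have q: "0 < q" "q < 1" "\<bar>x\<bar> < q"
      using that by (auto simp: q_def)
    show ?thesis
      by (rule powser_inside[of _ q]) (use q zero[of q] in \<open>auto simp: sums_iff\<close>)
  qed
  hence sm: "(\<lambda>m. d m * (x - 0) ^ m) sums F x" if "norm (x - 0) < 1" for x :: real
    using that by (simp add: F_def summable_sums)
  obtain r where r: "r > 0" "\<And>z. z \<in> cball 0 r - {0} \<Longrightarrow> F z \<noteq> 0"
  proof (rule powser_0_nonzero[of 1 0 d F "Suc n"])
    show "F 0 = 0"
      by (simp add: F_def d_def)
  qed (use sm ne in \<open>auto simp: d_def\<close>)
  define q where "q = min r (1/2)"
  have q: "0 < q" "q < 1" "q \<le> r"
    using r(1) by (auto simp: q_def)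
  have "F q = 0"
    using zero[OF q(1,2)] by (simp add: F_def sums_iff)
  moreover have "F q \<noteq> 0"
    using r(2)[of q] q by auto
  ultimately show False by contradiction
qed

lemma is_L_function_unique:
  assumes "is_L_function k f L" "is_L_function k f M"
  shows   "L = M"
proof -
  obtain a where L: "L nicely_meromorphic_on UNIV" and a: "q_expansion f a"
    and sL: "\<And>s. Re s > real k + 1 \<Longrightarrow>
               (\<lambda>n. of_real (a (Suc n)) * of_nat (Suc n) powr (- s)) sums L s"
    using assms(1) unfolding is_L_function_def by blast
  obtain b where M: "M nicely_meromorphic_on UNIV" and b: "q_expansion f b"
    and sM: "\<And>s. Re s > real k + 1 \<Longrightarrow>
               (\<lambda>n. of_real (b (Suc n)) * of_nat (Suc n) powr (- s)) sums M s"
    using assms(2) unfolding is_L_function_def by blast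
  have half: "L s = M s" if "Re s > real k + 1" for s
    using sL[OF that] sM[OF that] q_expansion_unique[OF a b] by (simp add: sums_unique2)
  define D where "D = remove_sings (\<lambda>s. L s - M s)"
  have mero: "(\<lambda>s. L s - M s) meromorphic_on UNIV"
    using L M by (intro meromorphic_intros) (auto simp: nicely_meromorphic_on_def)
  have iso: "isolated_singularity_at (\<lambda>s. L s - M s) z" for z
    by (rule meromorphic_on_isolated_singularity, rule meromorphic_on_subset[OF mero]) auto
  have D: "D nicely_meromorphic_on UNIV"
    unfolding D_def by (rule remove_sings_nicely_meromorphic[OF mero])
  define z0 where "z0 = complex_of_real (real k + 2)"
  have "open {s. Re s > real k + 1}"
    by (rule open_halfspace_Re_gt)
  hence "eventually (\<lambda>s. s \<in> {s. Re s > real k + 1}) (at z0)"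
    by (intro eventually_at_in_open') (auto simp: z0_def)
  moreover have "eventually (\<lambda>s. D s = L s - M s) (at z0)"
    unfolding D_def by (rule eventually_remove_sings_eq_at[OF iso])
  ultimately have "eventually (\<lambda>s. D s = 0) (at z0)"
    by eventually_elim (use half in auto)
  hence fr: "frequently (\<lambda>s. D s = 0) (at z0)"
    by (simp add: eventually_frequently)
  have D0: "D s = 0" for s
    by (rule frequently_eq_meromorphic_imp_constant[OF fr D]) auto
  have ev: "eventually (\<lambda>s. L s = M s) (at z)" for z
  proof -
    have "eventually (\<lambda>s. D s = L s - M s) (at z)"
      unfolding D_def by (rule eventually_remove_sings_eq_at[OF iso])
    thus ?thesis
      by eventually_elim (use D0 in auto)
  qed
  show "L = M"
  proof
    fix z
    have pole: "is_pole L z \<longleftrightarrow> is_pole M z"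
      by (rule is_pole_cong[OF ev refl])
    show "L z = M z"
    proof (cases "is_pole L z")
      case True
      have "\<not> (L \<midarrow>z\<rightarrow> L z)" "\<not> (M \<midarrow>z\<rightarrow> M z)"
        using True pole unfolding is_pole_def
        by (meson at_neq_bot not_tendsto_and_filterlim_at_infinity)+
      thus ?thesis
        using L M unfolding nicely_meromorphic_on_def by (metis UNIV_I)
    next
      case False
      hence "L \<midarrow>z\<rightarrow> L z" "M \<midarrow>z\<rightarrow> M z"
        using L M pole unfolding nicely_meromorphic_on_def by auto
      moreover from this(1) have "M \<midarrow>z\<rightarrow> L z"
        by (rule Lim_transform_eventually) (rule ev)
      ultimately show ?thesis
        using tendsto_unique at_neq_bot by blast
    qed
  qed
qed

lemma has_L_value_unique:
  "has_L_value k f s v \<Longrightarrow> has_L_value k f s w \<Longrightarrow> v = w"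
  unfolding has_L_value_def using is_L_function_unique by blast

end

theory Submission
  imports Defs
begin

text \<open>
  All the forms are built from theta functions by products of weight 3, and they decay rapidly at both
  ends of the unit interval, so \<open>L(f, 1)\<close> is the integral of \<open>f(q) dq/q\<close> over \<open>(0, 1)\<close>.
  In terms of \<open>\<lambda> = theta2\<^sup>4 / theta3\<^sup>4\<close> one has \<open>q d\<lambda>/dq = \<lambda> (1 - \<lambda>) theta3\<^sup>4\<close> and
  \<open>theta3\<^sup>2 = 2F1(1/2, 1/2; 1; \<lambda>)\<close>, while \<open>theta2\<close>, \<open>theta4\<close> and \<open>theta4(q\<^sup>2)\<close> are \<open>theta3\<close> times
  powers of \<open>\<lambda>\<close> and \<open>1 - \<lambda>\<close>; integrating the hypergeometric series term by term yields a beta function times a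
  3F2 at 1. The closed forms come from Watson's summation theorem. All facts about theta functions
  are extracted from the duplication formulas for \<open>q \<mapsto> q\<^sup>2\<close>: a function invariant under \<open>q \<mapsto> q\<^sup>2\<close> equals its limit
  at \<open>0\<close>, so neither Poisson summation nor product formulas are needed.
\<close>

section \<open>Hypergeometric series and beta integrals\<close>

text \<open>Weight 3 means six theta factors, and this number decides the shape of the answer: the
  integrand is theta3^6 times powers of lambda and 1 - lambda, the differential of lambda uses up
  four of the six, and the other two are exactly one 2F1. What is left is a beta weight with
  exponents A = p/4 and B = s/4 + u/8, hence the lower parameter A + B of the 3F2. The obstacle is
  the cusp q = 1. A continuation of L is demanded, and it is obtained without a functional equation:
  f(exp(-t)) is smaller than every power of t as t -> 0, so its Mellin transform is entire. A theta4
  factor forces this decay. Decay and growth bounds both come from quantities that are monotone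
  under doubling of t. The growth bound for theta3, applied to a majorant with nonnegative
  coefficients, also yields a_n = O(n^3), just enough for the Dirichlet series on Re s > 4. The
  hypergeometric integrands are nonnegative, so integrating term by term is an equivalence; the
  convergence of the 3F2 at the boundary point 1 is then a consequence of the integral and needs no
  estimate.\<close>

lemma has_integral_change_of_variables_nonneg:
  fixes f g g' :: "real \<Rightarrow> real"
  assumes "S \<in> sets lebesgue"
    and "\<And>x. x \<in> S \<Longrightarrow> (g has_field_derivative g' x) (at x within S)"
    and "inj_on g S"
    and nn: "\<And>x. x \<in> S \<Longrightarrow> 0 \<le> f (g x)"
  shows "((\<lambda>x. \<bar>g' x\<bar> * f (g x)) has_integral b) S \<longleftrightarrow> (f has_integral b) (g ` S)"
proof -
  \<comment> \<open>A nonnegative integrable function is absolutely integrable, so the theorem for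
    absolute integrals turns into an equivalence between plain \<open>has_integral\<close>
    statements.\<close>
  have "(h has_integral b) T \<longleftrightarrow> h absolutely_integrable_on T \<and> integral T h = b"
    if "\<And>x. x \<in> T \<Longrightarrow> 0 \<le> h x" for h :: "real \<Rightarrow> real" and T
    using nonnegative_absolutely_integrable_1[of h T] that absolutely_integrable_on_def
    by (auto simp: has_integral_integrable_integral set_lebesgue_integral_eq_integral(1))
  from this[of S "\<lambda>x. \<bar>g' x\<bar> * f (g x)"] this[of "g ` S" f] show ?thesis
    using has_absolute_integral_change_of_variables_1'[OF assms(1-3), of f b] nn by auto
qed

text \<open>One direction is monotone convergence. In the other, the partial sums of
  \<open>I\<close> are integrals of partial sums of \<open>F\<close>, hence bounded by
  \<open>J\<close>. Both directions matter: a summed series proves an integral, and a known integral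
  proves that a series converges.\<close>

lemma has_integral_sums_iff:
  fixes f :: "nat \<Rightarrow> 'a::euclidean_space \<Rightarrow> real"
  assumes f: "\<And>n. (f n has_integral I n) S"
    and nn: "\<And>n x. x \<in> S \<Longrightarrow> 0 \<le> f n x"
    and F: "\<And>x. x \<in> S \<Longrightarrow> (\<lambda>n. f n x) sums F x"
  shows "(F has_integral J) S \<longleftrightarrow> I sums J"
proof -
  have *: "(F has_integral K) S" if "I sums K" for K
  proof (rule has_integral_monotone_convergence_increasing)
    show "((\<lambda>x. \<Sum>n<k. f n x) has_integral (\<Sum>n<k. I n)) S" for k
      by (intro has_integral_sum f) auto
  qed (use nn F that in \<open>auto simp: sums_def\<close>)
  have I0: "0 \<le> I n" for n
    using has_integral_nonneg[OF f nn] .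
  have "summable I" if J: "(F has_integral J) S"
  proof (rule summableI_nonneg_bounded)
    show "(\<Sum>n<k. I n) \<le> J" for k
    proof (rule has_integral_le[OF _ J])
      show "((\<lambda>x. \<Sum>n<k. f n x) has_integral (\<Sum>n<k. I n)) S"
        by (intro has_integral_sum f) auto
      show "(\<Sum>n<k. f n x) \<le> F x" if "x \<in> S" for x
        using F[OF that] nn[OF that] by (metis sum_le_suminf finite_lessThan sums_iff)
    qed
  qed (use I0 in auto)
  thus ?thesis
    using * has_integral_unique summable_sums by metis
qed

section \<open>Beta integrals of power series, Euler's integral and Gauss's theorem\<close>

lemma has_integral_Beta_open:
  assumes "a > 0" "b > (0::real)"
  shows "((\<lambda>t. t powr (a - 1) * (1 - t) powr (b - 1)) has_integral Beta a b) {0<..<1}"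
  using has_integral_Beta_real[OF assms] by (simp add: has_integral_Icc_iff_Ioo)

text \<open>Each power x^n only shifts the first beta parameter. Since \<open>Beta (a + n) b\<close>
  is a quotient of Pochhammer symbols, integrating against a beta weight adds one upper and one
  lower parameter to a hypergeometric series. Every passage between integrals over lambda and series
  goes through this equivalence.\<close>

lemma has_integral_Beta_powser_iff:
  fixes F :: "real \<Rightarrow> real"
  assumes ab: "a > 0" "b > 0"
    and nn: "\<And>n. c n \<ge> 0"
    and F: "\<And>x. 0 < x \<Longrightarrow> x < 1 \<Longrightarrow> (\<lambda>n. c n * x ^ n) sums F x"
  shows "((\<lambda>x. x powr (a - 1) * (1 - x) powr (b - 1) * F x) has_integral J) {0<..<1} \<longleftrightarrow>
         (\<lambda>n. c n * Beta (a + real n) b) sums J"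
proof (rule has_integral_sums_iff)
  fix n
  have "((\<lambda>x. c n * (x powr (a + real n - 1) * (1 - x) powr (b - 1))) has_integral
          c n * Beta (a + real n) b) {0<..<1}"
    using ab by (intro has_integral_mult_right has_integral_Beta_open) auto
  thus "((\<lambda>x. x powr (a - 1) * (1 - x) powr (b - 1) * (c n * x ^ n)) has_integral
          c n * Beta (a + real n) b) {0<..<1}"
    by (rule has_integral_eq[rotated])
       (auto simp: powr_add powr_diff powr_realpow field_simps)
qed (use nn F in \<open>auto intro!: sums_mult\<close>)

lemma Beta_real_pos: "a > 0 \<Longrightarrow> b > 0 \<Longrightarrow> Beta a b > (0::real)"
  by (simp add: Beta_def Gamma_real_pos)

lemma Beta_real_add_nat:
  fixes a b :: real
  assumes "a > 0" "b > 0"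
  shows "Beta (a + real n) b = Beta a b * pochhammer a n / pochhammer (a + b) n"
proof (induction n)
  case (Suc n)
  have "Beta (a + real n + 1) b * (a + b + real n) = Beta (a + real n) b * (a + real n)"
    using Beta_plus1_left[of "a + real n" b] assms nonpos_Ints_nonpos[of "a + real n"]
    by (force simp: algebra_simps)
  hence "Beta (a + real n + 1) b = Beta (a + real n) b * (a + real n) / (a + b + real n)"
    using assms by (simp add: field_simps)
  thus ?case
    using Suc by (simp add: pochhammer_rec' add_ac mult_ac)
qed auto

lemma hypergeo_2F1:
  "hypergeo [a, b] [c] z =
     (\<Sum>n. pochhammer a n * pochhammer b n / pochhammer c n * z ^ n / fact n)"
  by (simp add: hypergeo_def eval_fps_def)

lemma binomial_pochhammer_sums:
  fixes a z :: real
  assumes "\<bar>z\<bar> < 1"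
  shows "(\<lambda>n. pochhammer a n / fact n * z ^ n) sums (1 - z) powr (- a)"
proof -
  have "(\<lambda>n. (- a gchoose n) * (- z) ^ n) sums (1 + - z) powr (- a)"
    using assms by (intro gen_binomial_real) auto
  also have "(\<lambda>n. (- a gchoose n) * (- z) ^ n) = (\<lambda>n. pochhammer a n / fact n * z ^ n)"
  proof
    fix n
    have "(- a gchoose n) * (- z) ^ n = ((-1) ^ n * (-1) ^ n) * (pochhammer a n / fact n * z ^ n)"
      unfolding gbinomial_pochhammer power_minus[of z n] by (simp only: minus_minus) simp
    thus "(- a gchoose n) * (- z) ^ n = pochhammer a n / fact n * z ^ n"
      by simp
  qed
  finally show ?thesis by simp
qed

lemma hypergeo_2F1_sums:
  assumes "a > 0" "b > 0" "c > 0" "0 < z" "z < 1"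
  shows "(\<lambda>n. pochhammer a n * pochhammer b n / (pochhammer c n * fact n) * z ^ n)
           sums hypergeo [a, b] [c] z"
proof -
  define f where "f = (\<lambda>n. pochhammer a n * pochhammer b n / (pochhammer c n * fact n) * z ^ n)"
  have pos: "f n > 0" for n
    using assms by (auto simp: f_def pochhammer_pos)
  have "((\<lambda>n. (a + real n) * (b + real n) / ((c + real n) * (1 + real n)) * z) \<longlongrightarrow> 1 * z) sequentially"
    by (intro tendsto_mult) real_asymp+
  hence "eventually (\<lambda>n. (a + real n) * (b + real n) / ((c + real n) * (1 + real n)) * z < (z + 1) / 2)
           sequentially"
    using assms by (intro order_tendstoD) auto
  then obtain N where N: "(a + real n) * (b + real n) / ((c + real n) * (1 + real n)) * z < (z + 1) / 2"
    if "n \<ge> N" for n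
    by (auto simp: eventually_at_top_linorder)
  have "summable f"
  proof (rule summable_ratio_test[of "(z + 1) / 2" N])
    fix n assume n: "n \<ge> N"
    have "f (Suc n) = (a + real n) * (b + real n) / ((c + real n) * (1 + real n)) * z * f n"
      by (simp add: f_def pochhammer_rec' mult_ac)
    also have "\<dots> \<le> (z + 1) / 2 * f n"
      using N[OF n] pos[of n] by (intro mult_right_mono) auto
    finally show "norm (f (Suc n)) \<le> (z + 1) / 2 * norm (f n)"
      using pos[of n] pos[of "Suc n"] by simp
  qed (use assms in auto)
  thus ?thesis
    by (simp add: f_def hypergeo_2F1 sums_iff divide_simps)
qed

lemma isCont_hypergeo_2F1:
  assumes "a > 0" "b > 0" "c > 0" "0 \<le> z" "z < 1"
  shows "isCont (hypergeo [a, b] [c]) z"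
proof -
  have "isCont (\<lambda>x. \<Sum>n. pochhammer a n * pochhammer b n / (pochhammer c n * fact n) * x ^ n) z"
    using hypergeo_2F1_sums[of a b c "(z + 1) / 2"] assms
    by (intro isCont_powser[where K = "(z + 1) / 2"]) (auto simp: sums_iff)
  also have "(\<lambda>x. \<Sum>n. pochhammer a n * pochhammer b n / (pochhammer c n * fact n) * x ^ n) =
               hypergeo [a, b] [c]"
    by (simp add: hypergeo_2F1 fun_eq_iff)
  finally show ?thesis .
qed

lemma hypergeo_2F1_0 [simp]: "hypergeo [a, b] [c] 0 = 1"
  by (simp add: hypergeo_def eval_fps_at_0)

lemma hypergeo_2F1_pos:
  assumes "a > 0" "b > 0" "c > 0" "0 < z" "z < 1"
  shows "hypergeo [a, b] [c] z > 0"
proof -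
  note S = hypergeo_2F1_sums[OF assms]
  have "0 < (\<Sum>n. pochhammer a n * pochhammer b n / (pochhammer c n * fact n) * z ^ n)"
    using S assms by (intro suminf_pos) (auto simp: sums_iff pochhammer_pos)
  thus ?thesis using S by (simp add: sums_iff)
qed

lemma Euler_integral_2F1:
  assumes "a > 0" "b > 0" "c > b" "0 < z" "z < 1"
  shows "((\<lambda>t. t powr (b - 1) * (1 - t) powr (c - b - 1) * (1 - z * t) powr (- a)) has_integral
            Beta b (c - b) * hypergeo [a, b] [c] z) {0<..<1}"
proof (subst has_integral_Beta_powser_iff[where c = "\<lambda>n. pochhammer a n / fact n * z ^ n"])
  show "(\<lambda>n. pochhammer a n / fact n * z ^ n * x ^ n) sums (1 - z * x) powr (- a)"
    if "0 < x" "x < 1" for x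
  proof -
    have "z * x < 1 * 1"
      using assms that by (intro mult_strict_mono) auto
    thus ?thesis
      using binomial_pochhammer_sums[of "z * x" a] that assms by (simp add: power_mult_distrib mult_ac)
  qed
  have "(\<lambda>n. Beta b (c - b) * (pochhammer a n * pochhammer b n / (pochhammer c n * fact n) * z ^ n))
          sums (Beta b (c - b) * hypergeo [a, b] [c] z)"
    using assms by (intro sums_mult hypergeo_2F1_sums) auto
  thus "(\<lambda>n. pochhammer a n / fact n * z ^ n * Beta (b + real n) (c - b)) sums
          (Beta b (c - b) * hypergeo [a, b] [c] z)"
    using assms by (simp add: Beta_real_add_nat mult_ac)
qed (use assms in \<open>auto simp: pochhammer_nonneg\<close>)

text \<open>At z = 1 the factor (1 - z t)^(-a) of Euler's integral merges with the beta weight, so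
  the integral is itself a beta function. Read from the integral to the series, the equivalence
  gives both the convergence at 1 and the value.\<close>

lemma Gauss_2F1_sums:
  assumes "a > 0" "b > 0" "c > a + b"
  shows "(\<lambda>n. pochhammer a n * pochhammer b n / (pochhammer c n * fact n)) sums
           (Gamma c * Gamma (c - a - b) / (Gamma (c - a) * Gamma (c - b)) :: real)"
proof -
  have "((\<lambda>t. t powr (b - 1) * (1 - t) powr (c - b - a - 1)) has_integral Beta b (c - b - a)) {0<..<1}"
    using assms by (intro has_integral_Beta_open) auto
  hence "((\<lambda>t. t powr (b - 1) * (1 - t) powr (c - b - 1) * (1 - t) powr (- a)) has_integral
           Beta b (c - b - a)) {0<..<1}"
    by (rule has_integral_eq[rotated]) (auto simp flip: powr_add simp: algebra_simps)
  hence "(\<lambda>n. pochhammer a n / fact n * Beta (b + real n) (c - b)) sums Beta b (c - b - a)"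
    using assms binomial_pochhammer_sums[of _ a]
    by (subst (asm) has_integral_Beta_powser_iff[where c = "\<lambda>n. pochhammer a n / fact n"])
       (auto simp: pochhammer_nonneg)
  hence "(\<lambda>n. pochhammer a n / fact n * Beta (b + real n) (c - b) / Beta b (c - b)) sums
           (Beta b (c - b - a) / Beta b (c - b))"
    by (rule sums_divide)
  moreover have "Beta b (c - b) \<noteq> 0"
    using Beta_real_pos[of b "c - b"] assms by simp
  moreover have "Beta b (c - b - a) / Beta b (c - b) =
      Gamma c * Gamma (c - a - b) / (Gamma (c - a) * Gamma (c - b))"
    using assms Gamma_real_pos[of b, THEN less_imp_neq] Gamma_real_pos[of c, THEN less_imp_neq]
      Gamma_real_pos[of "c - b", THEN less_imp_neq]
    by (simp add: Beta_def divide_simps diff_diff_eq add.commute)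
  ultimately show ?thesis
    using assms by (simp add: Beta_real_add_nat mult_ac)
qed

section \<open>The quadratic transformation and Watson's theorem\<close>

lemma has_integral_symmetric_Beta_even_power:
  assumes "c > (0::real)"
  shows "((\<lambda>t. t powr (c - 1) * (1 - t) powr (c - 1) * (1 - 2 * t) ^ (2 * m)) has_integral
           Beta c c * pochhammer (1/2) m / pochhammer (c + 1/2) m) {0<..<1}"
  using assms
proof (induction m arbitrary: c)
  case 0
  thus ?case using has_integral_Beta_open[of c c] by simp
next
  case (Suc m)
  let ?P = "pochhammer (c + 1/2) m"
  have P: "?P > 0" using Suc.prems by (auto intro: pochhammer_pos)
  \<comment> \<open>The induction rests on (1 - 2 t)^2 = 1 - 4 t (1 - t): the factor t (1 - t)
    raises \<open>c\<close> to \<open>c + 1\<close> in the weight, which is why \<open>c\<close> is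
    arbitrary in the induction.\<close>
  have "((\<lambda>t. t powr (c - 1) * (1 - t) powr (c - 1) * (1 - 2 * t) ^ (2 * m) -
           4 * (t powr (c + 1 - 1) * (1 - t) powr (c + 1 - 1) * (1 - 2 * t) ^ (2 * m)))
         has_integral (Beta c c * pochhammer (1/2) m / ?P -
           4 * (Beta (c + 1) (c + 1) * pochhammer (1/2) m / pochhammer (c + 1 + 1/2) m))) {0<..<1}"
    using Suc.prems by (intro has_integral_diff has_integral_mult_right Suc.IH) auto
  moreover have "Beta c c * pochhammer (1/2) m / ?P -
           4 * (Beta (c + 1) (c + 1) * pochhammer (1/2) m / pochhammer (c + 1 + 1/2) m) =
         Beta c c * pochhammer (1/2) (Suc m) / pochhammer (c + 1/2) (Suc m)"
  proof -
    have B: "Beta (c + 1) (c + 1) = Beta c c * c / (2 * (2 * c + 1))"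
    proof -
      have "Beta (c + 1) c * (2 * c) = Beta c c * c"
        using Beta_plus1_left[of c c] Suc.prems nonpos_Ints_nonpos[of c] by (force simp: algebra_simps)
      moreover have "Beta (c + 1) (c + 1) * (2 * c + 1) = Beta (c + 1) c * c"
        using Beta_plus1_right[of c "c + 1"] Suc.prems nonpos_Ints_nonpos[of c] by (force simp: algebra_simps)
      moreover have "Beta (c + 1) c = Beta c c / 2"
        using calculation(1) Suc.prems by (simp add: field_simps)
      ultimately have "(2 * c + 1) * Beta (c + 1) (c + 1) = Beta c c / 2 * c"
        by (simp only: mult.commute)
      moreover have "(2 * c + 1) \<noteq> 0" using Suc.prems by simp
      ultimately show ?thesis
        by (simp add: eq_divide_eq algebra_simps)
    qed
    have Q: "pochhammer (c + 1 + 1/2) m = ?P * (c + 1/2 + real m) / (c + 1/2)"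
      using pochhammer_rec[of "c + 1/2" m] pochhammer_rec'[of "c + 1/2" m] Suc.prems
      by (simp add: field_simps)
    have "4 * (Beta (c + 1) (c + 1) * pochhammer (1/2) m / pochhammer (c + 1 + 1/2) m) =
          Beta c c * pochhammer (1/2) m / ?P * (c / (c + 1/2 + real m))"
      unfolding B Q using Suc.prems P by (simp add: divide_simps)
    hence "Beta c c * pochhammer (1/2) m / ?P -
           4 * (Beta (c + 1) (c + 1) * pochhammer (1/2) m / pochhammer (c + 1 + 1/2) m) =
          Beta c c * pochhammer (1/2) m / ?P * (1 - c / (c + 1/2 + real m))"
      by (simp only: right_diff_distrib mult_1_right)
    also have "1 - c / (c + 1/2 + real m) = (1/2 + real m) / (c + 1/2 + real m)"
      using Suc.prems by (simp add: field_simps)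
    finally show ?thesis by (simp add: pochhammer_rec' mult_ac)
  qed
  ultimately have "((\<lambda>t. t powr (c - 1) * (1 - t) powr (c - 1) * (1 - 2 * t) ^ (2 * m) -
           4 * (t powr (c + 1 - 1) * (1 - t) powr (c + 1 - 1) * (1 - 2 * t) ^ (2 * m)))
         has_integral Beta c c * pochhammer (1/2) (Suc m) / pochhammer (c + 1/2) (Suc m)) {0<..<1}"
    by simp
  thus ?case
  proof (rule has_integral_eq[rotated])
    fix t :: real assume "t \<in> {0<..<1}"
    define u v where "u = t powr (c - 1)" and "v = (1 - t) powr (c - 1)"
    have "t powr (c + 1 - 1) = u * t" "(1 - t) powr (c + 1 - 1) = v * (1 - t)"
      using powr_add[of t "c - 1" 1] powr_add[of "1 - t" "c - 1" 1] \<open>t \<in> {0<..<1}\<close>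
      by (auto simp: u_def v_def)
    moreover have "(1 - 2 * t) ^ (2 * Suc m) = (1 - 4 * t * (1 - t)) * (1 - 2 * t) ^ (2 * m)"
      by (simp add: power2_eq_square algebra_simps)
    ultimately show "t powr (c - 1) * (1 - t) powr (c - 1) * (1 - 2 * t) ^ (2 * m) -
           4 * (t powr (c + 1 - 1) * (1 - t) powr (c + 1 - 1) * (1 - 2 * t) ^ (2 * m)) =
          t powr (c - 1) * (1 - t) powr (c - 1) * (1 - 2 * t) ^ (2 * Suc m)"
      unfolding u_def[symmetric] v_def[symmetric] by (simp only:) (simp add: algebra_simps)
  qed
qed


lemma has_integral_reflect_unit:
  fixes f :: "real \<Rightarrow> real"
  assumes "(f has_integral J) {0<..<1}"
  shows "((\<lambda>t. f (1 - t)) has_integral J) {0<..<1}"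
proof -
  have "((\<lambda>x. f ((-1) *\<^sub>R x + 1)) has_integral (1 / (\<bar>-1\<bar> ^ DIM(real))) *\<^sub>R J)
          ((\<lambda>x. (1 / -1) *\<^sub>R x + - ((1 / -1) *\<^sub>R 1)) ` cbox 0 1)"
    using assms by (intro has_integral_affinity) (auto simp: has_integral_Icc_iff_Ioo)
  moreover have "(\<lambda>x. (1 / -1) *\<^sub>R x + - ((1 / -1) *\<^sub>R 1)) ` cbox 0 (1::real) = {0..1}"
    by (auto simp: image_iff intro!: bexI[of _ "1 - x" for x])
  ultimately show ?thesis
    by (simp add: has_integral_Icc_iff_Ioo)
qed

text \<open>
  Under \<open>t \<mapsto> 1 - t\<close> the Euler integral becomes an even function of \<open>1 - 2 t\<close>,
  because \<open>1 - z t = (1 - z/2) (1 + w (1 - 2 t))\<close> with \<open>w = z / (2 - z)\<close>.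
\<close>

lemma hypergeo_2F1_quadratic:
  assumes "a > 0" "c > 0" "0 < z" "z < 1"
  shows "hypergeo [a, c] [2 * c] z =
           (1 - z / 2) powr (- a) * hypergeo [a / 2, (a + 1) / 2] [c + 1/2] ((z / (2 - z))\<^sup>2)"
proof -
  define w where "w = z / (2 - z)"
  have w: "0 < w" "w < 1" using assms by (auto simp: w_def field_simps)
  define \<phi> where "\<phi> = (\<lambda>t. t powr (c - 1) * (1 - t) powr (c - 1) * (1 - z * t) powr (- a))"
  define J where "J = Beta c c * hypergeo [a, c] [2 * c] z"
  have \<phi>: "(\<phi> has_integral J) {0<..<1}"
    using Euler_integral_2F1[of a c "2 * c" z] assms by (simp add: \<phi>_def J_def)
  \<comment> \<open>The even part of (1 + w x)^(-a). Averaging over t and 1 - t leaves only even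
    powers of x = 1 - 2 t, all with nonnegative coefficients; the unaveraged expansion has terms of
    both signs, to which monotone convergence does not apply.\<close>
  define E where "E = (\<lambda>x. ((1 - w * x) powr (- a) + (1 + w * x) powr (- a)) / 2)"
  have sym: "((\<lambda>t. (\<phi> t + \<phi> (1 - t)) / 2) has_integral (J + J) / 2) {0<..<1}"
    by (intro has_integral_divide has_integral_add has_integral_reflect_unit \<phi>)
  have eq: "(\<phi> t + \<phi> (1 - t)) / 2 =
            (1 - z / 2) powr (- a) * (t powr (c - 1) * (1 - t) powr (c - 1) * E (1 - 2 * t))"
    if t: "t \<in> {0<..<1}" for t
  proof -
    have wt: "w * \<bar>1 - 2 * t\<bar> < 1 * 1"
      using w t by (intro mult_strict_mono) auto
    hence "\<bar>w * (1 - 2 * t)\<bar> < 1" using w by (simp add: abs_mult)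
    hence pos: "1 + w * (1 - 2 * t) > 0" "1 - w * (1 - 2 * t) > 0" by linarith+
    have "1 - z * t = (1 - z / 2) * (1 + w * (1 - 2 * t))"
         "1 - z * (1 - t) = (1 - z / 2) * (1 - w * (1 - 2 * t))"
      using assms by (auto simp: w_def field_simps)
    thus ?thesis
      using pos assms unfolding \<phi>_def E_def
      by (simp add: powr_mult) (simp add: algebra_simps add_divide_distrib)
  qed
  have E: "((\<lambda>t. t powr (c - 1) * (1 - t) powr (c - 1) * E (1 - 2 * t)) has_integral
             J * (1 - z / 2) powr a) {0<..<1}"
  proof -
    have "((\<lambda>t. (1 - z / 2) powr a * ((\<phi> t + \<phi> (1 - t)) / 2)) has_integral
            (1 - z / 2) powr a * ((J + J) / 2)) {0<..<1}"
      by (intro has_integral_mult_right sym)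
    moreover have P: "(1 - z / 2) powr a * (1 - z / 2) powr - a = 1"
      using assms by (simp flip: powr_add)
    ultimately have "((\<lambda>t. (1 - z / 2) powr a * ((\<phi> t + \<phi> (1 - t)) / 2)) has_integral
            J * (1 - z / 2) powr a) {0<..<1}"
      by (simp add: mult.commute)
    thus ?thesis
    proof (rule has_integral_eq[rotated])
      fix t :: real assume "t \<in> {0<..<1}"
      from eq[OF this] have "(1 - z / 2) powr a * ((\<phi> t + \<phi> (1 - t)) / 2) =
          ((1 - z / 2) powr a * (1 - z / 2) powr - a) * (t powr (c - 1) * (1 - t) powr (c - 1) * E (1 - 2 * t))"
        by (simp only: mult.assoc)
      thus "(1 - z / 2) powr a * ((\<phi> t + \<phi> (1 - t)) / 2) =
          t powr (c - 1) * (1 - t) powr (c - 1) * E (1 - 2 * t)"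
        unfolding P by simp
    qed
  qed
  define e where "e = (\<lambda>m. pochhammer a (2 * m) / fact (2 * m) * w ^ (2 * m))"
  have "((\<lambda>t. t powr (c - 1) * (1 - t) powr (c - 1) * E (1 - 2 * t)) has_integral
             J * (1 - z / 2) powr a) {0<..<1} \<longleftrightarrow>
        (\<lambda>m. e m * (Beta c c * pochhammer (1/2) m / pochhammer (c + 1/2) m)) sums
             (J * (1 - z / 2) powr a)"
  proof (rule has_integral_sums_iff)
    show "((\<lambda>t. e m * (t powr (c - 1) * (1 - t) powr (c - 1) * (1 - 2 * t) ^ (2 * m))) has_integral
             e m * (Beta c c * pochhammer (1/2) m / pochhammer (c + 1/2) m)) {0<..<1}" for m
      using assms by (intro has_integral_mult_right has_integral_symmetric_Beta_even_power)
    show "0 \<le> e m * (t powr (c - 1) * (1 - t) powr (c - 1) * (1 - 2 * t) ^ (2 * m))" for m and t :: real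
      unfolding e_def using assms w by (intro mult_nonneg_nonneg divide_nonneg_nonneg pochhammer_nonneg) auto
    fix t :: real assume t: "t \<in> {0<..<1}"
    define x where "x = 1 - 2 * t"
    have "w * \<bar>x\<bar> < 1 * 1"
      using w t by (intro mult_strict_mono) (auto simp: x_def)
    hence x: "\<bar>w * x\<bar> < 1" using w by (simp add: abs_mult)
    define b where "b = (\<lambda>n. pochhammer a n / fact n * (w * x) ^ n)"
    have "b sums (1 - w * x) powr (- a)"
      using binomial_pochhammer_sums[OF x] by (simp add: b_def)
    moreover have "(\<lambda>n. (-1) ^ n * b n) sums (1 + w * x) powr (- a)"
      using binomial_pochhammer_sums[of "- (w * x)" a] x
      by (simp add: b_def power_minus[of "w * x"] mult_ac)
    ultimately have "(\<lambda>n. (b n + (-1) ^ n * b n) / 2) sums E x"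
      unfolding E_def by (intro sums_divide sums_add)
    hence "(\<lambda>m. (b (2 * m) + (-1) ^ (2 * m) * b (2 * m)) / 2) sums E x"
      by (subst (asm) sums_mono_reindex[of "\<lambda>m. 2 * m", symmetric])
         (auto simp: strict_mono_def image_iff minus_one_power_iff elim: evenE)
    hence "(\<lambda>m. e m * x ^ (2 * m)) sums E x"
      by (simp add: b_def e_def power_mult_distrib mult_ac)
    thus "(\<lambda>m. e m * (t powr (c - 1) * (1 - t) powr (c - 1) * (1 - 2 * t) ^ (2 * m))) sums
            (t powr (c - 1) * (1 - t) powr (c - 1) * E (1 - 2 * t))"
      using sums_mult[of _ "E x" "t powr (c - 1) * (1 - t) powr (c - 1)"]
      unfolding x_def by (simp only: mult.left_commute[of "e _"])
  qed
  with E have S: "(\<lambda>m. e m * (Beta c c * pochhammer (1/2) m / pochhammer (c + 1/2) m)) sums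
             (J * (1 - z / 2) powr a)" by blast
  \<comment> \<open>The duplication formulas for (a)_(2m) and (2m)! produce the parameters a/2 and
    (a + 1)/2; the factor (1/2)_m inside (2m)! cancels the one from the integral.\<close>
  have em: "e m * (Beta c c * pochhammer (1/2) m / pochhammer (c + 1/2) m) =
        Beta c c * (pochhammer (a / 2) m * pochhammer ((a + 1) / 2) m /
          (pochhammer (c + 1/2) m * fact m) * (w\<^sup>2) ^ m)" for m
  proof -
    have "pochhammer a (2 * m) = 4 ^ m * pochhammer (a / 2) m * pochhammer ((a + 1) / 2) m"
      using pochhammer_double[of "a / 2" m] by (simp add: power_mult add_divide_distrib)
    moreover have "fact (2 * m) = (4 ^ m * pochhammer (1 / 2) m * fact m :: real)"
      using fact_double[of m, where 'a = real] by (simp add: power_mult)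
    moreover have "pochhammer (1 / 2) m \<noteq> (0::real)"
      using pochhammer_pos[of "1/2::real" m] by simp
    ultimately show ?thesis
      by (simp add: e_def power_mult) (simp add: mult_ac)
  qed
  have "(\<lambda>m. Beta c c * (pochhammer (a / 2) m * pochhammer ((a + 1) / 2) m /
          (pochhammer (c + 1/2) m * fact m) * (w\<^sup>2) ^ m)) sums
        (Beta c c * hypergeo [a / 2, (a + 1) / 2] [c + 1/2] (w\<^sup>2))"
    using assms w by (intro sums_mult hypergeo_2F1_sums) (auto simp: power_less_one_iff)
  with S have "J * (1 - z / 2) powr a = Beta c c * hypergeo [a / 2, (a + 1) / 2] [c + 1/2] (w\<^sup>2)"
    unfolding em using sums_unique2 by blast
  hence "hypergeo [a, c] [2 * c] z * (1 - z / 2) powr a =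
         hypergeo [a / 2, (a + 1) / 2] [c + 1/2] (w\<^sup>2)"
    using Beta_real_pos[of c c] assms by (simp add: J_def)
  thus ?thesis
    using assms by (simp add: w_def powr_minus field_simps)
qed

text \<open>The series is the beta integral of 2F1(a, c; 2c; t) with exponents b and \<delta>. The
  substitution t = 2 s/(1 + s) brings in the quadratic transformation with argument s^2, and y = s^2
  makes a beta integral again, whose series Gauss's theorem sums. The argument is written from the
  Gauss end backwards. \<open>b < a + 1\<close> is \<delta> > 0, integrability at t = 1;
  \<open>a + b < 2 * c + 1\<close> is the convergence condition of the Gauss series.\<close>

theorem Watson_3F2_sums:
  fixes a b c :: real
  assumes abc: "a > 0" "b > 0" "c > 0" and conv: "b < a + 1" "a + b < 2 * c + 1"
  shows "(\<lambda>n. pochhammer a n * pochhammer b n * pochhammer c n /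
            (pochhammer ((a + b + 1) / 2) n * pochhammer (2 * c) n * fact n)) sums
         (2 powr (b - 1) * Beta (b / 2) ((a - b + 1) / 2) / Beta b ((a - b + 1) / 2) *
          (Gamma (c + 1/2) * Gamma (c + 1/2 - a / 2 - b / 2) /
             (Gamma (c + 1/2 - a / 2) * Gamma (c + 1/2 - b / 2))))"
proof -
  define \<delta> where "\<delta> = (a - b + 1) / 2"
  have \<delta>: "\<delta> > 0" using conv by (simp add: \<delta>_def)
  define W where "W = Gamma (c + 1/2) * Gamma (c + 1/2 - a / 2 - b / 2) /
             (Gamma (c + 1/2 - a / 2) * Gamma (c + 1/2 - b / 2))"
  define H where "H = hypergeo [a / 2, (a + 1) / 2] [c + 1/2]"
  define h where "h = (\<lambda>n. pochhammer (a / 2) n * pochhammer ((a + 1) / 2) n / (pochhammer (c + 1/2) n * fact n))"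
  have H_pos: "H y > 0" if "0 < y" "y < 1" for y
    using hypergeo_2F1_pos[of "a / 2" "(a + 1) / 2" "c + 1/2" y] that abc by (simp add: H_def)
  have 1: "((\<lambda>y. y powr (b / 2 - 1) * (1 - y) powr (\<delta> - 1) * H y) has_integral
             Beta (b / 2) \<delta> * W) {0<..<1}"
  proof (subst has_integral_Beta_powser_iff[where c = h])
    show "(\<lambda>n. h n * x ^ n) sums H x" if "0 < x" "x < 1" for x
      unfolding h_def H_def using that abc by (intro hypergeo_2F1_sums) auto
    have "(\<lambda>n. Beta (b / 2) \<delta> * (pochhammer (a / 2) n * pochhammer (b / 2) n /
              (pochhammer (c + 1/2) n * fact n))) sums (Beta (b / 2) \<delta> * W)"
      unfolding W_def using abc conv by (intro sums_mult Gauss_2F1_sums) auto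
    also have "(\<lambda>n. Beta (b / 2) \<delta> * (pochhammer (a / 2) n * pochhammer (b / 2) n /
              (pochhammer (c + 1/2) n * fact n))) = (\<lambda>n. h n * Beta (b / 2 + real n) \<delta>)"
    proof
      fix n
      \<comment> \<open>The point of the choice of \<delta>: the lower parameter created by
        integration cancels the upper parameter (a + 1)/2, and a 3F2 drops to a 2F1.\<close>
      have "b / 2 + \<delta> = (a + 1) / 2" by (simp add: \<delta>_def field_simps)
      moreover have "pochhammer ((a + 1) / 2) n > 0" using abc by (intro pochhammer_pos) auto
      moreover have "Beta (b / 2 + real n) \<delta> =
          Beta (b / 2) \<delta> * pochhammer (b / 2) n / pochhammer (b / 2 + \<delta>) n"
        using abc \<delta> by (intro Beta_real_add_nat) auto
      ultimately show "Beta (b / 2) \<delta> * (pochhammer (a / 2) n * pochhammer (b / 2) n /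
              (pochhammer (c + 1/2) n * fact n)) = h n * Beta (b / 2 + real n) \<delta>"
        by (simp only: h_def) simp
    qed
    finally show "(\<lambda>n. h n * Beta (b / 2 + real n) \<delta>) sums (Beta (b / 2) \<delta> * W)" .
  qed (use abc \<delta> in \<open>auto simp: h_def intro!: divide_nonneg_nonneg mult_nonneg_nonneg pochhammer_nonneg\<close>)
  have "((\<lambda>s. \<bar>2 * s\<bar> * ((s\<^sup>2) powr (b / 2 - 1) * (1 - s\<^sup>2) powr (\<delta> - 1) * H (s\<^sup>2))) has_integral
             Beta (b / 2) \<delta> * W) {0<..<1}"
  proof (subst has_integral_change_of_variables_nonneg
      [where g = "\<lambda>s. s\<^sup>2" and f = "\<lambda>y. y powr (b / 2 - 1) * (1 - y) powr (\<delta> - 1) * H y"])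
    have "(\<lambda>x. x\<^sup>2) ` {0<..<1::real} = {0<..<1}"
    proof (intro equalityI subsetI)
      fix x :: real assume "x \<in> {0<..<1}"
      thus "x \<in> (\<lambda>x. x\<^sup>2) ` {0<..<1}"
        by (intro image_eqI[of _ _ "sqrt x"]) auto
    qed (auto simp: power_less_one_iff)
    thus "((\<lambda>y. y powr (b / 2 - 1) * (1 - y) powr (\<delta> - 1) * H y) has_integral
             Beta (b / 2) \<delta> * W) ((\<lambda>x. x\<^sup>2) ` {0<..<1})" using 1 by simp
  qed (auto intro!: derivative_eq_intros inj_onI mult_nonneg_nonneg less_imp_le[OF H_pos]
            simp: power_less_one_iff power2_eq_iff)
  hence "((\<lambda>s. 2 powr (b - 1) * (\<bar>2 * s\<bar> * ((s\<^sup>2) powr (b / 2 - 1) * (1 - s\<^sup>2) powr (\<delta> - 1) * H (s\<^sup>2)))) has_integral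
             2 powr (b - 1) * (Beta (b / 2) \<delta> * W)) {0<..<1}"
    by (rule has_integral_mult_right)
  hence 2: "((\<lambda>s. \<bar>2 / (1 + s)\<^sup>2\<bar> * ((2 * s / (1 + s)) powr (b - 1) * (1 - 2 * s / (1 + s)) powr (\<delta> - 1) *
                hypergeo [a, c] [2 * c] (2 * s / (1 + s)))) has_integral
             2 powr (b - 1) * (Beta (b / 2) \<delta> * W)) {0<..<1}"
  proof (rule has_integral_eq[rotated])
    fix s :: real assume "s \<in> {0<..<1}"
    hence s: "0 < s" "s < 1" by auto
    have t0: "1 - 2 * s / (1 + s) = (1 - s) / (1 + s)" using s by (simp add: field_simps)
    have t1: "1 - 2 * s / (1 + s) / 2 = 1 / (1 + s)" using s by (simp add: field_simps)
    \<comment> \<open>The substitution inverts z -> z/(2 - z), so the argument of the transformed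
      2F1 is exactly s^2.\<close>
    have t2: "2 * s / (1 + s) / (2 - 2 * s / (1 + s)) = s" using s by (simp add: field_simps)
    have "0 < 2 * s / (1 + s)" "2 * s / (1 + s) < 1" using s by (auto simp: field_simps)
    hence "hypergeo [a, c] [2 * c] (2 * s / (1 + s)) = (1 / (1 + s)) powr (- a) * H (s\<^sup>2)"
      using abc by (subst hypergeo_2F1_quadratic) (simp_all only: t1 t2 H_def)
    hence G: "hypergeo [a, c] [2 * c] (2 * s / (1 + s)) = (1 + s) powr a * H (s\<^sup>2)"
      using s by (simp add: powr_minus powr_divide)
    have "1 - s\<^sup>2 = (1 - s) * (1 + s)" by (simp add: power2_eq_square algebra_simps)
    hence A: "(1 - s\<^sup>2) powr (\<delta> - 1) = (1 - s) powr (\<delta> - 1) * (1 + s) powr (\<delta> - 1)"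
      using s by (simp add: powr_mult)
    have B: "s * (s\<^sup>2) powr (b / 2 - 1) = s powr (b - 1)"
      using s powr_powr[of s 2 "b / 2 - 1"] powr_add[of s 1 "b - 2"] by (simp add: powr_numeral)
    \<comment> \<open>Bookkeeping of the powers of 1 + s from the weight, the Jacobian and the
      quadratic transformation: together they leave (1 + s)^(\<delta> - 1), which completes (1 -
      s)^(\<delta> - 1) to a power of 1 - s^2.\<close>
    have "b - 1 + (\<delta> - 1) + 2 = a - (\<delta> - 1)"
      by (simp add: \<delta>_def field_simps)
    hence "(1 + s) powr (b - 1) * (1 + s) powr (\<delta> - 1) * (1 + s) powr 2 = (1 + s) powr a / (1 + s) powr (\<delta> - 1)"
      by (simp only: powr_add[symmetric] powr_diff[symmetric])
    hence C: "(1 + s) powr a / ((1 + s) powr (b - 1) * (1 + s) powr (\<delta> - 1) * (1 + s)\<^sup>2) = (1 + s) powr (\<delta> - 1)"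
      using s by (simp add: powr_numeral)
    have "\<bar>2 / (1 + s)\<^sup>2\<bar> * ((2 * s / (1 + s)) powr (b - 1) * (1 - 2 * s / (1 + s)) powr (\<delta> - 1) *
                hypergeo [a, c] [2 * c] (2 * s / (1 + s))) =
          2 powr (b - 1) * 2 * s powr (b - 1) * (1 - s) powr (\<delta> - 1) * H (s\<^sup>2) *
            ((1 + s) powr a / ((1 + s) powr (b - 1) * (1 + s) powr (\<delta> - 1) * (1 + s)\<^sup>2))"
      unfolding G t0 using s by (simp add: powr_divide powr_mult mult_ac)
    thus "2 powr (b - 1) * (\<bar>2 * s\<bar> * ((s\<^sup>2) powr (b / 2 - 1) * (1 - s\<^sup>2) powr (\<delta> - 1) * H (s\<^sup>2))) =
        \<bar>2 / (1 + s)\<^sup>2\<bar> * ((2 * s / (1 + s)) powr (b - 1) * (1 - 2 * s / (1 + s)) powr (\<delta> - 1) *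
                hypergeo [a, c] [2 * c] (2 * s / (1 + s)))"
      unfolding C A B[symmetric] using s by (simp add: mult_ac)
  qed
  have 3: "((\<lambda>t. t powr (b - 1) * (1 - t) powr (\<delta> - 1) * hypergeo [a, c] [2 * c] t) has_integral
             2 powr (b - 1) * (Beta (b / 2) \<delta> * W)) {0<..<1}"
  proof -
    have img: "(\<lambda>s. 2 * s / (1 + s)) ` {0<..<1::real} = {0<..<1}"
    proof (intro equalityI subsetI)
      fix x :: real assume "x \<in> {0<..<1}"
      thus "x \<in> (\<lambda>s. 2 * s / (1 + s)) ` {0<..<1}"
        by (intro image_eqI[of _ _ "x / (2 - x)"]) (auto simp: field_simps)
    qed (auto simp: field_simps)
    have "((\<lambda>t. t powr (b - 1) * (1 - t) powr (\<delta> - 1) * hypergeo [a, c] [2 * c] t) has_integral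
             2 powr (b - 1) * (Beta (b / 2) \<delta> * W)) ((\<lambda>s. 2 * s / (1 + s)) ` {0<..<1})"
    proof (subst has_integral_change_of_variables_nonneg[symmetric])
      show "inj_on (\<lambda>s. 2 * s / (1 + s)) {0<..<1::real}"
        by (auto intro!: inj_onI simp: field_simps)
      show "((\<lambda>s. 2 * s / (1 + s)) has_field_derivative 2 / (1 + x)\<^sup>2) (at x within {0<..<1})"
        if "x \<in> {0<..<1}" for x :: real
        using that by (auto intro!: derivative_eq_intros simp: power2_eq_square)
      show "0 \<le> (2 * x / (1 + x)) powr (b - 1) * (1 - 2 * x / (1 + x)) powr (\<delta> - 1) *
              hypergeo [a, c] [2 * c] (2 * x / (1 + x))" if "x \<in> {0<..<1}" for x
        using that abc by (intro mult_nonneg_nonneg less_imp_le[OF hypergeo_2F1_pos]) auto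
    qed (use 2 in auto)
    thus ?thesis unfolding img .
  qed
  define g where "g = (\<lambda>n. pochhammer a n * pochhammer c n / (pochhammer (2 * c) n * fact n))"
  have "(\<lambda>n. g n * Beta (b + real n) \<delta>) sums (2 powr (b - 1) * (Beta (b / 2) \<delta> * W))"
  proof (subst has_integral_Beta_powser_iff[symmetric])
    show "(\<lambda>n. g n * x ^ n) sums hypergeo [a, c] [2 * c] x" if "0 < x" "x < 1" for x
      unfolding g_def using that abc by (intro hypergeo_2F1_sums) auto
  qed (use 3 abc \<delta> in \<open>auto simp: g_def intro!: divide_nonneg_nonneg mult_nonneg_nonneg pochhammer_nonneg\<close>)
  hence "(\<lambda>n. g n * Beta (b + real n) \<delta> / Beta b \<delta>) sums (2 powr (b - 1) * (Beta (b / 2) \<delta> * W) / Beta b \<delta>)"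
    by (rule sums_divide)
  also have "(\<lambda>n. g n * Beta (b + real n) \<delta> / Beta b \<delta>) =
       (\<lambda>n. pochhammer a n * pochhammer b n * pochhammer c n /
            (pochhammer ((a + b + 1) / 2) n * pochhammer (2 * c) n * fact n))"
  proof
    fix n
    have e: "(a + b + 1) / 2 = b + \<delta>" by (simp add: \<delta>_def field_simps)
    show "g n * Beta (b + real n) \<delta> / Beta b \<delta> = pochhammer a n * pochhammer b n * pochhammer c n /
            (pochhammer ((a + b + 1) / 2) n * pochhammer (2 * c) n * fact n)"
      unfolding e using Beta_real_add_nat[of b \<delta> n] Beta_real_pos[of b \<delta>] abc \<delta> by (simp add: g_def mult_ac)
  qed
  finally show ?thesis
    by (simp add: W_def \<delta>_def mult_ac)
qed

text \<open>Gauss's substitution \<open>t = (1 + x)\<^sup>2 s / (1 + x s)\<^sup>2\<close> carries one Euler integral into the other.\<close>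

lemma hypergeo_Landen:
  assumes "0 < x" "x < (1::real)"
  shows "hypergeo [1/2, 1/2] [1] (4 * x / (1 + x)\<^sup>2) = (1 + x) * hypergeo [1/2, 1/2] [1] (x\<^sup>2)"
proof -
  define z where "z = 4 * x / (1 + x)\<^sup>2"
  have "0 < (1 - x)\<^sup>2" using assms by simp
  hence z: "0 < z" "z < 1"
    using assms by (auto simp: z_def field_simps power2_eq_square)
  define g where "g = (\<lambda>s. (1 + x)\<^sup>2 * s / (1 + x * s)\<^sup>2)"
  define g' where "g' = (\<lambda>s. (1 + x)\<^sup>2 * (1 - x * s) / (1 + x * s) ^ 3)"
  define \<phi> where "\<phi> = (\<lambda>z t. t powr (-1/2) * (1 - t) powr (-1/2) * (1 - z * t) powr (-1/2 :: real))"
  have xs: "0 < x * s" "x * s < 1" if "0 < s" "s < 1" for s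
    using mult_strict_mono[of x 1 s 1] that assms by auto
  \<comment> \<open>Under the substitution 1 - z g(s) becomes a perfect square, whose root cancels
    the numerator 1 - x s of the Jacobian, and 1 - g(s) supplies the two factors of the integrand
    for x^2.\<close>
  have key: "1 - g s = (1 - s) * (1 - x\<^sup>2 * s) / (1 + x * s)\<^sup>2"
            "1 - z * g s = ((1 - x * s) / (1 + x * s))\<^sup>2" if "0 < s" for s
  proof -
    have "1 + x * s > 0" using assms that by (simp add: pos_add_strict)
    hence ne: "1 + x * s \<noteq> 0" by simp
    have "1 - g s = ((1 + x * s)\<^sup>2 - (1 + x)\<^sup>2 * s) / (1 + x * s)\<^sup>2"
      using ne by (simp add: g_def diff_divide_distrib)
    also have "(1 + x * s)\<^sup>2 - (1 + x)\<^sup>2 * s = (1 - s) * (1 - x\<^sup>2 * s)"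
      by algebra
    finally show "1 - g s = (1 - s) * (1 - x\<^sup>2 * s) / (1 + x * s)\<^sup>2" .
    have "z * g s = 4 * x * s / (1 + x * s)\<^sup>2"
      using assms by (simp add: z_def g_def)
    hence "1 - z * g s = ((1 + x * s)\<^sup>2 - 4 * x * s) / (1 + x * s)\<^sup>2"
      using ne by (simp add: diff_divide_distrib)
    also have "(1 + x * s)\<^sup>2 - 4 * x * s = (1 - x * s)\<^sup>2"
      by algebra
    finally show "1 - z * g s = ((1 - x * s) / (1 + x * s))\<^sup>2"
      by (simp add: power_divide)
  qed
  have deriv: "(g has_field_derivative g' s) (at s)" if "0 \<le> s" for s
  proof -
    have pos: "1 + x * s > 0" using assms that by (simp add: add_pos_nonneg)
    have "((1 + x)\<^sup>2 * (1 + x * s)\<^sup>2 - (1 + x)\<^sup>2 * s * (2 * (1 + x * s) * x)) / ((1 + x * s)\<^sup>2 * (1 + x * s)\<^sup>2) = g' s"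
    proof -
      have "((1 + x)\<^sup>2 * (1 + x * s)\<^sup>2 - (1 + x)\<^sup>2 * s * (2 * (1 + x * s) * x)) =
            (1 + x * s) * ((1 + x)\<^sup>2 * (1 - x * s))" by algebra
      moreover have "(1 + x * s)\<^sup>2 * (1 + x * s)\<^sup>2 = (1 + x * s) * (1 + x * s) ^ 3" by algebra
      ultimately show ?thesis using pos by (simp add: g'_def)
    qed
    thus ?thesis unfolding g_def using pos
      by (auto intro!: derivative_eq_intros simp: mult_ac power2_eq_square)
  qed
  have mono: "g s < g t" if "0 \<le> s" "s < t" "t \<le> 1" for s t
  proof (rule DERIV_pos_imp_increasing_open[OF that(2)])
    show "\<exists>y. (g has_real_derivative y) (at u) \<and> 0 < y" if "s < u" "u < t" for u
      using deriv[of u] xs[of u] that \<open>0 \<le> s\<close> \<open>t \<le> 1\<close> assms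
      by (intro exI[of _ "g' u"]) (auto simp: g'_def add_pos_pos intro!: divide_pos_pos mult_pos_pos)
    show "continuous_on {s..t} g"
      using deriv that(1) by (intro continuous_at_imp_continuous_on ballI DERIV_isCont[OF deriv]) auto
  qed
  have g01: "g 0 = 0" "g 1 = 1" using assms by (auto simp: g_def)
  have img: "g ` {0<..<1} = {0<..<1}"
  proof (intro equalityI subsetI)
    fix t :: real assume t: "t \<in> {0<..<1}"
    have "\<exists>s. 0 \<le> s \<and> s \<le> 1 \<and> g s = t"
      using g01 t deriv by (intro IVT) (auto intro: DERIV_isCont)
    then obtain s where s: "0 \<le> s" "s \<le> 1" "g s = t" by blast
    with t g01 have "s \<noteq> 0" "s \<noteq> 1" by auto
    with s show "t \<in> g ` {0<..<1}" by force
  qed (use mono[of 0] mono[of _ 1] g01 in force)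
  have inj: "inj_on g {0<..<1}"
    by (rule strict_mono_on_imp_inj_on) (auto simp: strict_mono_on_def intro!: mono)
  have B: "Beta (1/2) (1/2 :: real) = pi"
    by (simp add: Beta_def Gamma_one_half_real)
  have F: "((\<lambda>t. \<phi> z t) has_integral pi * hypergeo [1/2, 1/2] [1] z) {0<..<1}" if "0 < z" "z < 1" for z
    using Euler_integral_2F1[of "1/2" "1/2" 1 z] that by (simp add: \<phi>_def B)
  have "((\<lambda>s. (1 + x) * \<phi> (x\<^sup>2) s) has_integral (1 + x) * (pi * hypergeo [1/2, 1/2] [1] (x\<^sup>2))) {0<..<1}"
    using assms by (intro has_integral_mult_right F) (auto simp: power_less_one_iff)
  moreover have "((\<lambda>s. \<bar>g' s\<bar> * \<phi> z (g s)) has_integral pi * hypergeo [1/2, 1/2] [1] z) {0<..<1}"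
    using F[OF z] img inj deriv
    by (subst has_integral_change_of_variables_nonneg) (auto simp: \<phi>_def intro: has_field_derivative_at_within)
  hence "((\<lambda>s. (1 + x) * \<phi> (x\<^sup>2) s) has_integral pi * hypergeo [1/2, 1/2] [1] z) {0<..<1}"
  proof (rule has_integral_eq[rotated])
    fix s :: real assume "s \<in> {0<..<1}"
    hence s: "0 < s" "s < 1" by auto
    define D where "D = 1 + x * s"
    define N where "N = 1 - x * s"
    have DN: "D > 0" "N > 0" using xs[OF s] by (auto simp: D_def N_def)
    have "g s powr (-1/2) = D / ((1 + x) * sqrt s)"
      using s assms DN unfolding g_def D_def[symmetric]
      by (simp add: powr_minus_divide[of _ "1/2"] powr_half_sqrt real_sqrt_mult real_sqrt_divide)
    moreover have "x\<^sup>2 * s < 1" using xs[of s] xs[of "x * s"] s by (simp add: power2_eq_square mult.assoc)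
    hence "(1 - g s) powr (-1/2) = D / (sqrt (1 - s) * sqrt (1 - x\<^sup>2 * s))"
      using s assms DN unfolding key(1)[OF s(1)] D_def[symmetric]
      by (simp add: powr_minus_divide[of _ "1/2"] powr_half_sqrt real_sqrt_mult real_sqrt_divide)
    moreover have "(1 - z * g s) powr (-1/2) = D / N"
      using DN unfolding key(2)[OF s(1)] D_def[symmetric] N_def[symmetric]
      by (simp add: powr_minus_divide[of _ "1/2"] powr_half_sqrt real_sqrt_divide)
    moreover have "\<bar>g' s\<bar> = (1 + x)\<^sup>2 * N / D ^ 3"
      using DN by (simp add: g'_def N_def D_def)
    ultimately have "\<bar>g' s\<bar> * \<phi> z (g s) =
       ((1 + x)\<^sup>2 * N / D ^ 3) * (D / ((1 + x) * sqrt s) * (D / (sqrt (1 - s) * sqrt (1 - x\<^sup>2 * s))) * (D / N))"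
      by (simp add: \<phi>_def)
    also have "\<dots> = (1 + x) / (sqrt s * (sqrt (1 - s) * sqrt (1 - x\<^sup>2 * s)))"
      using DN assms by (simp add: power2_eq_square power3_eq_cube)
    also have "\<dots> = (1 + x) * \<phi> (x\<^sup>2) s"
      using s \<open>x\<^sup>2 * s < 1\<close> by (simp add: \<phi>_def powr_minus_divide[of _ "1/2"] powr_half_sqrt)
    finally show "\<bar>g' s\<bar> * \<phi> z (g s) = (1 + x) * \<phi> (x\<^sup>2) s" .
  qed
  ultimately have "(1 + x) * (pi * hypergeo [1/2, 1/2] [1] (x\<^sup>2)) = pi * hypergeo [1/2, 1/2] [1] z"
    by (rule has_integral_unique)
  thus ?thesis by (simp add: z_def)
qed

section \<open>Duplication formulas for theta functions\<close>

lemma has_sum_Times_real: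
  fixes f :: "'a \<Rightarrow> real" and g :: "'b \<Rightarrow> real"
  assumes "(f has_sum x) A" "(g has_sum y) B"
  shows "((\<lambda>(i, j). f i * g j) has_sum x * y) (A \<times> B)"
proof (rule has_sum_SigmaI)
  show "((\<lambda>j. case (i, j) of (i, j) \<Rightarrow> f i * g j) has_sum f i * y) B" for i
    using has_sum_cmult_right[OF assms(2)] by simp
  show "((\<lambda>i. f i * y) has_sum x * y) A"
    by (rule has_sum_cmult_left[OF assms(1)])
  have "(\<lambda>i. norm (f i)) summable_on A" "(\<lambda>j. norm (g j)) summable_on B"
    using assms has_sum_imp_summable summable_on_iff_abs_summable_on_real by blast+
  hence "(\<lambda>z. norm (case z of (i, j) \<Rightarrow> f i * g j)) summable_on A \<times> B"
    unfolding Infinite_Sum.abs_summable_on_Sigma_iff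
    by (auto simp: norm_mult abs_mult infsum_cmult_right' abs_of_nonneg infsum_nonneg
             intro!: summable_on_cmult_right summable_on_cmult_left)
  thus "(\<lambda>(i, j). f i * g j) summable_on A \<times> B"
    by (rule abs_summable_summable)
qed

text \<open>
  Rotation of the square lattice by 45 degrees: \<open>(a, b) \<mapsto> (a + b, a - b)\<close> is a bijection onto the
  pairs with even sum, \<open>(a, b) \<mapsto> (a + b + 1, a - b)\<close> onto those with odd sum.
\<close>

lemma has_sum_rotate_lattice:
  fixes f g :: "int \<Rightarrow> real"
  assumes f: "(f has_sum x) UNIV" and g: "(g has_sum y) UNIV"
    and f0: "(f0 has_sum x0) UNIV" and g0: "(g0 has_sum y0) UNIV"
    and f1: "(f1 has_sum x1) UNIV" and g1: "(g1 has_sum y1) UNIV"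
    and even: "\<And>a b. f (a + b) * g (a - b) = f0 a * g0 b"
    and odd: "\<And>a b. f (a + b + 1) * g (a - b) = f1 a * g1 b"
  shows "x * y = x0 * y0 + x1 * y1"
proof -
  define F where "F = (\<lambda>(m, n). f m * g n)"
  define E :: "(int \<times> int) set" where "E = {(m, n). even (m + n)}"
  have "((\<lambda>(a, b). f0 a * g0 b) has_sum x0 * y0) UNIV \<longleftrightarrow> (F has_sum x0 * y0) E"
    by (rule has_sum_reindex_bij_witness
          [where j = "\<lambda>(a, b). (a + b, a - b)" and i = "\<lambda>(m, n). ((m + n) div 2, (m - n) div 2)"])
       (auto simp: F_def E_def even elim!: evenE, presburger+)
  moreover have "((\<lambda>(a, b). f1 a * g1 b) has_sum x1 * y1) UNIV \<longleftrightarrow> (F has_sum x1 * y1) (- E)"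
    by (rule has_sum_reindex_bij_witness
          [where j = "\<lambda>(a, b). (a + b + 1, a - b)" and i = "\<lambda>(m, n). ((m + n - 1) div 2, (m - n - 1) div 2)"])
       (auto simp: F_def E_def odd elim!: oddE, presburger+)
  ultimately have "(F has_sum (x0 * y0 + x1 * y1)) (E \<union> - E)"
    using has_sum_Times_real[OF f0 g0] has_sum_Times_real[OF f1 g1]
    by (intro has_sum_Un_disjoint) auto
  moreover have "(F has_sum (x * y)) (E \<union> - E)"
    using has_sum_Times_real[OF f g] by (simp add: F_def)
  ultimately show ?thesis
    using has_sum_unique by blast
qed

section \<open>Theta series as power series\<close>

lemma summable_on_power_nat_abs_int:
  fixes q :: real
  assumes "0 \<le> q" "q < 1"
  shows "(\<lambda>n::int. q ^ nat \<bar>n\<bar>) summable_on UNIV"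
proof -
  have S: "(\<lambda>n::nat. q ^ n) summable_on UNIV"
    using assms by (subst summable_on_UNIV_nonneg_real_iff) (auto intro: summable_geometric)
  have "(\<lambda>n::int. q ^ nat \<bar>n\<bar>) summable_on range int"
    by (subst summable_on_reindex) (use S in \<open>auto simp: o_def\<close>)
  moreover have "(\<lambda>n::int. q ^ nat \<bar>n\<bar>) summable_on range (\<lambda>n. - int n)"
    by (subst summable_on_reindex) (use S in \<open>auto simp: o_def inj_def\<close>)
  moreover have "range int \<union> range (\<lambda>n. - int n) = UNIV"
  proof (intro equalityI subsetI UNIV_I)
    fix n :: int show "n \<in> range int \<union> range (\<lambda>n. - int n)"
      by (cases n rule: int_cases2) auto
  qed
  ultimately show ?thesis
    using summable_on_union by metis
qed

lemma summable_on_power_quadratic: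
  fixes q :: real and e :: "int \<Rightarrow> nat"
  assumes "0 < q" "q < 1" "\<And>n. nat \<bar>n\<bar> \<le> Suc (e n)"
  shows "(\<lambda>n. q ^ e n) summable_on UNIV"
proof (rule summable_on_comparison_test)
  show "(\<lambda>n. inverse q * q ^ nat \<bar>n\<bar>) summable_on UNIV"
    using summable_on_power_nat_abs_int[of q] assms by (intro summable_on_cmult_right) auto
  show "q ^ e n \<le> inverse q * q ^ nat \<bar>n\<bar>" for n
    using power_decreasing[OF assms(3)[of n], of q] assms by (simp add: field_simps)
qed (use assms in auto)

text \<open>Collects the terms of a lattice sum by exponent. The coefficients are finite sums over
  the fibres of \<open>e\<close>, so the theta series become ordinary power series that can be
  differentiated and multiplied.\<close>

lemma has_sum_int_imp_powser_sums:
  fixes q :: real and e :: "int \<Rightarrow> nat"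
  assumes "((\<lambda>n. c n * q ^ e n) has_sum s) UNIV"
    and fin: "\<And>m. finite {n. e n = m}"
  shows "(\<lambda>m. (\<Sum>n | e n = m. c n) * q ^ m) sums s"
proof -
  have "((\<lambda>(m, n). c n * q ^ e n) has_sum s) (SIGMA m:UNIV. {n. e n = m}) \<longleftrightarrow>
        ((\<lambda>n. c n * q ^ e n) has_sum s) UNIV"
    by (rule has_sum_reindex_bij_witness[where j = snd and i = "\<lambda>n. (e n, n)"]) auto
  with assms have "((\<lambda>(m, n). c n * q ^ e n) has_sum s) (SIGMA m:UNIV. {n. e n = m})"
    by simp
  hence "((\<lambda>m. (\<Sum>n | e n = m. c n) * q ^ m) has_sum s) UNIV"
  proof (rule has_sum_SigmaD)
    fix m
    have "((\<lambda>n. c n * q ^ e n) has_sum (\<Sum>n | e n = m. c n * q ^ e n)) {n. e n = m}"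
      using fin by (intro has_sum_finite)
    thus "((\<lambda>n. case (m, n) of (m, n) \<Rightarrow> c n * q ^ e n) has_sum (\<Sum>n | e n = m. c n) * q ^ m) {n. e n = m}"
      by (simp add: sum_distrib_right)
  qed
  thus ?thesis by (rule has_sum_imp_sums)
qed

lemma powr_int_square: "0 < q \<Longrightarrow> q powr (real_of_int n)\<^sup>2 = q ^ nat (n\<^sup>2)"
  by (subst powr_realpow[symmetric]) auto

lemma powr_half_int_square:
  assumes "0 < q"
  shows "q powr ((real_of_int n + 1/2)\<^sup>2) = q powr (1/4) * q ^ nat (n\<^sup>2 + n)"
proof -
  have "0 \<le> n * (n + 1)" by (cases "n \<ge> 0") (auto simp: zero_le_mult_iff)
  hence "(real_of_int n + 1/2)\<^sup>2 = 1/4 + real (nat (n\<^sup>2 + n))"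
    by (simp add: power2_eq_square algebra_simps flip: of_int_mult of_int_add)
  thus ?thesis using assms by (simp add: powr_add powr_realpow)
qed

lemma nat_abs_le_square: "nat \<bar>n\<bar> \<le> Suc (nat (n\<^sup>2))" "nat \<bar>n\<bar> \<le> Suc (nat (n\<^sup>2 + n))" for n :: int
proof -
  have 1: "\<bar>n\<bar> \<le> n\<^sup>2"
  proof (cases "n = 0")
    case False
    hence "\<bar>n\<bar> * 1 \<le> \<bar>n\<bar> * \<bar>n\<bar>" by (intro mult_left_mono) auto
    thus ?thesis by (simp add: power2_eq_square)
  qed auto
  thus "nat \<bar>n\<bar> \<le> Suc (nat (n\<^sup>2))" by linarith
  \<comment> \<open>At n = -1 the exponent n^2 + n is 0 while |n| = 1; this single case forces the
    \<open>Suc\<close> in the bound.\<close>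
  have "n \<ge> 0 \<or> n = -1 \<or> (n \<le> -2 \<and> 0 \<le> n * (n + 2))" by (auto simp: zero_le_mult_iff)
  hence "\<bar>n\<bar> \<le> 1 + (n\<^sup>2 + n)"
    using 1 by (auto simp: power2_eq_square algebra_simps)
  thus "nat \<bar>n\<bar> \<le> Suc (nat (n\<^sup>2 + n))" by linarith
qed

lemma finite_quadratic_fibre:
  "finite {n::int. nat (n\<^sup>2) = m}" "finite {n::int. nat (n\<^sup>2 + n) = m}"
proof -
  have "{n::int. nat (n\<^sup>2) = m} \<subseteq> {- int m - 1..int m + 1}"
  proof
    fix n :: int assume "n \<in> {n. nat (n\<^sup>2) = m}"
    thus "n \<in> {- int m - 1..int m + 1}" using nat_abs_le_square(1)[of n] by simp linarith
  qed
  moreover have "{n::int. nat (n\<^sup>2 + n) = m} \<subseteq> {- int m - 1..int m + 1}"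
  proof
    fix n :: int assume "n \<in> {n. nat (n\<^sup>2 + n) = m}"
    thus "n \<in> {- int m - 1..int m + 1}" using nat_abs_le_square(2)[of n] by simp linarith
  qed
  ultimately show "finite {n::int. nat (n\<^sup>2) = m}" "finite {n::int. nat (n\<^sup>2 + n) = m}"
    by (meson finite_atLeastAtMost_int finite_subset)+
qed

lemma norm_minus_one_powi_mult: "norm ((-1) powi n * x) = norm (x :: real)"
  by (simp only: norm_mult norm_power_int norm_minus_cancel norm_one power_int_1_left mult_1_left)

context
  fixes q :: real
  assumes q: "0 < q" "q < 1"
begin

lemma theta3_has_sum: "((\<lambda>n::int. q powr (of_int n)\<^sup>2) has_sum theta3 q) UNIV"
proof -
  have "(\<lambda>n::int. q ^ nat (n\<^sup>2)) summable_on UNIV"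
    by (rule summable_on_power_quadratic[OF q nat_abs_le_square(1)])
  thus ?thesis using q by (simp add: theta3_def powr_int_square)
qed

lemma theta4_has_sum: "((\<lambda>n::int. (-1) powi n * q powr (of_int n)\<^sup>2) has_sum theta4 q) UNIV"
proof -
  have "(\<lambda>n::int. norm ((-1) powi n * q powr (of_int n)\<^sup>2)) summable_on UNIV"
    using has_sum_imp_summable[OF theta3_has_sum] by (simp only: norm_minus_one_powi_mult) (simp only: real_norm_def abs_of_nonneg powr_ge_zero)
  thus ?thesis unfolding theta4_def by (rule has_sum_infsum[OF abs_summable_summable])
qed

lemma theta2_has_sum: "((\<lambda>n::int. q powr ((of_int n + 1/2)\<^sup>2)) has_sum theta2 q) UNIV"
proof -
  have "(\<lambda>n::int. q powr (1/4) * q ^ nat (n\<^sup>2 + n)) summable_on UNIV"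
    by (intro summable_on_cmult_right summable_on_power_quadratic[OF q nat_abs_le_square(2)])
  thus ?thesis using q unfolding theta2_def powr_half_int_square[OF q(1)] by (intro has_sum_infsum)
qed

lemma theta3_sums: "(\<lambda>m. (\<Sum>n::int | nat (n\<^sup>2) = m. 1) * q ^ m) sums theta3 q"
  using theta3_has_sum q
  by (intro has_sum_int_imp_powser_sums finite_quadratic_fibre) (simp add: powr_int_square)

lemma theta4_sums: "(\<lambda>m. (\<Sum>n::int | nat (n\<^sup>2) = m. (-1) powi n) * q ^ m) sums theta4 q"
  using theta4_has_sum q
  by (intro has_sum_int_imp_powser_sums finite_quadratic_fibre) (simp add: powr_int_square)

text \<open>Stripped of q^(1/4), theta2 is a power series in q. Since n and -1 - n share the
  exponent n^2 + n, the factor 1/2 normalises the constant coefficient to 1.\<close>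

lemma theta2_sums:
  "(\<lambda>m. (\<Sum>n::int | nat (n\<^sup>2 + n) = m. 1 / 2) * q ^ m) sums (theta2 q / (2 * q powr (1/4)))"
proof (intro has_sum_int_imp_powser_sums finite_quadratic_fibre)
  have "((\<lambda>n::int. 1 / (2 * q powr (1/4)) * q powr ((of_int n + 1/2)\<^sup>2)) has_sum
          1 / (2 * q powr (1/4)) * theta2 q) UNIV"
    by (rule has_sum_cmult_right[OF theta2_has_sum])
  thus "((\<lambda>n. 1 / 2 * q ^ nat (n\<^sup>2 + n)) has_sum theta2 q / (2 * q powr (1/4))) UNIV"
    using q by (simp add: powr_half_int_square)
qed

lemma unit_interval_square: "0 < q\<^sup>2" "q\<^sup>2 < 1"
  using q by (auto simp: power_less_one_iff)

end

text \<open>Used with (a + b)^2 + (a - b)^2 = 2 a^2 + 2 b^2 and (a + b + 1)^2 + (a - b)^2 = 2 (a +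
  1/2)^2 + 2 (b + 1/2)^2: the rotation doubles the quadratic form, which is the passage from q to
  q^2.\<close>

lemma powr_rotate:
  fixes q :: real
  assumes "q > 0" "x + y = 2 * u + 2 * v"
  shows "q powr x * q powr y = (q\<^sup>2) powr u * (q\<^sup>2) powr v"
proof -
  have "(q\<^sup>2) powr z = q powr (2 * z)" for z
    using assms by (simp add: powr_powr flip: powr_numeral)
  thus ?thesis using assms by (simp flip: powr_add)
qed

lemma minus_one_powi_add_diff: "(-1) powi (a + b) * (-1) powi (a - b) = (1 :: real)"
proof -
  have "(-1) powi (a + b) * (-1) powi (a - b) = ((-1) powi (2 * a) :: real)"
    by (subst power_int_add[symmetric]) (auto simp: algebra_simps)
  thus ?thesis by (simp add: power_int_mult)
qed

section \<open>Quadratic relations between theta functions at q and at q^2\<close>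

context
  fixes q :: real
  assumes q: "0 < q" "q < 1"
begin

text \<open>Pairs with even sum rotate to integer points, pairs with odd sum to half-integer points,
  which yields one theta3 square and one theta2 square.\<close>

lemma theta3_squared: "(theta3 q)\<^sup>2 = (theta3 (q\<^sup>2))\<^sup>2 + (theta2 (q\<^sup>2))\<^sup>2"
proof -
  have "theta3 q * theta3 q = theta3 (q\<^sup>2) * theta3 (q\<^sup>2) + theta2 (q\<^sup>2) * theta2 (q\<^sup>2)"
  proof (rule has_sum_rotate_lattice[OF theta3_has_sum theta3_has_sum theta3_has_sum theta3_has_sum
        theta2_has_sum theta2_has_sum])
    fix a b :: int
    show "q powr (of_int (a + b))\<^sup>2 * q powr (of_int (a - b))\<^sup>2 =
          (q\<^sup>2) powr (of_int a)\<^sup>2 * (q\<^sup>2) powr (of_int b)\<^sup>2"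
         "q powr (of_int (a + b + 1))\<^sup>2 * q powr (of_int (a - b))\<^sup>2 =
          (q\<^sup>2) powr ((of_int a + 1/2)\<^sup>2) * (q\<^sup>2) powr ((of_int b + 1/2)\<^sup>2)"
      using q by (intro powr_rotate; simp add: power2_eq_square algebra_simps)+
  qed (use q unit_interval_square[OF q] in auto)
  thus ?thesis by (simp add: power2_eq_square)
qed

text \<open>The same rotation as for theta3; the sign (-1)^(m + n) is constant on each class, +1 on
  even and -1 on odd sums.\<close>

lemma theta4_squared: "(theta4 q)\<^sup>2 = (theta3 (q\<^sup>2))\<^sup>2 - (theta2 (q\<^sup>2))\<^sup>2"
proof -
  have 1: "((\<lambda>n. - ((q\<^sup>2) powr ((of_int n + 1/2)\<^sup>2))) has_sum - theta2 (q\<^sup>2)) (UNIV :: int set)"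
    using theta2_has_sum[OF unit_interval_square[OF q]] by (simp add: has_sum_uminus)
  have "theta4 q * theta4 q = theta3 (q\<^sup>2) * theta3 (q\<^sup>2) + (- theta2 (q\<^sup>2)) * theta2 (q\<^sup>2)"
  proof (rule has_sum_rotate_lattice; ((rule theta3_has_sum theta2_has_sum theta4_has_sum 1 unit_interval_square q)+)?)
    fix a b :: int
    have "(-1) powi (a + b) * q powr (of_int (a + b))\<^sup>2 * ((-1) powi (a - b) * q powr (of_int (a - b))\<^sup>2) =
          ((-1) powi (a + b) * (-1) powi (a - b)) * (q powr (of_int (a + b))\<^sup>2 * q powr (of_int (a - b))\<^sup>2)"
      by simp
    also have "\<dots> = (q\<^sup>2) powr (of_int a)\<^sup>2 * (q\<^sup>2) powr (of_int b)\<^sup>2"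
      unfolding minus_one_powi_add_diff mult_1 using q
      by (intro powr_rotate) (simp_all add: power2_eq_square algebra_simps)
    finally show "(-1) powi (a + b) * q powr (of_int (a + b))\<^sup>2 * ((-1) powi (a - b) * q powr (of_int (a - b))\<^sup>2) =
          (q\<^sup>2) powr (of_int a)\<^sup>2 * (q\<^sup>2) powr (of_int b)\<^sup>2" .
    have "(-1) powi (a + b + 1) * q powr (of_int (a + b + 1))\<^sup>2 * ((-1) powi (a - b) * q powr (of_int (a - b))\<^sup>2) =
          - (((-1) powi (a + b) * (-1) powi (a - b)) * (q powr (of_int (a + b + 1))\<^sup>2 * q powr (of_int (a - b))\<^sup>2))"
      by (simp add: power_int_add)
    also have "\<dots> = - ((q\<^sup>2) powr ((of_int a + 1/2)\<^sup>2) * (q\<^sup>2) powr ((of_int b + 1/2)\<^sup>2))"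
      unfolding minus_one_powi_add_diff mult_1 using q
      by (intro arg_cong[of _ _ uminus] powr_rotate) (simp_all add: power2_eq_square algebra_simps)
    finally show "(-1) powi (a + b + 1) * q powr (of_int (a + b + 1))\<^sup>2 * ((-1) powi (a - b) * q powr (of_int (a - b))\<^sup>2) =
          - ((q\<^sup>2) powr ((of_int a + 1/2)\<^sup>2)) * (q\<^sup>2) powr ((of_int b + 1/2)\<^sup>2)"
      by simp
  qed
  thus ?thesis by (simp add: power2_eq_square)
qed

text \<open>With the sign on one factor only, (-1)^(a - b) splits into (-1)^a (-1)^b, so the even
  class gives theta4 squared. The odd class gives the square of the alternating half-integer sum,
  and that sum vanishes because n -> -1 - n preserves (n + 1/2)^2 and flips the sign.\<close>

lemma theta3_times_theta4: "theta3 q * theta4 q = (theta4 (q\<^sup>2))\<^sup>2"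
proof -
  let ?g = "\<lambda>n::int. (-1) powi n * (q\<^sup>2) powr ((of_int n + 1/2)\<^sup>2)"
  have "(\<lambda>n. norm (?g n)) summable_on UNIV"
    using has_sum_imp_summable[OF theta2_has_sum[OF unit_interval_square[OF q]]]
    by (simp only: norm_minus_one_powi_mult) (simp only: real_norm_def abs_of_nonneg powr_ge_zero)
  then obtain \<sigma> where \<sigma>: "(?g has_sum \<sigma>) UNIV"
    using abs_summable_summable summable_on_def by blast
  have sgn: "(-1) powi (a - b) = ((-1) powi a * (-1) powi b :: real)" for a b :: int
  proof -
    have "(-1) powi (a - b) = ((-1) powi (a + b + 2 * (- b)) :: real)"
      by (rule arg_cong[of _ _ "power_int (-1)"]) simp
    also have "\<dots> = (-1) powi a * (-1) powi b * (-1) powi (2 * (- b))"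
      by (simp only: power_int_add simp_thms zero_neq_neg_one[symmetric])
    also have "(-1) powi (2 * (- b)) = (1 :: real)"
      by (simp add: power_int_mult)
    finally show ?thesis by simp
  qed
  have "(?g has_sum \<sigma>) UNIV \<longleftrightarrow> ((\<lambda>n. - ?g n) has_sum \<sigma>) UNIV"
  proof (rule has_sum_reindex_bij_witness[where i = "\<lambda>n. - 1 - n" and j = "\<lambda>n. - 1 - n"])
    fix n :: int
    have "(real_of_int (- 1 - n) + 1 / 2)\<^sup>2 = (real_of_int n + 1 / 2)\<^sup>2"
      by (simp add: power2_eq_square algebra_simps)
    moreover have "(-1) powi (- 1 - n) = (- ((-1) powi n) :: real)"
      by (subst sgn) simp
    ultimately show "- ?g (- 1 - n) = ?g n" by simp
  qed auto
  with \<sigma> have "\<sigma> = - \<sigma>"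
    using has_sum_uminusI[OF \<sigma>] has_sum_unique by blast
  hence 0: "(?g has_sum 0) UNIV" using \<sigma> by simp
  have "theta3 q * theta4 q = theta4 (q\<^sup>2) * theta4 (q\<^sup>2) + 0 * 0"
  proof (rule has_sum_rotate_lattice; ((rule theta3_has_sum theta4_has_sum 0 unit_interval_square q)+)?)
    fix a b :: int
    have "q powr (of_int (a + b))\<^sup>2 * ((-1) powi (a - b) * q powr (of_int (a - b))\<^sup>2) =
          (-1) powi (a - b) * (q powr (of_int (a + b))\<^sup>2 * q powr (of_int (a - b))\<^sup>2)"
      by simp
    also have "q powr (of_int (a + b))\<^sup>2 * q powr (of_int (a - b))\<^sup>2 = (q\<^sup>2) powr (of_int a)\<^sup>2 * (q\<^sup>2) powr (of_int b)\<^sup>2"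
      using q by (intro powr_rotate) (simp_all add: power2_eq_square algebra_simps)
    finally show "q powr (of_int (a + b))\<^sup>2 * ((-1) powi (a - b) * q powr (of_int (a - b))\<^sup>2) =
          (-1) powi a * (q\<^sup>2) powr (of_int a)\<^sup>2 * ((-1) powi b * (q\<^sup>2) powr (of_int b)\<^sup>2)"
      unfolding sgn by (simp only: mult_ac)
    have "q powr (of_int (a + b + 1))\<^sup>2 * ((-1) powi (a - b) * q powr (of_int (a - b))\<^sup>2) =
          (-1) powi (a - b) * (q powr (of_int (a + b + 1))\<^sup>2 * q powr (of_int (a - b))\<^sup>2)"
      by simp
    also have "q powr (of_int (a + b + 1))\<^sup>2 * q powr (of_int (a - b))\<^sup>2 =
          (q\<^sup>2) powr ((of_int a + 1/2)\<^sup>2) * (q\<^sup>2) powr ((of_int b + 1/2)\<^sup>2)"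
      using q by (intro powr_rotate) (simp_all add: power2_eq_square algebra_simps)
    finally show "q powr (of_int (a + b + 1))\<^sup>2 * ((-1) powi (a - b) * q powr (of_int (a - b))\<^sup>2) = ?g a * ?g b"
      unfolding sgn by (simp only: mult_ac)
  qed
  thus ?thesis by (simp add: power2_eq_square)
qed

text \<open>Both classes now contain one integer and one half-integer coordinate, so they contribute
  equally; in the odd class the integer coordinate is a + 1, hence the shifted theta3 sum.\<close>

lemma theta2_squared: "(theta2 q)\<^sup>2 = 2 * theta2 (q\<^sup>2) * theta3 (q\<^sup>2)"
proof -
  have "((\<lambda>n::int. (q\<^sup>2) powr ((of_int (n + 1))\<^sup>2)) has_sum theta3 (q\<^sup>2)) UNIV \<longleftrightarrow>
        ((\<lambda>n::int. (q\<^sup>2) powr ((of_int n)\<^sup>2)) has_sum theta3 (q\<^sup>2)) UNIV"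
    by (rule has_sum_reindex_bij_witness[where i = "\<lambda>n. n - 1" and j = "\<lambda>n. n + 1"]) auto
  hence 1: "((\<lambda>n::int. (q\<^sup>2) powr ((of_int (n + 1))\<^sup>2)) has_sum theta3 (q\<^sup>2)) UNIV"
    using theta3_has_sum[OF unit_interval_square[OF q]] by blast
  have "theta2 q * theta2 q = theta2 (q\<^sup>2) * theta3 (q\<^sup>2) + theta3 (q\<^sup>2) * theta2 (q\<^sup>2)"
  proof (rule has_sum_rotate_lattice[OF theta2_has_sum theta2_has_sum theta2_has_sum theta3_has_sum 1 theta2_has_sum])
    fix a b :: int
    show "q powr ((of_int (a + b) + 1/2)\<^sup>2) * q powr ((of_int (a - b) + 1/2)\<^sup>2) =
          (q\<^sup>2) powr ((of_int a + 1/2)\<^sup>2) * (q\<^sup>2) powr ((of_int b)\<^sup>2)"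
         "q powr ((of_int (a + b + 1) + 1/2)\<^sup>2) * q powr ((of_int (a - b) + 1/2)\<^sup>2) =
          (q\<^sup>2) powr ((of_int (a + 1))\<^sup>2) * (q\<^sup>2) powr ((of_int b + 1/2)\<^sup>2)"
      using q by (intro powr_rotate; simp add: power2_eq_square algebra_simps)+
  qed (use q unit_interval_square[OF q] in auto)
  thus ?thesis by (simp add: power2_eq_square)
qed

end

section \<open>Theta functions and the modular parameter\<close>

text \<open>The theta functions agree with their power series only inside the unit interval:
  \<open>0 powr 0 = 0\<close> makes \<open>theta3 0\<close> equal to 0 and not 1. Their behaviour at
  0 is therefore expressed by limits from the right.\<close>

lemma powser_unit_interval:
  fixes f :: "real \<Rightarrow> real"
  assumes sums: "\<And>q. 0 < q \<Longrightarrow> q < 1 \<Longrightarrow> (\<lambda>n. a n * q ^ n) sums f q"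
  shows has_real_derivative_powser_unit_interval:
      "\<And>q. 0 < q \<Longrightarrow> q < 1 \<Longrightarrow> (f has_real_derivative deriv f q) (at q)"
    and tendsto_powser_at_right_0: "(f \<longlongrightarrow> a 0) (at_right 0)"
    and tendsto_deriv_powser_at_right_0: "(deriv f \<longlongrightarrow> a 1) (at_right 0)"
proof -
  have sm: "summable (\<lambda>n. a n * x ^ n)" if "\<bar>x\<bar> < 1" for x
    by (rule powser_inside[of _ "(\<bar>x\<bar> + 1) / 2"])
       (use sums[of "(\<bar>x\<bar> + 1) / 2"] that in \<open>auto simp: sums_iff\<close>)
  define F where "F = (\<lambda>x. \<Sum>n. a n * x ^ n)"
  define F' where "F' = (\<lambda>x. \<Sum>n. diffs a n * x ^ n)"
  have DF: "(F has_real_derivative F' x) (at x)" if "\<bar>x\<bar> < 1" for x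
    unfolding F_def F'_def
    by (rule termdiffs_strong[where K = "(\<bar>x\<bar> + 1) / 2"]) (use sm[of "(\<bar>x\<bar> + 1) / 2"] that in auto)
  have sm': "summable (\<lambda>n. diffs a n * x ^ n)" if "\<bar>x\<bar> < 1" for x
    by (rule termdiff_converges[where K = 1]) (use sm that in auto)
  have CF': "isCont F' x" if "\<bar>x\<bar> < 1" for x
    unfolding F'_def
    by (rule isCont_powser[where K = "(\<bar>x\<bar> + 1) / 2"]) (use sm'[of "(\<bar>x\<bar> + 1) / 2"] that in auto)
  have fF: "f q = F q" if "0 < q" "q < 1" for q
    using sums[OF that] by (simp add: F_def sums_iff)
  have ev: "eventually (\<lambda>x. f x = F x) (nhds q)" if "0 < q" "q < 1" for q
    using eventually_nhds_in_open[of "{0<..<1}" q] that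
    by (auto elim!: eventually_mono simp: fF)
  have Df: "(f has_real_derivative F' q) (at q)" if "0 < q" "q < 1" for q
    using DF[of q] DERIV_cong_ev[OF refl ev[OF that] refl] that by auto
  hence df: "deriv f q = F' q" if "0 < q" "q < 1" for q
    using that DERIV_imp_deriv by blast
  show "(f has_real_derivative deriv f q) (at q)" if "0 < q" "q < 1" for q
    using Df df that by simp
  have near0: "eventually (\<lambda>x::real. x \<in> {0<..<1}) (at_right 0)"
    by (rule eventually_at_right_real) simp
  have "(F \<longlongrightarrow> F 0) (at 0)" "(F' \<longlongrightarrow> F' 0) (at 0)"
    using DERIV_isCont[OF DF, of 0] CF'[of 0] by (auto simp: isCont_def)
  hence "(F \<longlongrightarrow> F 0) (at_right 0)" "(F' \<longlongrightarrow> F' 0) (at_right 0)"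
    by (auto intro: tendsto_within_subset)
  moreover have "F 0 = a 0" "F' 0 = a 1"
    by (simp_all add: F_def F'_def diffs_def)
  moreover have "eventually (\<lambda>x. F x = f x) (at_right 0)" "eventually (\<lambda>x. F' x = deriv f x) (at_right 0)"
    using near0 by (auto elim!: eventually_mono simp: fF df)
  ultimately show "(f \<longlongrightarrow> a 0) (at_right 0)" "(deriv f \<longlongrightarrow> a 1) (at_right 0)"
    by (auto intro: Lim_transform_eventually)
qed

text \<open>The transformation \<open>q \<mapsto> q\<^sup>2\<close> contracts the unit interval to \<open>0\<close>.\<close>

lemma square_invariant_eq_limit:
  fixes h :: "real \<Rightarrow> 'a::t2_space"
  assumes inv: "\<And>q. 0 < q \<Longrightarrow> q < 1 \<Longrightarrow> h (q\<^sup>2) = h q"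
    and lim: "(h \<longlongrightarrow> c) (at_right 0)" and q: "0 < q" "q < 1"
  shows "h q = c"
proof -
  have h: "h (q ^ (2 ^ n)) = h q" for n
  proof (induction n)
    case (Suc n)
    have "h ((q ^ (2 ^ n))\<^sup>2) = h (q ^ (2 ^ n))"
      using q by (intro inv) (auto simp: power_less_one_iff)
    thus ?case using Suc by (simp add: power_mult[symmetric] mult.commute)
  qed simp
  have "(\<lambda>n. q ^ n) \<longlonglongrightarrow> 0" using q by (intro LIMSEQ_realpow_zero) auto
  moreover have "filterlim (\<lambda>n::nat. 2 ^ n :: nat) at_top sequentially"
    by (rule filterlim_subseq) (auto intro!: strict_monoI power_strict_increasing)
  ultimately have "(\<lambda>n. q ^ (2 ^ n)) \<longlonglongrightarrow> 0"
    by (rule filterlim_compose)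
  hence "filterlim (\<lambda>n. q ^ (2 ^ n)) (at_right 0) sequentially"
    using q by (intro tendsto_imp_filterlim_at_right) auto
  hence "(\<lambda>n. h (q ^ (2 ^ n))) \<longlonglongrightarrow> c"
    by (rule filterlim_compose[OF lim])
  thus ?thesis unfolding h by (simp add: LIMSEQ_const_iff)
qed

text \<open>The square root of the complementary modulus k' of elliptic function theory.\<close>

definition theta_ratio :: "real \<Rightarrow> real" where
  "theta_ratio q = theta4 q / theta3 q"

text \<open>The elliptic lambda function k^2. Defining it through theta4 makes its derivative a
  matter of \<open>theta_ratio\<close> alone, whose logarithmic derivative involves only integral
  powers of q; the link to theta2 is \<open>theta2_power4\<close>.\<close>

definition modular_lambda :: "real \<Rightarrow> real" where
  "modular_lambda q = 1 - theta_ratio q ^ 4"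

lemma nat_square_eq_0_1:
  "{n::int. nat (n\<^sup>2) = 0} = {0}" "{n::int. nat (n\<^sup>2) = 1} = {-1, 1}" "{n::int. nat (n\<^sup>2 + n) = 0} = {-1, 0}"
proof -
  show "{n::int. nat (n\<^sup>2) = 0} = {0}" by (auto simp: nat_eq_iff)
  show "{n::int. nat (n\<^sup>2) = 1} = {-1, 1}" by (auto simp: nat_eq_iff power2_eq_1_iff)
  have "n\<^sup>2 + n \<le> 0 \<longleftrightarrow> n = -1 \<or> n = 0" for n :: int
  proof -
    have "n = -1 \<or> n = 0 \<or> 0 < n * (n + 1)"
      using mult_pos_pos[of n "n + 1"] mult_neg_neg[of n "n + 1"] by linarith
    thus ?thesis by (auto simp: power2_eq_square algebra_simps)
  qed
  thus "{n::int. nat (n\<^sup>2 + n) = 0} = {-1, 0}" by auto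
qed

context
  fixes q :: real
  assumes q: "0 < q" "q < 1"
begin

lemma has_real_derivative_theta3: "(theta3 has_real_derivative deriv theta3 q) (at q)"
  by (rule has_real_derivative_powser_unit_interval[OF theta3_sums q])

lemma has_real_derivative_theta4: "(theta4 has_real_derivative deriv theta4 q) (at q)"
  by (rule has_real_derivative_powser_unit_interval[OF theta4_sums q])

lemma isCont_theta3: "isCont theta3 q"
  by (rule DERIV_isCont[OF has_real_derivative_theta3])

end

lemma tendsto_theta3: "(theta3 \<longlongrightarrow> 1) (at_right 0)" "(deriv theta3 \<longlongrightarrow> 2) (at_right 0)"
  using tendsto_powser_at_right_0[OF theta3_sums] tendsto_deriv_powser_at_right_0[OF theta3_sums]
  by (simp_all only: nat_square_eq_0_1) simp_all

lemma tendsto_theta4: "(theta4 \<longlongrightarrow> 1) (at_right 0)" "(deriv theta4 \<longlongrightarrow> -2) (at_right 0)"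
  using tendsto_powser_at_right_0[OF theta4_sums] tendsto_deriv_powser_at_right_0[OF theta4_sums]
  by (simp_all only: nat_square_eq_0_1) simp_all

lemma tendsto_theta2: "((\<lambda>q. theta2 q / (2 * q powr (1/4))) \<longlongrightarrow> 1) (at_right 0)"
  using tendsto_powser_at_right_0[OF theta2_sums]
  by (simp only: nat_square_eq_0_1) simp

section \<open>Positivity, the arithmetic-geometric mean step and the derivative of lambda\<close>

context
  fixes q :: real
  assumes q: "0 < q" "q < 1"
begin

lemma theta3_pos: "theta3 q > 0"
proof -
  have "sum (\<lambda>n::int. q powr (of_int n)\<^sup>2) {0} \<le> theta3 q"
    by (rule finite_sum_le_has_sum[OF theta3_has_sum[OF q]]) auto
  thus ?thesis using q by simp
qed

lemma theta2_pos: "theta2 q > 0"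
proof -
  have "sum (\<lambda>n::int. q powr ((of_int n + 1/2)\<^sup>2)) {0} \<le> theta2 q"
    by (rule finite_sum_le_has_sum[OF theta2_has_sum[OF q]]) auto
  moreover have "sum (\<lambda>n::int. q powr ((of_int n + 1/2)\<^sup>2)) {0} > 0"
    using q by simp
  ultimately show ?thesis by linarith
qed

end

text \<open>The alternating series shows no sign. But theta3 theta4 is a square, so theta4 is
  nonnegative, and a zero at q is equivalent to a zero at q^2. The truth value of theta4 q = 0 is
  thus a square-invariant function, and near 0 it is \<open>False\<close>.\<close>

lemma theta4_pos:
  assumes q: "0 < q" "q < 1"
  shows "theta4 q > 0"
proof -
  have nonneg: "theta4 p \<ge> 0" if "0 < p" "p < 1" for p
    using theta3_times_theta4[OF that] theta3_pos[OF that] by (metis zero_le_mult_iff zero_le_power2 not_less)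
  have "(theta4 q = 0) = False"
  proof (rule square_invariant_eq_limit[where h = "\<lambda>q. theta4 q = 0"])
    show "(theta4 (p\<^sup>2) = 0) = (theta4 p = 0)" if "0 < p" "p < 1" for p
      using theta3_times_theta4[OF that] theta3_pos[OF that] by auto
    have "eventually (\<lambda>q. theta4 q > 0) (at_right 0)"
      using tendsto_theta4(1) by (rule order_tendstoD) simp
    thus "((\<lambda>q. theta4 q = 0) \<longlongrightarrow> False) (at_right 0)"
      by (auto simp: tendsto_discrete elim!: eventually_mono)
  qed (use q in auto)
  with nonneg[OF q] show ?thesis by simp
qed

context
  fixes q :: real
  assumes q: "0 < q" "q < 1"
begin

lemma theta4_squared_ratio: "(theta4 q)\<^sup>2 = (theta3 q)\<^sup>2 * (theta_ratio q)\<^sup>2"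
  using theta3_pos[OF q] by (simp add: theta_ratio_def power_divide)

lemma theta3_square: "2 * (theta3 (q\<^sup>2))\<^sup>2 = (theta3 q)\<^sup>2 * (1 + (theta_ratio q)\<^sup>2)"
  using theta3_squared[OF q] theta4_squared[OF q] theta4_squared_ratio
  unfolding distrib_left mult_1_right by linarith

lemma theta2_square: "2 * (theta2 (q\<^sup>2))\<^sup>2 = (theta3 q)\<^sup>2 * (1 - (theta_ratio q)\<^sup>2)"
  using theta3_squared[OF q] theta4_squared[OF q] theta4_squared_ratio
  unfolding right_diff_distrib mult_1_right by linarith

lemma theta_ratio_pos: "theta_ratio q > 0"
  using theta3_pos[OF q] theta4_pos[OF q] by (simp add: theta_ratio_def)

lemma theta_ratio_less_1: "theta_ratio q < 1"
proof -
  have "0 < (theta3 q)\<^sup>2 * (1 - (theta_ratio q)\<^sup>2)"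
    using theta2_square theta2_pos[OF unit_interval_square[OF q]] by (metis zero_less_mult_iff zero_less_numeral zero_less_power)
  hence "(theta_ratio q)\<^sup>2 < 1" using theta3_pos[OF q] by (simp add: zero_less_mult_iff)
  thus ?thesis by (simp add: power_less_one_iff abs_square_less_1)
qed

text \<open>One step of Gauss's arithmetic-geometric mean: theta3(q^2)^2 and theta4(q^2)^2 are the
  arithmetic and the geometric mean of theta3(q)^2 and theta4(q)^2.\<close>

lemma theta_ratio_square: "(theta_ratio (q\<^sup>2))\<^sup>2 = 2 * theta_ratio q / (1 + (theta_ratio q)\<^sup>2)"
proof -
  have "(theta4 (q\<^sup>2))\<^sup>2 = (theta3 q)\<^sup>2 * theta_ratio q"
    using theta3_times_theta4[OF q] theta3_pos[OF q] by (simp add: theta_ratio_def power2_eq_square)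
  moreover have "(theta3 (q\<^sup>2))\<^sup>2 = (theta3 q)\<^sup>2 * (1 + (theta_ratio q)\<^sup>2) / 2"
    using theta3_square by simp
  ultimately have "(theta4 (q\<^sup>2))\<^sup>2 / (theta3 (q\<^sup>2))\<^sup>2 =
      ((theta3 q)\<^sup>2 * theta_ratio q) / ((theta3 q)\<^sup>2 * (1 + (theta_ratio q)\<^sup>2) / 2)"
    by (simp only:)
  thus ?thesis
    using theta3_pos[OF q] by (simp add: theta_ratio_def[of "q\<^sup>2"] power_divide mult_ac)
qed

text \<open>Jacobi's identity theta3^4 = theta2^4 + theta4^4. Squaring the duplication formula for
  theta2 gives a product of a sum and a difference of squares, (1 + r^2) (1 - r^2) = 1 -
  r^4.\<close>

lemma theta2_power4: "theta2 q ^ 4 = theta3 q ^ 4 * modular_lambda q"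
proof -
  have "theta2 q ^ 4 = ((theta2 q)\<^sup>2)\<^sup>2" by simp
  also have "\<dots> = (2 * (theta2 (q\<^sup>2))\<^sup>2) * (2 * (theta3 (q\<^sup>2))\<^sup>2)"
    unfolding theta2_squared[OF q] by (simp add: power_mult_distrib)
  also have "\<dots> = theta3 q ^ 4 * modular_lambda q"
    unfolding theta2_square theta3_square modular_lambda_def by algebra
  finally show ?thesis .
qed

lemma theta4_power4: "theta4 q ^ 4 = theta3 q ^ 4 * (1 - modular_lambda q)"
  using theta3_pos[OF q] by (simp add: modular_lambda_def theta_ratio_def power_divide)

lemma modular_lambda_pos: "0 < modular_lambda q" and modular_lambda_less_1: "modular_lambda q < 1"
  using theta_ratio_pos theta_ratio_less_1 by (auto simp: modular_lambda_def power_less_one_iff)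

lemma has_real_derivative_theta_ratio:
  "(theta_ratio has_real_derivative deriv theta_ratio q) (at q)"
  and deriv_theta_ratio: "deriv theta_ratio q =
        theta_ratio q * (deriv theta4 q / theta4 q - deriv theta3 q / theta3 q)"
proof -
  have "(theta_ratio has_real_derivative
          theta_ratio q * (deriv theta4 q / theta4 q - deriv theta3 q / theta3 q)) (at q)"
    unfolding theta_ratio_def[abs_def]
    using theta3_pos[OF q] theta4_pos[OF q]
    by (auto intro!: derivative_eq_intros has_real_derivative_theta3 has_real_derivative_theta4 q
             simp: field_simps)
  thus "deriv theta_ratio q = theta_ratio q * (deriv theta4 q / theta4 q - deriv theta3 q / theta3 q)"
       "(theta_ratio has_real_derivative deriv theta_ratio q) (at q)"
    using DERIV_imp_deriv by metis+
qed

end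

text \<open>The derivative of the mean step \<open>theta_ratio_square\<close>: a transformation law
  under q -> q^2 for the logarithmic derivative of the ratio, which theta2^4 also satisfies up to
  the factor q.\<close>

lemma deriv_theta_ratio_square:
  assumes q: "0 < q" "q < 1"
  shows "4 * q * (deriv theta_ratio (q\<^sup>2) / theta_ratio (q\<^sup>2)) * (1 + (theta_ratio q)\<^sup>2) =
         (deriv theta_ratio q / theta_ratio q) * (1 - (theta_ratio q)\<^sup>2)"
proof -
  define r r' R R' where "r = theta_ratio q" and "r' = deriv theta_ratio q"
    and "R = theta_ratio (q\<^sup>2)" and "R' = deriv theta_ratio (q\<^sup>2)"
  note pos = theta_ratio_pos[OF q] theta_ratio_pos[OF unit_interval_square[OF q]]
  have D: "1 + r\<^sup>2 > 0" by (simp add: add_pos_nonneg)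
  have "((\<lambda>x. theta_ratio (x\<^sup>2)) has_real_derivative R' * (2 * q)) (at q)"
    unfolding R'_def
    by (rule DERIV_chain'[where f = "\<lambda>x. x\<^sup>2"])
       (auto intro!: derivative_eq_intros has_real_derivative_theta_ratio unit_interval_square q)
  hence "((\<lambda>x. (theta_ratio (x\<^sup>2))\<^sup>2) has_real_derivative 4 * q * R * R') (at q)"
    by (auto intro!: derivative_eq_intros simp: R_def)
  moreover have 2: "((\<lambda>x. 2 * theta_ratio x / (1 + (theta_ratio x)\<^sup>2)) has_real_derivative
                   (2 * r' * (1 + r\<^sup>2) - 2 * r * (2 * r * r')) / ((1 + r\<^sup>2) * (1 + r\<^sup>2))) (at q)"
    unfolding r_def r'_def using D[unfolded r_def]
    by (auto intro!: derivative_eq_intros has_real_derivative_theta_ratio q)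
  moreover have ev: "eventually (\<lambda>x. (theta_ratio (x\<^sup>2))\<^sup>2 = 2 * theta_ratio x / (1 + (theta_ratio x)\<^sup>2)) (nhds q)"
    using eventually_nhds_in_open[of "{0<..<1}" q] q
    by (auto elim!: eventually_mono simp: theta_ratio_square)
  ultimately have "4 * q * R * R' = (2 * r' * (1 + r\<^sup>2) - 2 * r * (2 * r * r')) / ((1 + r\<^sup>2) * (1 + r\<^sup>2))"
    using DERIV_unique[OF _ DERIV_cong_ev[OF refl ev refl, THEN iffD2, OF 2]] by blast
  also have "\<dots> = 2 * r' * (1 - r\<^sup>2) / ((1 + r\<^sup>2) * (1 + r\<^sup>2))"
    by (simp add: power2_eq_square algebra_simps)
  finally have 1: "4 * q * R * R' * (1 + r\<^sup>2) = 2 * r' * (1 - r\<^sup>2) / (1 + r\<^sup>2)"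
    using D by simp
  have R2: "R\<^sup>2 = 2 * r / (1 + r\<^sup>2)"
    unfolding r_def R_def by (rule theta_ratio_square[OF q])
  have "4 * q * (R' / R) * (1 + r\<^sup>2) = 4 * q * R * R' * (1 + r\<^sup>2) / R\<^sup>2"
    using pos by (simp add: R_def power2_eq_square)
  also have "\<dots> = r' / r * (1 - r\<^sup>2)"
    unfolding 1 R2 using D pos by (simp add: r_def[symmetric])
  finally show ?thesis by (simp add: r_def r'_def R_def R'_def)
qed

text \<open>
  The quotient of the two sides is invariant under \<open>q \<mapsto> q\<^sup>2\<close>, hence equal to its limit at \<open>0\<close>.
\<close>

lemma deriv_theta_ratio_eq:
  assumes q: "0 < q" "q < 1"
  shows "-4 * q * deriv theta_ratio q = theta_ratio q * theta2 q ^ 4"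
proof -
  define h where "h = (\<lambda>q. -4 * q * (deriv theta_ratio q / theta_ratio q) / theta2 q ^ 4)"
  have "h q = 1"
  proof (rule square_invariant_eq_limit[OF _ _ q])
    fix q :: real assume q: "0 < q" "q < 1"
    define r where "r = theta_ratio q"
    define g where "g = deriv theta_ratio q / theta_ratio q"
    have r: "0 < r" "r < 1" "1 + r\<^sup>2 > 0" "1 - r\<^sup>2 > 0"
      using theta_ratio_pos[OF q] theta_ratio_less_1[OF q] by (auto simp: r_def power_less_one_iff add_pos_nonneg)
    have t3: "theta3 q > 0" by (rule theta3_pos[OF q])
    have A: "4 * q * (deriv theta_ratio (q\<^sup>2) / theta_ratio (q\<^sup>2)) = g * (1 - r\<^sup>2) / (1 + r\<^sup>2)"
      using deriv_theta_ratio_square[OF q] r(3) unfolding g_def r_def[symmetric]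
      by (subst eq_divide_eq) auto
    have "theta2 (q\<^sup>2) ^ 4 = (2 * (theta2 (q\<^sup>2))\<^sup>2)\<^sup>2 / 4"
      by (simp add: power_mult_distrib)
    hence B: "theta2 (q\<^sup>2) ^ 4 = theta3 q ^ 4 * (1 - r\<^sup>2)\<^sup>2 / 4"
      unfolding theta2_square[OF q] r_def by (simp add: power_mult_distrib)
    have C: "theta2 q ^ 4 = theta3 q ^ 4 * ((1 - r\<^sup>2) * (1 + r\<^sup>2))"
      unfolding theta2_power4[OF q] modular_lambda_def r_def[symmetric] by algebra
    have "h (q\<^sup>2) = - q * (4 * q * (deriv theta_ratio (q\<^sup>2) / theta_ratio (q\<^sup>2))) / theta2 (q\<^sup>2) ^ 4"
      by (simp add: h_def power2_eq_square)
    also have "\<dots> = -4 * q * g / (theta3 q ^ 4 * ((1 - r\<^sup>2) * (1 + r\<^sup>2)))"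
    proof -
      have "- q * (g * u / v) / (w * u\<^sup>2 / 4) = -4 * q * g / (w * (u * v))"
        if "u > 0" "v > 0" "w > 0" for u v w :: real
        using that by (simp add: power2_eq_square) (simp add: mult_ac)
      from this[OF r(4,3), of "theta3 q ^ 4"] show ?thesis
        unfolding A B using t3 by simp
    qed
    also have "\<dots> = h q"
      unfolding h_def C g_def by simp
    finally show "h (q\<^sup>2) = h q" .
  next
    have ev: "eventually (\<lambda>x::real. x \<in> {0<..<1}) (at_right 0)"
      by (rule eventually_at_right_real) simp
    \<comment> \<open>As q -> 0 the logarithmic derivative of the ratio tends to -2 - 2 = -4, while
      theta2^4 behaves like 16 q. The constant -4 in \<open>h\<close> makes the limit 1.\<close>
    have "((\<lambda>q. - (deriv theta4 q / theta4 q - deriv theta3 q / theta3 q) /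
             (4 * (theta2 q / (2 * q powr (1/4))) ^ 4)) \<longlongrightarrow> - (-2 / 1 - 2 / 1) / (4 * 1 ^ 4)) (at_right 0)"
      by (intro tendsto_intros tendsto_theta4 tendsto_theta3 tendsto_theta2) auto
    moreover have "eventually (\<lambda>q. - (deriv theta4 q / theta4 q - deriv theta3 q / theta3 q) /
             (4 * (theta2 q / (2 * q powr (1/4))) ^ 4) = h q) (at_right 0)"
      using ev
    proof eventually_elim
      case (elim q)
      hence q: "0 < q" "q < 1" by auto
      have "(q powr (1/4)) ^ 4 = q"
        using q by (simp add: powr_powr flip: powr_numeral)
      moreover have "deriv theta_ratio q / theta_ratio q = deriv theta4 q / theta4 q - deriv theta3 q / theta3 q"
        using deriv_theta_ratio[OF q] theta_ratio_pos[OF q] by simp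
      ultimately have "h q = -4 * q * (deriv theta4 q / theta4 q - deriv theta3 q / theta3 q) / theta2 q ^ 4"
        "4 * (theta2 q / (2 * q powr (1/4))) ^ 4 = theta2 q ^ 4 / (4 * q)"
        unfolding h_def by (simp_all only: power_divide power_mult_distrib) simp_all
      moreover have "- X / (T / (4 * q)) = -4 * q * X / T" for X T :: real
        by simp
      ultimately show ?case by (simp only:)
    qed
    ultimately show "(h \<longlongrightarrow> 1) (at_right 0)"
      by (auto intro: Lim_transform_eventually)
  qed
  thus ?thesis
    using theta_ratio_pos[OF q] theta2_pos[OF q] by (simp add: h_def field_simps)
qed

lemma has_real_derivative_modular_lambda:
  assumes q: "0 < q" "q < 1"
  shows "(modular_lambda has_real_derivative
           modular_lambda q * (1 - modular_lambda q) * theta3 q ^ 4 / q) (at q)"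
proof -
  have "(modular_lambda has_real_derivative - (4 * theta_ratio q ^ 3 * deriv theta_ratio q)) (at q)"
    unfolding modular_lambda_def[abs_def]
    by (auto intro!: derivative_eq_intros has_real_derivative_theta_ratio q)
  also have "- (4 * theta_ratio q ^ 3 * deriv theta_ratio q) =
             theta_ratio q ^ 3 * (-4 * q * deriv theta_ratio q) / q"
    using q by simp
  also have "\<dots> = theta_ratio q ^ 4 * theta2 q ^ 4 / q"
    unfolding deriv_theta_ratio_eq[OF q] by (simp add: power_Suc[symmetric] numeral_eq_Suc)
  also have "\<dots> = modular_lambda q * (1 - modular_lambda q) * theta3 q ^ 4 / q"
    unfolding theta2_power4[OF q] by (simp add: modular_lambda_def)
  finally show ?thesis .
qed

lemma tendsto_modular_lambda_0: "(modular_lambda \<longlongrightarrow> 0) (at_right 0)"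
proof -
  have "((\<lambda>q. 1 - (theta4 q / theta3 q) ^ 4) \<longlongrightarrow> 1 - (1 / 1) ^ 4) (at_right 0)"
    by (intro tendsto_intros tendsto_theta4 tendsto_theta3) auto
  thus ?thesis by (simp add: modular_lambda_def[abs_def] theta_ratio_def)
qed

text \<open>Landen's transformation is the hypergeometric form of the mean step: under q -> q^2 both
  sides are multiplied by the same factor (1 + r^2)/2, so their quotient is square-invariant and
  equals its limit 1.\<close>

theorem theta3_squared_hypergeo:
  assumes q: "0 < q" "q < 1"
  shows "(theta3 q)\<^sup>2 = hypergeo [1/2, 1/2] [1] (modular_lambda q)"
proof -
  let ?F = "hypergeo [1/2, 1/2] [1]"
  have "(theta3 q)\<^sup>2 / ?F (modular_lambda q) = 1"
  proof (rule square_invariant_eq_limit[where h = "\<lambda>q. (theta3 q)\<^sup>2 / ?F (modular_lambda q)", OF _ _ q])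
    fix q :: real assume q: "0 < q" "q < 1"
    define r where "r = theta_ratio q"
    \<comment> \<open>This is theta2(q^2)^2 / theta3(q^2)^2, the root of lambda(q^2), and lambda(q)
      = 4 x/(1 + x)^2 is Landen's argument.\<close>
    define x where "x = (1 - r\<^sup>2) / (1 + r\<^sup>2)"
    have r: "0 < r" "r < 1" "1 + r\<^sup>2 > 0" "1 - r\<^sup>2 > 0"
      using theta_ratio_pos[OF q] theta_ratio_less_1[OF q] by (auto simp: r_def power_less_one_iff add_pos_nonneg)
    have x: "0 < x" "x < 1" using r by (auto simp: x_def)
    have x1: "1 + x = 2 / (1 + r\<^sup>2)" using r by (simp add: x_def field_simps)
    have "x\<^sup>2 = 1 - ((theta_ratio (q\<^sup>2))\<^sup>2)\<^sup>2"
      unfolding theta_ratio_square[OF q] r_def[symmetric] x_def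
    proof -
      have "((1 - r\<^sup>2) / (1 + r\<^sup>2))\<^sup>2 = ((1 + r\<^sup>2)\<^sup>2 - (2 * r)\<^sup>2) / (1 + r\<^sup>2)\<^sup>2"
        unfolding power_divide by (rule arg_cong2[of _ _ _ _ "(/)"]) (algebra, rule refl)
      thus "((1 - r\<^sup>2) / (1 + r\<^sup>2))\<^sup>2 = 1 - (2 * r / (1 + r\<^sup>2))\<^sup>2"
        using r by (simp add: diff_divide_distrib power_divide)
    qed
    hence lam2: "modular_lambda (q\<^sup>2) = x\<^sup>2" by (simp add: modular_lambda_def)
    have "4 * x / (1 + x)\<^sup>2 = (1 - r\<^sup>2) * (1 + r\<^sup>2)"
    proof -
      have "4 * (u / v) / (2 / v)\<^sup>2 = u * v" if "v > 0" for u v :: real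
        using that by (simp add: power2_eq_square)
      from this[OF r(3)] show ?thesis unfolding x1 unfolding x_def .
    qed
    hence "modular_lambda q = 4 * x / (1 + x)\<^sup>2"
      unfolding modular_lambda_def r_def[symmetric] by algebra
    hence "?F (modular_lambda q) = 2 / (1 + r\<^sup>2) * ?F (modular_lambda (q\<^sup>2))"
      using hypergeo_Landen[OF x] by (simp add: lam2 x1)
    moreover have "(theta3 (q\<^sup>2))\<^sup>2 = (theta3 q)\<^sup>2 * (1 + r\<^sup>2) / 2"
      using theta3_square[OF q] unfolding r_def by linarith
    ultimately show "(theta3 (q\<^sup>2))\<^sup>2 / ?F (modular_lambda (q\<^sup>2)) = (theta3 q)\<^sup>2 / ?F (modular_lambda q)"
      by (simp only:) simp
  next
    have "isCont ?F 0" by (rule isCont_hypergeo_2F1) auto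
    hence "((\<lambda>q. ?F (modular_lambda q)) \<longlongrightarrow> ?F 0) (at_right 0)"
      by (rule isCont_tendsto_compose[OF _ tendsto_modular_lambda_0])
    hence "((\<lambda>q. (theta3 q)\<^sup>2 / ?F (modular_lambda q)) \<longlongrightarrow> 1\<^sup>2 / 1) (at_right 0)"
      by (intro tendsto_intros tendsto_theta3) auto
    thus "((\<lambda>q. (theta3 q)\<^sup>2 / ?F (modular_lambda q)) \<longlongrightarrow> 1) (at_right 0)" by simp
  qed
  thus ?thesis
    by (simp add: divide_eq_1_iff)
qed

section \<open>Mellin transforms and L-values\<close>

abbreviation halfline :: "real measure" where
  "halfline \<equiv> lebesgue_on {0<..}"

lemma integrable_lebesgue_on_iff:
  fixes f :: "'a::euclidean_space \<Rightarrow> 'b::{banach, second_countable_topology}"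
  assumes "S \<in> sets lebesgue"
  shows "integrable (lebesgue_on S) f \<longleftrightarrow> f absolutely_integrable_on S"
  using assms by (simp add: set_integrable_def integrable_restrict_space)

lemma integrable_exp_neg_halfline:
  assumes "(a::real) > 0"
  shows "integrable halfline (\<lambda>t. exp (- a * t))"
proof -
  have "(\<lambda>t. exp (- a * t)) absolutely_integrable_on {0..}"
    using integrable_on_exp_minus_to_infinity[OF assms, of 0]
    by (rule nonnegative_absolutely_integrable_1) auto
  hence "(\<lambda>t. exp (- a * t)) absolutely_integrable_on {0<..}"
    by (rule set_integrable_subset) auto
  thus ?thesis by (subst integrable_lebesgue_on_iff) auto
qed

text \<open>The power t^(s - 1) is written as an exponential of ln t to match the kernel of
  \<open>mellin\<close>, which is expanded in powers of its exponent.\<close>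

lemma Gamma_integral_halfline:
  assumes "m > 0" "Re s > 0"
  shows "has_bochner_integral halfline
           (\<lambda>t. of_real (exp (- m * t)) * exp ((s - 1) * of_real (ln t)))
           (Gamma s * of_real m powr (- s))"
proof -
  define g where "g = (\<lambda>t. of_real t powr (s - 1) / of_real (exp t) :: complex)"
  have "g absolutely_integrable_on {0<..} \<and> integral {0<..} g = Gamma s"
    using absolutely_integrable_Gamma_integral'[OF assms(2)] Gamma_integral_complex'[OF assms(2)]
    by (auto simp: g_def integral_unique)
  moreover have "(\<lambda>t. m * t) ` {0<..} = {0<..}"
    using assms by (auto simp: image_iff intro!: bexI[of _ "x / m" for x])
  ultimately have *: "(\<lambda>t. \<bar>m\<bar> *\<^sub>R g (m * t)) absolutely_integrable_on {0<..} \<and>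
        integral {0<..} (\<lambda>t. \<bar>m\<bar> *\<^sub>R g (m * t)) = Gamma s"
    using assms
    by (subst has_absolute_integral_change_of_variables_real[where g = "\<lambda>t. m * t"])
       (auto intro!: derivative_eq_intros inj_onI)
  have I: "integrable halfline (\<lambda>t. \<bar>m\<bar> *\<^sub>R g (m * t))"
    using * by (subst integrable_lebesgue_on_iff) auto
  have "has_bochner_integral halfline (\<lambda>t. \<bar>m\<bar> *\<^sub>R g (m * t)) (Gamma s)"
    using * I lebesgue_integral_eq_integral[OF I] by (auto simp: has_bochner_integral_iff)
  hence "has_bochner_integral halfline (\<lambda>t. \<bar>m\<bar> *\<^sub>R g (m * t) * of_real m powr (- s))
           (Gamma s * of_real m powr (- s))"
    by (rule has_bochner_integral_mult_left)
  thus ?thesis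
  proof (rule has_bochner_integral_cong[THEN iffD1, rotated -1])
    fix t assume "t \<in> space halfline"
    hence t: "t > 0" by simp
    define A where "A = exp ((s - 1) * of_real (ln m))"
    define E where "E = exp ((s - 1) * of_real (ln t))"
    have 1: "of_real (m * t) powr (s - 1) = A * E"
      using t assms
      by (simp add: A_def E_def powr_def ln_mult Ln_of_real distrib_left exp_add del: of_real_mult)
    have "of_real m powr (- s) = exp (- ((s - 1) * of_real (ln m)) - of_real (ln m))"
      using assms by (simp add: powr_def Ln_of_real algebra_simps)
    also have "\<dots> = inverse A / of_real m"
      unfolding exp_diff exp_of_real exp_minus A_def using assms by simp
    finally have 2: "of_real m powr (- s) = inverse A / of_real m" .
    have "A \<noteq> 0" by (simp add: A_def)
    thus "\<bar>m\<bar> *\<^sub>R g (m * t) * of_real m powr (- s) = of_real (exp (- m * t)) * exp ((s - 1) * of_real (ln t))"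
      unfolding g_def 1 2 E_def[symmetric] using assms
      by (simp add: scaleR_conv_of_real exp_minus field_simps)
  qed auto
qed

lemma sums_integral_dominated:
  fixes g :: "nat \<Rightarrow> 'a \<Rightarrow> 'b::{banach, second_countable_topology}"
  assumes meas: "\<And>k. g k \<in> borel_measurable M"
    and G: "integrable M G"
    and bound: "\<And>t. t \<in> space M \<Longrightarrow> summable (\<lambda>k. norm (g k t)) \<and> (\<Sum>k. norm (g k t)) \<le> G t"
  shows "integrable M (\<lambda>t. \<Sum>k. g k t)" "(\<lambda>k. \<integral>t. g k t \<partial>M) sums (\<integral>t. (\<Sum>k. g k t) \<partial>M)"
proof -
  have partial: "(\<Sum>k<n. norm (g k t)) \<le> G t" if "t \<in> space M" for n t
    using bound[OF that] sum_le_suminf[of "\<lambda>k. norm (g k t)" "{..<n}"] by force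
  have int: "integrable M (g k)" for k
  proof (rule Bochner_Integration.integrable_bound[OF G meas])
    have "norm (g k t) \<le> norm (G t)" if "t \<in> space M" for t
      using bound[OF that] sum_le_suminf[of "\<lambda>k. norm (g k t)" "{k}"] by force
    thus "AE t in M. norm (g k t) \<le> norm (G t)" by simp
  qed
  have sum: "summable (\<lambda>k. \<integral>t. norm (g k t) \<partial>M)"
  proof (rule summableI_nonneg_bounded)
    show "(\<Sum>k<n. \<integral>t. norm (g k t) \<partial>M) \<le> (\<integral>t. G t \<partial>M)" for n
    proof -
      have "(\<Sum>k<n. \<integral>t. norm (g k t) \<partial>M) = (\<integral>t. (\<Sum>k<n. norm (g k t)) \<partial>M)"
        using int by (simp add: Bochner_Integration.integral_sum)
      also have "\<dots> \<le> (\<integral>t. G t \<partial>M)"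
        using int G partial by (intro integral_mono) auto
      finally show ?thesis .
    qed
  qed auto
  have ae: "AE t in M. summable (\<lambda>k. norm (g k t))"
    using bound by auto
  show "integrable M (\<lambda>t. \<Sum>k. g k t)" "(\<lambda>k. \<integral>t. g k t \<partial>M) sums (\<integral>t. (\<Sum>k. g k t) \<partial>M)"
    using integrable_suminf[OF int ae sum] sums_integral[OF int ae sum] by auto
qed

text \<open>The classical Mellin transform at s with w = s - 1, so that s = 1 corresponds to w = 0,
  the plain integral.\<close>

definition mellin :: "(real \<Rightarrow> real) \<Rightarrow> complex \<Rightarrow> complex" where
  "mellin \<phi> w = (\<integral>t. of_real (\<phi> t) * exp (w * of_real (ln t)) \<partial>halfline)"

text \<open>Expanding exp(w ln t) in powers of w and integrating termwise gives a power series in w.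
  The bound, required for every R, dominates the terms whenever |w| <= R, so the series converges
  everywhere and the transform is entire.\<close>

lemma mellin_holomorphic:
  assumes meas[measurable]: "\<phi> \<in> borel_measurable halfline"
    and bound: "\<And>R::nat. \<exists>K. \<forall>t>0. \<bar>\<phi> t\<bar> * exp (real R * \<bar>ln t\<bar>) \<le> K * exp (- (1/2) * t)"
  shows "mellin \<phi> holomorphic_on UNIV"
proof -
  define \<mu> where "\<mu> = (\<lambda>k. \<integral>t. of_real (\<phi> t) * of_real (ln t) ^ k / fact k \<partial>halfline :: complex)"
  have sums: "(\<lambda>k. \<mu> k * (w - 0) ^ k) sums mellin \<phi> w" for w
  proof -
    define g where "g = (\<lambda>k t. of_real (\<phi> t) * of_real (ln t) ^ k / fact k * w ^ k :: complex)"
    obtain R :: nat where R: "norm w \<le> real R" using real_arch_simple by blast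
    obtain K where K: "\<And>t. t > 0 \<Longrightarrow> \<bar>\<phi> t\<bar> * exp (real R * \<bar>ln t\<bar>) \<le> K * exp (- (1/2) * t)"
      using bound[of R] by blast
    have ln_meas[measurable]: "ln \<in> borel_measurable halfline"
      by (intro measurable_restrict_space1 measurable_completion) auto
    have "(\<lambda>k. \<integral>t. g k t \<partial>halfline) sums (\<integral>t. (\<Sum>k. g k t) \<partial>halfline)"
    proof (rule sums_integral_dominated(2))
      show "g k \<in> borel_measurable halfline" for k
        unfolding g_def by measurable
      show "integrable halfline (\<lambda>t. K * exp (- (1/2) * t))"
        by (intro integrable_mult_right integrable_exp_neg_halfline) auto
      fix t assume "t \<in> space halfline"
      hence t: "t > 0" by simp
      have "(\<lambda>k. \<bar>\<phi> t\<bar> * ((norm w * \<bar>ln t\<bar>) ^ k /\<^sub>R fact k)) sums (\<bar>\<phi> t\<bar> * exp (norm w * \<bar>ln t\<bar>))"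
        by (intro sums_mult exp_converges)
      moreover have "norm (g k t) = \<bar>\<phi> t\<bar> * ((norm w * \<bar>ln t\<bar>) ^ k /\<^sub>R fact k)" for k
        by (simp add: g_def norm_mult norm_divide norm_power norm_inverse power_mult_distrib divide_inverse mult_ac)
      moreover have "\<bar>\<phi> t\<bar> * exp (norm w * \<bar>ln t\<bar>) \<le> \<bar>\<phi> t\<bar> * exp (real R * \<bar>ln t\<bar>)"
        using R by (intro mult_left_mono) (auto intro: mult_right_mono)
      ultimately show "summable (\<lambda>k. norm (g k t)) \<and> (\<Sum>k. norm (g k t)) \<le> K * exp (- (1/2) * t)"
        using K[OF t] by (auto simp: sums_iff)
    qed
    also have "(\<lambda>k. \<integral>t. g k t \<partial>halfline) = (\<lambda>k. \<mu> k * (w - 0) ^ k)"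
      by (simp add: g_def \<mu>_def)
    also have "(\<lambda>t. \<Sum>k. g k t) = (\<lambda>t. of_real (\<phi> t) * exp (w * of_real (ln t)))"
    proof
      fix t
      have "(\<lambda>k. of_real (\<phi> t) * ((w * of_real (ln t)) ^ k /\<^sub>R fact k)) sums (of_real (\<phi> t) * exp (w * of_real (ln t)))"
        by (intro sums_mult exp_converges)
      moreover have "of_real (\<phi> t) * ((w * of_real (ln t)) ^ k /\<^sub>R fact k) = g k t" for k
        by (simp add: g_def power_mult_distrib scaleR_conv_of_real field_simps)
      ultimately show "(\<Sum>k. g k t) = of_real (\<phi> t) * exp (w * of_real (ln t))"
        by (simp add: sums_iff)
    qed
    finally show ?thesis unfolding mellin_def .
  qed
  have "mellin \<phi> holomorphic_on ball 0 (real n)" for n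
    by (rule power_series_holomorphic) (rule sums)
  hence "mellin \<phi> field_differentiable (at w)" for w
  proof -
    obtain n where "norm w < real n" using reals_Archimedean2 by blast
    thus ?thesis using \<open>mellin \<phi> holomorphic_on ball 0 (real n)\<close>
      by (auto simp: holomorphic_on_open field_differentiable_def)
  qed
  thus ?thesis by (simp add: holomorphic_on_def)
qed

lemma power_le_exp: "x ^ n \<le> real n ^ n * exp x" if "x \<ge> 0" for x :: real
proof (cases "n = 0")
  case False
  have "(x / real n) ^ n \<le> (1 + x / real n) ^ n"
    using that by (intro power_mono) auto
  also have "\<dots> \<le> exp x"
    using that False by (intro exp_ge_one_plus_x_over_n_power_n) auto
  finally show ?thesis
    using False by (simp add: power_divide field_simps)
qed (use that in auto)

lemma power_times_exp_minus_le:
  "t ^ n * exp (- t) \<le> (2 * real n) ^ n * exp (- (1/2) * t)" if "t \<ge> 0" for t :: real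
proof -
  have "t ^ n = 2 ^ n * (t / 2) ^ n" by (simp add: power_divide)
  also have "\<dots> \<le> 2 ^ n * (real n ^ n * exp (t / 2))"
    using that by (intro mult_left_mono power_le_exp) auto
  finally have "t ^ n * exp (- t) \<le> 2 ^ n * (real n ^ n * exp (t / 2)) * exp (- t)"
    by (rule mult_right_mono) simp
  thus ?thesis by (simp add: power_mult_distrib mult.assoc flip: exp_add)
qed

text \<open>For Re s > 4 termwise integration gives Gamma(s) L(s) =
  \<open>mellin \<phi> (s - 1)\<close>. By \<open>decay\<close> the right side is entire, so
  dividing by Gamma gives the continuation. The cubic bound makes the coefficients times n^(-s)
  absolutely summable exactly in the half-plane that weight 3 prescribes.\<close>

theorem has_L_value_at_1:
  assumes exp: "q_expansion f a"
    and coeff: "\<And>n. n \<ge> 1 \<Longrightarrow> \<bar>a n\<bar> \<le> C * real n ^ 3"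
    and decay: "\<And>N. \<exists>K. \<forall>t. 0 < t \<and> t \<le> 1 \<longrightarrow> \<bar>f (exp (- t))\<bar> \<le> K * t ^ N"
  shows "(\<lambda>t. f (exp (- t))) integrable_on {0<..}"
    and "has_L_value 3 f 1 (of_real (integral {0<..} (\<lambda>t. f (exp (- t)))))"
proof -
  define \<phi> where "\<phi> = (\<lambda>t. f (exp (- t)))"
  define b where "b = (\<lambda>n. a (Suc n))"
  have fsum: "(\<lambda>n. b n * q ^ n) sums (f q / q)" if "0 < q" "q < 1" for q
    using sums_divide[of _ "f q" q] exp that by (force simp: q_expansion_def b_def)
  have abs_sum: "summable (\<lambda>n. \<bar>b n\<bar> * q ^ n)" if "0 < q" "q < 1" for q
    using powser_insidea[of b "(q + 1) / 2" q] fsum[of "(q + 1) / 2"] that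
    by (auto simp: sums_iff abs_mult)
  have \<phi>_sums: "(\<lambda>n. b n * exp (- real (Suc n) * t)) sums \<phi> t" if "t > 0" for t
  proof -
    have "(\<lambda>n. b n * exp (- t) ^ Suc n) sums \<phi> t"
      using exp that by (simp add: q_expansion_def b_def \<phi>_def)
    moreover have "exp (- t) ^ Suc n = exp (- real (Suc n) * t)" for n
      by (subst exp_of_nat_mult[symmetric]) (simp add: algebra_simps)
    ultimately show ?thesis by simp
  qed
  have b_sum: "summable (\<lambda>n. \<bar>b n\<bar> * exp (- real (Suc n) * t))" if "t > 0" for t
  proof -
    have "exp (- t) ^ Suc n = exp (- real (Suc n) * t)" for n
      by (subst exp_of_nat_mult[symmetric]) (simp add: algebra_simps)
    thus ?thesis
      using summable_mult[OF abs_sum[of "exp (- t)"], of "exp (- t)"] that by (simp add: mult_ac)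
  qed
  define S where "S = (\<Sum>n. \<bar>b n\<bar> * exp (- real (Suc n) * 1))"
  have large: "\<bar>\<phi> t\<bar> \<le> S * exp 1 * exp (- t)" if t: "t \<ge> 1" for t
  proof -
    have "\<bar>\<phi> t\<bar> \<le> (\<Sum>n. \<bar>b n\<bar> * exp (- real (Suc n) * t))"
      using \<phi>_sums[of t] summable_rabs[of "\<lambda>n. b n * exp (- real (Suc n) * t)"] b_sum[of t] t
      by (auto simp: sums_iff abs_mult)
    \<comment> \<open>The expansion starts with the first power, so passing from 1 to t costs at
      least a factor exp(1 - t) in every term.\<close>
    also have "\<dots> \<le> (\<Sum>n. \<bar>b n\<bar> * exp (- real (Suc n) * 1) * exp (1 - t))"
    proof (rule suminf_le)
      fix n
      have "real n * 1 \<le> real n * t" using t by (intro mult_left_mono) auto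
      hence "exp (- real (Suc n) * t) \<le> exp (- real (Suc n) * 1 + (1 - t))"
        by (simp add: algebra_simps)
      thus "\<bar>b n\<bar> * exp (- real (Suc n) * t) \<le> \<bar>b n\<bar> * exp (- real (Suc n) * 1) * exp (1 - t)"
        by (simp only: mult.assoc exp_add[symmetric]) (rule mult_left_mono, auto)
    qed (use b_sum[of t] b_sum[of 1] t in \<open>auto intro: summable_mult2\<close>)
    also have "\<dots> = S * exp (1 - t)"
      unfolding S_def by (rule suminf_mult2[symmetric]) (use b_sum[of 1] in auto)
    finally show ?thesis by (simp add: exp_diff exp_minus field_simps)
  qed
  have cont: "continuous_on {0<..} \<phi>"
  proof (rule continuous_at_imp_continuous_on, rule ballI)
    fix t :: real assume "t \<in> {0<..}"
    hence t: "t > 0" by simp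
    define q where "q = exp (- t)"
    have q: "0 < q" "q < 1" using t by (auto simp: q_def)
    have "isCont (\<lambda>x. x * (\<Sum>n. b n * x ^ n)) q"
      using fsum[of "(q + 1) / 2"] q
      by (intro continuous_intros isCont_powser[where K = "(q + 1) / 2"]) (auto simp: sums_iff)
    moreover have "eventually (\<lambda>x. x * (\<Sum>n. b n * x ^ n) = f x) (nhds q)"
      using eventually_nhds_in_open[of "{0<..<1}" q] q fsum
      by (auto elim!: eventually_mono simp: sums_iff)
    ultimately have "isCont f q"
      using isCont_cong[of "\<lambda>x. x * (\<Sum>n. b n * x ^ n)" f q] by blast
    moreover have "isCont (\<lambda>t. exp (- t)) t" by (intro continuous_intros)
    ultimately show "isCont \<phi> t"
      unfolding \<phi>_def q_def by (rule isCont_o2[rotated])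
  qed
  have meas: "\<phi> \<in> borel_measurable halfline"
    by (rule continuous_imp_measurable_on_sets_lebesgue[OF cont]) auto
  have bound: "\<exists>K. \<forall>t>0. \<bar>\<phi> t\<bar> * exp (real R * \<bar>ln t\<bar>) \<le> K * exp (- (1/2) * t)" for R :: nat
  proof -
    obtain K where K: "\<And>t. 0 < t \<Longrightarrow> t \<le> 1 \<Longrightarrow> \<bar>\<phi> t\<bar> \<le> K * t ^ R"
      using decay[of R] unfolding \<phi>_def by blast
    define K' where "K' = (2 * real R) ^ R"
    have K': "t ^ R * exp (- t) \<le> K' * exp (- (1/2) * t)" if "t \<ge> 1" for t :: real
      using power_times_exp_minus_le[of t R] that by (simp add: K'_def)
    have S0: "S \<ge> 0" unfolding S_def by (intro suminf_nonneg) (use b_sum[of 1] in auto)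
    have K0: "K \<ge> 0" using order_trans[OF abs_ge_zero K[of 1]] by simp
    have K'0: "K' \<ge> 0" by (simp add: K'_def)
    have e: "exp (real R * \<bar>x\<bar>) = (exp \<bar>x\<bar>) ^ R" for x :: real
      by (simp add: exp_of_nat_mult)
    \<comment> \<open>On t <= 1 the exponential is t^(-R), absorbed by the decay of order R; for t >
      1 it is t^R, absorbed by half of exp(-t).\<close>
    have "\<bar>\<phi> t\<bar> * exp (real R * \<bar>ln t\<bar>) \<le> max (K * exp (1/2)) (S * exp 1 * K') * exp (- (1/2) * t)"
      if t: "t > 0" for t
    proof (cases "t \<le> 1")
      case True
      have "exp \<bar>ln t\<bar> = inverse t" using True t by (simp add: exp_minus)
      hence "\<bar>\<phi> t\<bar> * exp (real R * \<bar>ln t\<bar>) \<le> K * t ^ R * inverse t ^ R"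
        unfolding e using K[OF t True] t by (simp add: mult_right_mono)
      also have "\<dots> = K" using t by (simp add: power_inverse)
      also have "\<dots> \<le> K * exp (1/2) * exp (- (1/2) * t)"
        using K0 True by (simp add: mult.assoc mult_le_cancel_left1 flip: exp_add)
      also have "\<dots> \<le> max (K * exp (1/2)) (S * exp 1 * K') * exp (- (1/2) * t)"
        by (intro mult_right_mono) auto
      finally show ?thesis .
    next
      case False
      hence "exp \<bar>ln t\<bar> = t" by simp
      hence "\<bar>\<phi> t\<bar> * exp (real R * \<bar>ln t\<bar>) \<le> S * exp 1 * exp (- t) * t ^ R"
        unfolding e using large[of t] False by (simp add: mult_right_mono)
      also have "\<dots> = S * exp 1 * (t ^ R * exp (- t))" by simp
      also have "\<dots> \<le> S * exp 1 * (K' * exp (- (1/2) * t))"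
        using K'[of t] False S0 by (intro mult_left_mono) auto
      also have "\<dots> \<le> max (K * exp (1/2)) (S * exp 1 * K') * exp (- (1/2) * t)"
        unfolding mult.assoc[symmetric] by (intro mult_right_mono) auto
      finally show ?thesis .
    qed
    thus ?thesis by blast
  qed
  \<comment> \<open>\<open>rGamma\<close> is the entire reciprocal of Gamma, so L is entire, and
    \<open>rGamma 1 = 1\<close> makes L(1) the integral itself.\<close>
  define L where "L = (\<lambda>s. rGamma s * mellin \<phi> (s - 1))"
  have "(\<lambda>s. mellin \<phi> (s - 1)) holomorphic_on UNIV"
    using holomorphic_on_compose[OF _ holomorphic_on_subset[OF mellin_holomorphic[OF meas bound] subset_UNIV],
       of "\<lambda>s. s - 1" UNIV] by (simp add: o_def holomorphic_intros)
  hence hol: "L holomorphic_on UNIV"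
    unfolding L_def by (intro holomorphic_intros)
  have I0: "integrable halfline (\<lambda>t. \<phi> t)"
  proof -
    obtain K where "\<forall>t>0. \<bar>\<phi> t\<bar> * exp (real 0 * \<bar>ln t\<bar>) \<le> K * exp (- (1/2) * t)"
      using bound[of 0] by blast
    hence K: "\<forall>t>0. \<bar>\<phi> t\<bar> \<le> K * exp (- (1/2) * t)" by simp
    show ?thesis
    proof (rule Bochner_Integration.integrable_bound[OF _ meas])
      show "integrable halfline (\<lambda>t. K * exp (- (1/2) * t))"
        by (intro integrable_mult_right integrable_exp_neg_halfline) auto
      have "norm (\<phi> t) \<le> norm (K * exp (- (1/2) * t))" if "t \<in> space halfline" for t
        using K that by (auto intro: order_trans[OF _ abs_ge_self])
      thus "AE t in halfline. norm (\<phi> t) \<le> norm (K * exp (- (1/2) * t))" by (rule AE_I2)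
    qed
  qed
  thus int: "(\<lambda>t. f (exp (- t))) integrable_on {0<..}"
    unfolding \<phi>_def by (subst (asm) integrable_lebesgue_on_iff) (auto intro: set_lebesgue_integral_eq_integral)
  define I where "I = integral {0<..} (\<lambda>t. f (exp (- t)))"
  have L1: "L 1 = of_real I"
  proof -
    have "mellin \<phi> (1 - 1) = (\<integral>t. of_real (\<phi> t) \<partial>halfline)"
      by (simp add: mellin_def)
    also have "\<dots> = of_real (\<integral>t. \<phi> t \<partial>halfline)"
      by (rule integral_complex_of_real)
    also have "(\<integral>t. \<phi> t \<partial>halfline) = I"
      using lebesgue_integral_eq_integral[OF I0] by (simp add: \<phi>_def I_def)
    finally show ?thesis by (simp add: L_def)
  qed
  have dirichlet: "(\<lambda>n. of_real (a (Suc n)) * of_nat (Suc n) powr (- s)) sums L s" if s: "Re s > 4" for s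
  proof -
    define g where "g = (\<lambda>n t. of_real (b n) * (of_real (exp (- real (Suc n) * t)) * exp ((s - 1) * of_real (ln t))))"
    have G: "has_bochner_integral halfline (g n) (of_real (b n) * (Gamma s * of_nat (Suc n) powr (- s)))" for n
    proof -
      have "0 < real (Suc n)" "0 < Re s" using s by auto
      from Gamma_integral_halfline[OF this] show ?thesis
        unfolding g_def of_real_of_nat_eq by (rule has_bochner_integral_mult_right)
    qed
    have ng: "norm (g n t) = \<bar>b n\<bar> * (exp (- real (Suc n) * t) * exp ((Re s - 1) * ln t))" for n t
      by (simp add: g_def norm_mult)
    \<comment> \<open>The norm of the kernel is the kernel at the real point Re s, so the same Gamma
      integral evaluates it; these values justify exchanging sum and integral.\<close>
    have NG: "has_bochner_integral halfline (\<lambda>t. norm (g n t)) (\<bar>b n\<bar> * (Gamma (Re s) * real (Suc n) powr (- Re s)))" for n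
    proof -
      have "has_bochner_integral halfline
           (\<lambda>t. Re (of_real (exp (- real (Suc n) * t)) * exp ((of_real (Re s) - 1) * of_real (ln t))))
           (Re (Gamma (of_real (Re s)) * of_real (real (Suc n)) powr (- of_real (Re s))))"
        using s by (intro has_bochner_integral_Re Gamma_integral_halfline) auto
      also have "(\<lambda>t. Re (of_real (exp (- real (Suc n) * t)) * exp ((of_real (Re s) - 1) * of_real (ln t)))) =
           (\<lambda>t. exp (- real (Suc n) * t) * exp ((Re s - 1) * ln t))"
        by (simp add: Re_exp)
      also have "Re (Gamma (of_real (Re s)) * of_real (real (Suc n)) powr (- of_real (Re s))) =
           Gamma (Re s) * real (Suc n) powr (- Re s)"
        by (simp only: Gamma_complex_of_real of_real_minus[symmetric] powr_of_real of_nat_0_le_iff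
              of_real_mult[symmetric] Re_complex_of_real)
      finally show ?thesis unfolding ng by (rule has_bochner_integral_mult_right)
    qed
    have "(\<lambda>n. \<integral>t. g n t \<partial>halfline) sums (\<integral>t. (\<Sum>n. g n t) \<partial>halfline)"
    proof (rule sums_integral)
      show "integrable halfline (g n)" for n using G by (rule integrable.intros)
      have "summable (\<lambda>n. norm (g n t))" if "t > 0" for t
        unfolding ng mult.assoc[symmetric] by (rule summable_mult2[OF b_sum[OF that]])
      thus "AE t in halfline. summable (\<lambda>n. norm (g n t))" by (intro AE_I2) simp
      have C0: "C \<ge> 0" using coeff[of 1] abs_ge_zero[of "a 1"] by simp
      have "summable (\<lambda>n. C * Gamma (Re s) * real (Suc n) powr (3 - Re s))"
        using s summable_real_powr_iff[of "3 - Re s"]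
        by (intro summable_mult) (subst summable_Suc_iff[of "\<lambda>n. real n powr (3 - Re s)"], simp)
      thus "summable (\<lambda>n. \<integral>t. norm (g n t) \<partial>halfline)"
      proof (rule summable_comparison_test'[where N = 0])
        fix n :: nat
        have "\<bar>b n\<bar> * (Gamma (Re s) * real (Suc n) powr (- Re s)) \<le>
              (C * real (Suc n) ^ 3) * (Gamma (Re s) * real (Suc n) powr (- Re s))"
          using coeff[of "Suc n"] s by (intro mult_right_mono mult_nonneg_nonneg Gamma_real_nonneg) (auto simp: b_def)
        also have "\<dots> = C * Gamma (Re s) * real (Suc n) powr (3 - Re s)"
          by (simp add: powr_diff powr_minus divide_inverse mult_ac)
        finally have "(\<integral>t. norm (g n t) \<partial>halfline) \<le> C * Gamma (Re s) * real (Suc n) powr (3 - Re s)"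
          unfolding has_bochner_integral_integral_eq[OF NG[of n]] .
        moreover have "0 \<le> (\<integral>t. norm (g n t) \<partial>halfline)" by simp
        ultimately show "norm (\<integral>t. norm (g n t) \<partial>halfline) \<le> C * Gamma (Re s) * real (Suc n) powr (3 - Re s)"
          by (simp only: real_norm_def abs_of_nonneg)
      qed
    qed
    also have "(\<lambda>n. \<integral>t. g n t \<partial>halfline) = (\<lambda>n. of_real (b n) * (Gamma s * of_nat (Suc n) powr (- s)))"
      using has_bochner_integral_integral_eq[OF G] by (intro ext)
    also have "(\<integral>t. (\<Sum>n. g n t) \<partial>halfline) = mellin \<phi> (s - 1)"
      unfolding mellin_def
    proof (rule Bochner_Integration.integral_cong)
      fix t assume "t \<in> space halfline"
      hence "(\<lambda>n. of_real (b n * exp (- real (Suc n) * t)) * exp ((s - 1) * of_real (ln t))) sums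
               (of_real (\<phi> t) * exp ((s - 1) * of_real (ln t)))"
        using \<phi>_sums[of t] by (intro sums_mult2 sums_of_real) auto
      thus "(\<Sum>n. g n t) = of_real (\<phi> t) * exp ((s - 1) * of_real (ln t))"
        by (simp add: g_def sums_iff mult_ac)
    qed auto
    finally have "(\<lambda>n. rGamma s * (of_real (b n) * (Gamma s * of_nat (Suc n) powr (- s)))) sums L s"
      unfolding L_def by (rule sums_mult)
    moreover have "Gamma s \<noteq> 0"
      using s by (auto simp: Gamma_eq_zero_iff elim!: nonpos_Ints_cases)
    hence "rGamma s * Gamma s = 1" by (simp add: Gamma_def)
    hence "rGamma s * (of_real (b n) * (Gamma s * of_nat (Suc n) powr (- s))) =
           of_real (a (Suc n)) * of_nat (Suc n) powr (- s)" for n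
      unfolding b_def by (metis (no_types, opaque_lifting) mult.assoc mult.left_commute mult_1)
    ultimately show ?thesis by (simp only:)
  qed
  have "is_L_function 3 f L"
    unfolding is_L_function_def
    using analytic_on_imp_nicely_meromorphic_on[of L UNIV] hol exp dirichlet
    by (auto simp: analytic_on_open)
  moreover have "\<not> is_pole L 1"
    using hol by (intro not_is_pole_holomorphic[of UNIV]) auto
  ultimately show "has_L_value 3 f 1 (of_real (integral {0<..} (\<lambda>t. f (exp (- t)))))"
    unfolding has_L_value_def using L1 I_def by blast
qed

section \<open>Theta products of weight 3\<close>

text \<open>Cauchy's majorants, with the coefficients hidden. The relation is stable under products
  and q -> q^k, so coefficient bounds for a theta product reduce to values of a product with
  nonnegative coefficients.\<close>

definition majorized_powser :: "(real \<Rightarrow> real) \<Rightarrow> (real \<Rightarrow> real) \<Rightarrow> bool" where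
  "majorized_powser f g \<longleftrightarrow>
     (\<exists>a b. (\<forall>n. \<bar>a n\<bar> \<le> b n) \<and>
            (\<forall>q. 0 < q \<and> q < 1 \<longrightarrow> (\<lambda>n. a n * q ^ n) sums f q \<and> (\<lambda>n. b n * q ^ n) sums g q))"

lemma majorized_powserI:
  assumes "\<And>n. \<bar>a n\<bar> \<le> b n"
    and "\<And>q. 0 < q \<Longrightarrow> q < 1 \<Longrightarrow> (\<lambda>n. a n * q ^ n) sums f q"
    and "\<And>q. 0 < q \<Longrightarrow> q < 1 \<Longrightarrow> (\<lambda>n. b n * q ^ n) sums g q"
  shows "majorized_powser f g"
  using assms unfolding majorized_powser_def by blast

lemma majorized_powser_mult:
  assumes "majorized_powser f g" "majorized_powser f' g'"
  shows "majorized_powser (\<lambda>q. f q * f' q) (\<lambda>q. g q * g' q)"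
proof -
  obtain a b where ab: "\<And>n. \<bar>a n\<bar> \<le> b n"
    "\<And>q. 0 < q \<Longrightarrow> q < 1 \<Longrightarrow> (\<lambda>n. a n * q ^ n) sums f q"
    "\<And>q. 0 < q \<Longrightarrow> q < 1 \<Longrightarrow> (\<lambda>n. b n * q ^ n) sums g q"
    using assms(1) unfolding majorized_powser_def by blast
  obtain a' b' where ab': "\<And>n. \<bar>a' n\<bar> \<le> b' n"
    "\<And>q. 0 < q \<Longrightarrow> q < 1 \<Longrightarrow> (\<lambda>n. a' n * q ^ n) sums f' q"
    "\<And>q. 0 < q \<Longrightarrow> q < 1 \<Longrightarrow> (\<lambda>n. b' n * q ^ n) sums g' q"
    using assms(2) unfolding majorized_powser_def by blast
  have prod: "(\<lambda>n. (\<Sum>i\<le>n. c i * c' (n - i)) * q ^ n) sums (s * s')"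
    if "\<And>n. \<bar>c n\<bar> \<le> b n" "\<And>n. \<bar>c' n\<bar> \<le> b' n"
       "(\<lambda>n. c n * q ^ n) sums s" "(\<lambda>n. c' n * q ^ n) sums s'" "0 < q" "q < 1"
    for c c' :: "nat \<Rightarrow> real" and q s s'
  proof -
    have "summable (\<lambda>n. norm (c n * q ^ n))"
      by (rule summable_comparison_test'[where g = "\<lambda>n. b n * q ^ n" and N = 0])
         (use that ab(3) in \<open>auto simp: sums_iff abs_mult intro!: mult_right_mono\<close>)
    moreover have "summable (\<lambda>n. norm (c' n * q ^ n))"
      by (rule summable_comparison_test'[where g = "\<lambda>n. b' n * q ^ n" and N = 0])
         (use that ab'(3) in \<open>auto simp: sums_iff abs_mult intro!: mult_right_mono\<close>)
    ultimately have "(\<lambda>n. \<Sum>i\<le>n. (c i * q ^ i) * (c' (n - i) * q ^ (n - i))) sums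
        ((\<Sum>n. c n * q ^ n) * (\<Sum>n. c' n * q ^ n))"
      by (rule Cauchy_product_sums)
    also have "(\<lambda>n. \<Sum>i\<le>n. (c i * q ^ i) * (c' (n - i) * q ^ (n - i))) =
               (\<lambda>n. (\<Sum>i\<le>n. c i * c' (n - i)) * q ^ n)"
    proof
      fix n
      have "(c i * q ^ i) * (c' (n - i) * q ^ (n - i)) = c i * c' (n - i) * q ^ n" if "i \<le> n" for i
        using that power_add[of q i "n - i"] by simp
      thus "(\<Sum>i\<le>n. (c i * q ^ i) * (c' (n - i) * q ^ (n - i))) = (\<Sum>i\<le>n. c i * c' (n - i)) * q ^ n"
        unfolding sum_distrib_right by (intro sum.cong refl) auto
    qed
    finally show ?thesis using that by (simp add: sums_iff)
  qed
  have b0: "b n \<ge> 0" "b' n \<ge> 0" for n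
    using ab(1)[of n] ab'(1)[of n] by linarith+
  have "\<bar>\<Sum>i\<le>n. a i * a' (n - i)\<bar> \<le> (\<Sum>i\<le>n. b i * b' (n - i))" for n
    by (rule order_trans[OF sum_abs sum_mono]) (simp add: abs_mult mult_mono ab ab' b0)
  thus ?thesis
    unfolding majorized_powser_def
    by (intro exI[of _ "\<lambda>n. \<Sum>i\<le>n. a i * a' (n - i)"] exI[of _ "\<lambda>n. \<Sum>i\<le>n. b i * b' (n - i)"])
       (auto intro!: prod ab ab' simp: b0)
qed

lemma majorized_powser_const: "majorized_powser (\<lambda>q. c) (\<lambda>q. \<bar>c\<bar>)"
proof -
  have "(\<lambda>n. (if n = 0 then x else 0) * q ^ n) sums x" for x q :: real
    using sums_single[of 0 "\<lambda>_. x"] by (rule back_subst[of "\<lambda>f. f sums x"]) auto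
  thus ?thesis
    unfolding majorized_powser_def
    by (intro exI[of _ "\<lambda>n. if n = 0 then c else 0"] exI[of _ "\<lambda>n. if n = 0 then \<bar>c\<bar> else 0"]) auto
qed

lemma majorized_powser_power:
  "majorized_powser f g \<Longrightarrow> majorized_powser (\<lambda>q. f q ^ n) (\<lambda>q. g q ^ n)"
proof (induction n)
  case 0
  show ?case using majorized_powser_const[of 1] by simp
qed (auto intro: majorized_powser_mult)

lemma majorized_powser_compose_power:
  assumes "majorized_powser f g" and k: "k > 0"
  shows "majorized_powser (\<lambda>q. f (q ^ k)) (\<lambda>q. g (q ^ k))"
proof -
  obtain a b where ab: "\<And>n. \<bar>a n\<bar> \<le> b n"
    "\<And>q. 0 < q \<Longrightarrow> q < 1 \<Longrightarrow> (\<lambda>n. a n * q ^ n) sums f q"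
    "\<And>q. 0 < q \<Longrightarrow> q < 1 \<Longrightarrow> (\<lambda>n. b n * q ^ n) sums g q"
    using assms(1) unfolding majorized_powser_def by blast
  have *: "(\<lambda>n. (if k dvd n then c (n div k) else 0) * q ^ n) sums s"
    if "(\<lambda>n. c n * (q ^ k) ^ n) sums s" for c :: "nat \<Rightarrow> real" and q s
  proof -
    have "strict_mono (\<lambda>n. k * n)" using k by (auto simp: strict_mono_def)
    hence "(\<lambda>n. (if k dvd (k * n) then c ((k * n) div k) else 0) * q ^ (k * n)) sums s \<longleftrightarrow> ?thesis"
      by (rule sums_mono_reindex) (auto simp: image_iff elim!: dvdE)
    thus ?thesis using that k by (simp add: power_mult)
  qed
  show ?thesis
    unfolding majorized_powser_def
    by (intro exI[of _ "\<lambda>n. if k dvd n then a (n div k) else 0"]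
          exI[of _ "\<lambda>n. if k dvd n then b (n div k) else 0"])
       (use k ab in \<open>auto intro!: * simp: power_less_one_iff\<close>)
qed

lemma majorized_powser_theta3: "majorized_powser theta3 theta3"
  by (rule majorized_powserI[OF _ theta3_sums theta3_sums]) (auto simp: sum_nonneg)

lemma majorized_powser_theta4: "majorized_powser theta4 theta3"
proof -
  have "\<bar>\<Sum>n::int | nat (n\<^sup>2) = m. (-1) powi n\<bar> \<le> (\<Sum>n::int | nat (n\<^sup>2) = m. 1 :: real)" for m
  proof (rule order_trans[OF sum_abs sum_mono])
    show "\<bar>(-1) powi n :: real\<bar> \<le> 1" for n :: int
      using norm_minus_one_powi_mult[of n 1] by simp
  qed
  thus ?thesis by (rule majorized_powserI[OF _ theta4_sums theta3_sums])
qed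

lemma majorized_powser_theta2:
  "majorized_powser (\<lambda>q. theta2 q / (2 * q powr (1/4))) (\<lambda>q. theta2 q / (2 * q powr (1/4)))"
proof -
  have "\<bar>\<Sum>n::int | nat (n\<^sup>2 + n) = m. 1 / 2\<bar> \<le> (\<Sum>n::int | nat (n\<^sup>2 + n) = m. 1 / 2 :: real)" for m
    by (rule order_trans[OF sum_abs sum_mono]) simp
  thus ?thesis by (rule majorized_powserI[OF _ theta2_sums theta2_sums])
qed

text \<open>With nonnegative coefficients a single term is at most the whole sum. At q = exp(-1/n)
  the n-th power of q is 1/e, so the n-th coefficient is at most e g(exp(-1/n)), of order
  n^d.\<close>

lemma majorized_powser_imp_q_expansion:
  assumes "majorized_powser h H" and m: "m > 0"
    and f: "\<And>q. 0 < q \<Longrightarrow> q < 1 \<Longrightarrow> f q = q ^ m * h q"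
    and g: "\<And>q. 0 < q \<Longrightarrow> q < 1 \<Longrightarrow> g q = q ^ m * H q"
    and bound: "\<And>t. 0 < t \<Longrightarrow> t \<le> 1 \<Longrightarrow> g (exp (- t)) \<le> K / t ^ d"
  obtains a where "q_expansion f a" "\<And>n. n \<ge> 1 \<Longrightarrow> \<bar>a n\<bar> \<le> exp 1 * K * real n ^ d"
proof -
  obtain a b where ab: "\<And>n. \<bar>a n\<bar> \<le> b n"
    "\<And>q. 0 < q \<Longrightarrow> q < 1 \<Longrightarrow> (\<lambda>n. a n * q ^ n) sums h q"
    "\<And>q. 0 < q \<Longrightarrow> q < 1 \<Longrightarrow> (\<lambda>n. b n * q ^ n) sums H q"
    using assms(1) unfolding majorized_powser_def by blast
  have b0: "b n \<ge> 0" for n using ab(1)[of n] by linarith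
  \<comment> \<open>Multiplication by q^m. As m > 0, coefficient 0 vanishes, and
    \<open>q_expansion\<close>, which sums from index 1, loses nothing.\<close>
  define shift where "shift = (\<lambda>c n. if n < m then 0 else c (n - m) :: real)"
  have shift: "(\<lambda>n. shift c n * q ^ n) sums (q ^ m * s)"
    if "(\<lambda>n. c n * q ^ n) sums s" for c and q s :: real
  proof -
    have "(\<lambda>n. shift c (n + m) * q ^ (n + m)) sums (q ^ m * s)"
      using sums_mult[OF that, of "q ^ m"] by (simp add: shift_def power_add mult_ac)
    moreover have "(\<Sum>i<m. shift c i * q ^ i) = 0" by (simp add: shift_def)
    ultimately show ?thesis
      using sums_iff_shift[of "\<lambda>n. shift c n * q ^ n" m "q ^ m * s"] by simp
  qed
  have "q_expansion f (shift a)"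
    unfolding q_expansion_def
  proof (intro allI impI)
    fix q :: real assume "0 < q \<and> q < 1"
    hence "(\<lambda>n. shift a n * q ^ n) sums f q" using shift[OF ab(2)] f by simp
    thus "(\<lambda>n. shift a (Suc n) * q ^ Suc n) sums f q"
      using m by (subst sums_Suc_iff) (simp add: shift_def)
  qed
  moreover have "\<bar>shift a n\<bar> \<le> exp 1 * K * real n ^ d" if n: "n \<ge> 1" for n
  proof -
    define q where "q = exp (- (1 / real n))"
    have q: "0 < q" "q < 1" using n by (auto simp: q_def)
    have qn: "q ^ n = exp (- 1)" using n by (simp add: q_def flip: exp_of_nat_mult)
    have S: "(\<lambda>n. shift b n * q ^ n) sums g q" using shift[OF ab(3)] g q by simp
    have "\<bar>shift a n\<bar> * exp (- 1) \<le> shift b n * q ^ n"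
      using ab(1) by (auto simp: shift_def qn)
    also have "\<dots> \<le> g q"
      using S b0 q sum_le_suminf[of "\<lambda>n. shift b n * q ^ n" "{n}"] by (auto simp: sums_iff shift_def)
    also have "\<dots> \<le> K / (1 / real n) ^ d"
      unfolding q_def using n by (intro bound) auto
    finally have "\<bar>shift a n\<bar> * exp (- 1) \<le> K * real n ^ d"
      by (simp add: power_one_over)
    hence "\<bar>shift a n\<bar> * exp (- 1) * exp 1 \<le> K * real n ^ d * exp 1"
      by (rule mult_right_mono) simp
    moreover have "\<bar>shift a n\<bar> * exp (- 1) * exp 1 = \<bar>shift a n\<bar>"
      by (simp add: mult.assoc flip: exp_add)
    moreover have "K * real n ^ d * exp 1 = exp 1 * K * real n ^ d" by simp
    ultimately show ?thesis by linarith
  qed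
  ultimately show ?thesis using that by blast
qed

text \<open>Any point of \<open>(0, T]\<close> is carried into \<open>[T, 2 T]\<close> by repeated doubling.\<close>

lemma doubling_bound:
  fixes \<phi> :: "real \<Rightarrow> real"
  assumes dbl: "\<And>t. t > 0 \<Longrightarrow> \<phi> t \<le> \<phi> (2 * t)"
    and cont: "\<And>t. t > 0 \<Longrightarrow> isCont \<phi> t" and T: "T > 0"
  obtains t0 where "t0 > 0" "\<And>t. 0 < t \<Longrightarrow> t \<le> T \<Longrightarrow> \<phi> t \<le> \<phi> t0"
proof -
  have "\<exists>t0\<in>{T..2 * T}. \<forall>t\<in>{T..2 * T}. \<phi> t \<le> \<phi> t0"
    using T by (intro continuous_attains_sup continuous_at_imp_continuous_on ballI cont) auto
  then obtain t0 where t0: "t0 \<in> {T..2 * T}" "\<And>t. t \<in> {T..2 * T} \<Longrightarrow> \<phi> t \<le> \<phi> t0"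
    by blast
  have "\<phi> t \<le> \<phi> t0" if "T \<le> 2 ^ n * t" "t \<le> T" "0 < t" for n t
    using that
  proof (induction n arbitrary: t)
    case 0
    thus ?case using t0 T by simp
  next
    case (Suc n)
    show ?case
    proof (cases "2 * t \<le> T")
      case True
      hence "\<phi> (2 * t) \<le> \<phi> t0" using Suc.prems by (intro Suc.IH) auto
      thus ?thesis using dbl[of t] Suc.prems by linarith
    next
      case False
      hence "\<phi> (2 * t) \<le> \<phi> t0" using Suc.prems by (intro t0) auto
      thus ?thesis using dbl[of t] Suc.prems by linarith
    qed
  qed
  moreover have "\<exists>n. T \<le> 2 ^ n * t" if "t > 0" for t
  proof -
    obtain n where "T / t < 2 ^ n" using real_arch_pow[of 2 "T / t"] by auto
    thus ?thesis using that by (auto simp: field_simps intro: less_imp_le)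
  qed
  ultimately show ?thesis
    using that[of t0] t0 T by (metis atLeastAtMost_iff less_le_trans)
qed

section \<open>Growth of theta3 and decay of the ratio near q = 1\<close>

lemma exp_minus_double: "exp (- (2 * t)) = (exp (- t))\<^sup>2" for t :: real
  by (simp add: power2_eq_square flip: exp_add)

text \<open>An arithmetic mean of nonnegative numbers is at least half of each, so theta3(q)^2 <= 2
  theta3(q^2)^2, and t theta3(exp(-t))^2 does not decrease when t doubles. This replaces the
  inversion formula for theta3.\<close>

lemma theta3_squared_bound:
  assumes "T > 0"
  obtains C where "\<And>t. 0 < t \<Longrightarrow> t \<le> T \<Longrightarrow> (theta3 (exp (- t)))\<^sup>2 \<le> C / t"
proof -
  define \<phi> where "\<phi> = (\<lambda>t. t * (theta3 (exp (- t)))\<^sup>2)"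
  obtain t0 where "t0 > 0" and t0: "\<And>t. 0 < t \<Longrightarrow> t \<le> T \<Longrightarrow> \<phi> t \<le> \<phi> t0"
  proof (rule doubling_bound[of \<phi>, OF _ _ assms])
    fix t :: real assume t: "t > 0"
    hence q: "0 < exp (- t)" "exp (- t) < 1" by auto
    have "(theta3 (exp (- t)))\<^sup>2 * (1 + 0) \<le> (theta3 (exp (- t)))\<^sup>2 * (1 + (theta_ratio (exp (- t)))\<^sup>2)"
      by (intro mult_left_mono) auto
    hence "(theta3 (exp (- t)))\<^sup>2 \<le> 2 * (theta3 (exp (- (2 * t))))\<^sup>2"
      using theta3_square[OF q] by (simp add: exp_minus_double)
    thus "\<phi> t \<le> \<phi> (2 * t)"
      using t by (simp add: \<phi>_def mult.left_commute mult_left_mono)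
    have "isCont theta3 (exp (- t))" by (rule isCont_theta3[OF q])
    moreover have "isCont (\<lambda>t. exp (- t)) t" by (intro continuous_intros)
    ultimately have "isCont (\<lambda>t. theta3 (exp (- t))) t" by (rule isCont_o2[rotated])
    thus "isCont \<phi> t" unfolding \<phi>_def by (intro continuous_intros)
  qed blast
  show ?thesis
  proof (rule that[of "\<phi> t0"])
    show "(theta3 (exp (- t)))\<^sup>2 \<le> \<phi> t0 / t" if "0 < t" "t \<le> T" for t
      using t0[OF that] that by (simp add: \<phi>_def field_simps)
  qed
qed

text \<open>
  Since \<open>r(q) \<le> r(q\<^sup>2)\<^sup>2\<close> for the ratio \<open>r\<close>, the function \<open>r(exp(-t))\<^sup>t\<close> increases under
  doubling of \<open>t\<close>, which replaces the modular transformation of \<open>theta4\<close>.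
\<close>

lemma theta_ratio_bound:
  assumes "T > 0"
  obtains c where "c > 0" "\<And>t. 0 < t \<Longrightarrow> t \<le> T \<Longrightarrow> theta_ratio (exp (- t)) \<le> exp (- (c / t))"
proof -
  define \<phi> where "\<phi> = (\<lambda>t. t * ln (theta_ratio (exp (- t))))"
  obtain t0 where "t0 > 0" and t0: "\<And>t. 0 < t \<Longrightarrow> t \<le> T \<Longrightarrow> \<phi> t \<le> \<phi> t0"
  proof (rule doubling_bound[of \<phi>, OF _ _ assms])
    fix t :: real assume t: "t > 0"
    hence q: "0 < exp (- t)" "exp (- t) < 1" by auto
    define r where "r = theta_ratio (exp (- t))"
    define R where "R = theta_ratio (exp (- (2 * t)))"
    have r: "0 < r" "r < 1" using theta_ratio_pos[OF q] theta_ratio_less_1[OF q] by (auto simp: r_def)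
    have R: "0 < R" using theta_ratio_pos[OF unit_interval_square[OF q]] by (simp add: R_def exp_minus_double)
    \<comment> \<open>Since R^2 = 2 r/(1 + r^2) and r < 1, the denominator is below 2 and R^2 is at
      least r.\<close>
    have "r * (1 + r\<^sup>2) \<le> r * 2"
      using r by (intro mult_left_mono) (auto simp: power_le_one_iff)
    hence "r \<le> R\<^sup>2"
      using theta_ratio_square[OF q] r
      unfolding R_def exp_minus_double r_def[symmetric] by (simp add: pos_le_divide_eq add_pos_nonneg)
    hence "ln r \<le> ln (R\<^sup>2)" using r R by simp
    hence "ln r \<le> 2 * ln R" using R by (simp add: ln_realpow)
    thus "\<phi> t \<le> \<phi> (2 * t)"
      using t by (simp add: \<phi>_def r_def R_def mult.left_commute mult_left_mono)
    have "isCont theta_ratio (exp (- t))" by (rule DERIV_isCont[OF has_real_derivative_theta_ratio[OF q]])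
    moreover have "isCont (\<lambda>t. exp (- t)) t" by (intro continuous_intros)
    ultimately have "isCont (\<lambda>t. theta_ratio (exp (- t))) t" by (rule isCont_o2[rotated])
    thus "isCont \<phi> t" unfolding \<phi>_def using r by (intro continuous_intros) (auto simp: r_def)
  qed blast
  show ?thesis
  proof (rule that[of "- \<phi> t0"])
    have "ln (theta_ratio (exp (- t0))) < 0"
      using theta_ratio_pos[of "exp (- t0)"] theta_ratio_less_1[of "exp (- t0)"] \<open>t0 > 0\<close> by simp
    thus "- \<phi> t0 > 0" using \<open>t0 > 0\<close> by (simp add: \<phi>_def mult_pos_neg)
    show "theta_ratio (exp (- t)) \<le> exp (- (- \<phi> t0 / t))" if "0 < t" "t \<le> T" for t
    proof -
      have "ln (theta_ratio (exp (- t))) \<le> \<phi> t0 / t"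
        using t0[OF that] that by (simp add: \<phi>_def field_simps)
      thus ?thesis
        using theta_ratio_pos[of "exp (- t)"] that by (subst (asm) exp_le_cancel_iff[symmetric]) simp
    qed
  qed
qed

section \<open>Lambda as a coordinate on the unit interval\<close>

lemma inj_on_modular_lambda: "inj_on modular_lambda {0<..<1}"
proof (rule strict_mono_on_imp_inj_on, rule strict_mono_onI)
  fix x y :: real assume xy: "x \<in> {0<..<1}" "y \<in> {0<..<1}" "x < y"
  show "modular_lambda x < modular_lambda y"
  proof (rule DERIV_pos_imp_increasing[OF xy(3)])
    fix q assume "x \<le> q" "q \<le> y"
    hence q: "0 < q" "q < 1" using xy by auto
    have "modular_lambda q * (1 - modular_lambda q) * theta3 q ^ 4 / q > 0"
      using modular_lambda_pos[OF q] modular_lambda_less_1[OF q] theta3_pos[OF q] q by simp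
    thus "\<exists>D. (modular_lambda has_real_derivative D) (at q) \<and> 0 < D"
      using has_real_derivative_modular_lambda[OF q] by blast
  qed
qed

text \<open>Surjectivity needs values near both ends: lambda -> 0 at q = 0 is a power series limit,
  while values near 1 come from the decay of \<open>theta_ratio\<close> as q -> 1.\<close>

lemma image_modular_lambda: "modular_lambda ` {0<..<1} = {0<..<1}"
proof (intro equalityI subsetI)
  fix y :: real assume y: "y \<in> {0<..<1}"
  have "eventually (\<lambda>q. modular_lambda q < y) (at_right 0)"
    using order_tendstoD(2)[OF tendsto_modular_lambda_0, of y] y by simp
  moreover have "eventually (\<lambda>q::real. q \<in> {0<..<1/2}) (at_right 0)"
    by (rule eventually_at_right_real) simp
  ultimately obtain q1 where q1: "modular_lambda q1 < y" "0 < q1" "q1 < 1/2"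
    using eventually_happens'[OF trivial_limit_at_right_real eventually_conj] by force
  obtain c where c: "c > 0" "\<And>t. 0 < t \<Longrightarrow> t \<le> 1/2 \<Longrightarrow> theta_ratio (exp (- t)) \<le> exp (- (c / t))"
    using theta_ratio_bound[of "1/2"] by auto
  have "((\<lambda>t. 1 - exp (- (c / t)) ^ 4) \<longlongrightarrow> 1) (at_right 0)"
    using c(1) by real_asymp
  hence "eventually (\<lambda>t. 1 - exp (- (c / t)) ^ 4 > y) (at_right 0)"
    using y by (intro order_tendstoD) auto
  moreover have "eventually (\<lambda>t::real. t \<in> {0<..<1/2}) (at_right 0)"
    by (rule eventually_at_right_real) simp
  ultimately obtain t where t: "y < 1 - exp (- (c / t)) ^ 4" "0 < t" "t < 1/2"
    using eventually_happens'[OF trivial_limit_at_right_real eventually_conj] by force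
  define q2 where "q2 = exp (- t)"
  have q2: "0 < q2" "q2 < 1" using t by (auto simp: q2_def)
  have "theta_ratio q2 ^ 4 \<le> exp (- (c / t)) ^ 4"
    using c(2)[of t] t theta_ratio_pos[OF q2] by (intro power_mono) (auto simp: q2_def)
  hence lam2: "y < modular_lambda q2" using t by (simp add: modular_lambda_def)
  \<comment> \<open>The cut at 1/2 separates the two points: t < 1/2 gives exp(-t) >= 1 - t >= 1/2,
    and q1 < 1/2 by choice.\<close>
  have "1 / 2 \<le> q2"
    unfolding q2_def using exp_ge_add_one_self[of "- t"] t by linarith
  hence "q1 \<le> q2" using q1 by linarith
  have "\<exists>q. q1 \<le> q \<and> q \<le> q2 \<and> modular_lambda q = y"
    using q1 q2 lam2 \<open>q1 \<le> q2\<close>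
    by (intro IVT) (auto intro!: DERIV_isCont has_real_derivative_modular_lambda)
  thus "y \<in> modular_lambda ` {0<..<1}" using q1 q2 by force
qed (auto simp: modular_lambda_pos modular_lambda_less_1)

text \<open>Positive roots of the fourth-power identities. The exponent 1/8 arises from
  theta4(q^2)^2 = theta3(q) theta4(q), in which theta4(q) already carries 1/4.\<close>

lemma theta2_eq: "0 < q \<Longrightarrow> q < 1 \<Longrightarrow> theta2 q = theta3 q * modular_lambda q powr (1/4)"
  and theta4_eq: "0 < q \<Longrightarrow> q < 1 \<Longrightarrow> theta4 q = theta3 q * (1 - modular_lambda q) powr (1/4)"
  and theta4_square_eq: "0 < q \<Longrightarrow> q < 1 \<Longrightarrow> theta4 (q\<^sup>2) = theta3 q * (1 - modular_lambda q) powr (1/8)"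
proof -
  assume q: "0 < q" "q < 1"
  have root: "x = y" if "x ^ n = y ^ n" "x > 0" "y > 0" "n > 0" for x y :: real and n
    using that power_eq_imp_eq_base[of x n y] by simp
  note pos = theta2_pos[OF q] theta3_pos[OF q] theta4_pos[OF q] modular_lambda_pos[OF q]
    modular_lambda_less_1[OF q] theta4_pos[OF unit_interval_square[OF q]]
  have pw: "(x powr (1/4)) ^ 4 = x" "(x powr (1/8)) ^ 2 = x powr (1/4)" if "x > 0" for x :: real
    using that by (simp_all add: powr_powr flip: powr_numeral)
  show "theta2 q = theta3 q * modular_lambda q powr (1/4)"
    by (rule root[where n = 4]) (use pos theta2_power4[OF q] in \<open>simp_all add: power_mult_distrib pw\<close>)
  show 4: "theta4 q = theta3 q * (1 - modular_lambda q) powr (1/4)"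
    by (rule root[where n = 4]) (use pos theta4_power4[OF q] in \<open>simp_all add: power_mult_distrib pw\<close>)
  have "(theta3 q * (1 - modular_lambda q) powr (1/8))\<^sup>2 = (theta3 q)\<^sup>2 * (1 - modular_lambda q) powr (1/4)"
    using pos by (simp add: power_mult_distrib pw)
  also have "\<dots> = (theta4 (q\<^sup>2))\<^sup>2"
    unfolding theta3_times_theta4[OF q, symmetric] 4 by (simp add: power2_eq_square)
  finally show "theta4 (q\<^sup>2) = theta3 q * (1 - modular_lambda q) powr (1/8)"
    by (rule root[OF sym]) (use pos in auto)
qed

text \<open>The common shape of all fifteen forms after q is replaced by q^j; the factor at q^2
  accounts for theta4(q^8) when j = 4.\<close>

definition theta_product :: "nat \<Rightarrow> nat \<Rightarrow> nat \<Rightarrow> nat \<Rightarrow> real \<Rightarrow> real" where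
  "theta_product p r s u q = theta2 q ^ p * theta3 q ^ r * theta4 q ^ s * theta4 (q\<^sup>2) ^ u"

text \<open>\<open>weight\<close> counts six factors of weight 1/2, and \<open>cusp\<close> asks for
  a theta4 factor, hence vanishing at q = 1. As theta2(q^j)^p begins with q^(j p/4), m is the order
  of vanishing at q = 0, required to be a positive integer.\<close>

context
  fixes p r s u j m :: nat and \<kappa> :: real
  assumes weight: "p + r + s + u = 6" and cusp: "s + u > 0" and j: "j > 0" and m: "m > 0" "4 * m = j * p"
begin

lemma theta_product_eq:
  assumes q: "0 < q" "q < 1"
  shows "theta_product p r s u q = theta3 q ^ 6 * modular_lambda q powr (real p / 4) *
           (1 - modular_lambda q) powr (real s / 4 + real u / 8)"
proof -
  have pw: "(x powr e) ^ n = x powr (real n * e)" if "x > 0" for x e :: real and n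
    using that by (simp add: powr_powr mult.commute flip: powr_realpow)
  have "theta_product p r s u q = theta3 q ^ (p + r + s + u) * modular_lambda q powr (real p / 4) *
           ((1 - modular_lambda q) powr (real s / 4) * (1 - modular_lambda q) powr (real u / 8))"
    using modular_lambda_pos[OF q] modular_lambda_less_1[OF q]
    by (simp add: theta_product_def theta2_eq[OF q] theta4_eq[OF q] theta4_square_eq[OF q]
        power_mult_distrib power_add pw)
  thus ?thesis by (simp add: weight powr_add)
qed

lemma theta_product_nonneg: "0 < q \<Longrightarrow> q < 1 \<Longrightarrow> theta_product p r s u q \<ge> 0"
  using theta3_pos by (simp add: theta_product_eq less_imp_le)

lemma exp_minus_power: "exp (- t) ^ j = exp (- (real j * t))"
  by (simp flip: exp_of_nat_mult)

lemma theta_product_decay: "\<exists>K. \<forall>t. 0 < t \<and> t \<le> 1 \<longrightarrow> \<bar>\<kappa> * theta_product p r s u (exp (- t) ^ j)\<bar> \<le> K * t ^ N"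
proof -
  have j0: "real j > 0" using j by simp
  obtain C where C: "\<And>t. 0 < t \<Longrightarrow> t \<le> real j \<Longrightarrow> (theta3 (exp (- t)))\<^sup>2 \<le> C / t"
    using theta3_squared_bound[OF j0] by blast
  obtain c where c: "c > 0" "\<And>t. 0 < t \<Longrightarrow> t \<le> real j \<Longrightarrow> theta_ratio (exp (- t)) \<le> exp (- (c / t))"
    using theta_ratio_bound[OF j0] by blast
  \<comment> \<open>Since 1 - lambda is the fourth power of the ratio, the exponent s/4 + u/8 of 1 -
    lambda becomes four times as large for the ratio.\<close>
  define b where "b = real s + real u / 2"
  have b: "b > 0" using cusp by (auto simp: b_def)
  \<comment> \<open>The decay exp(-bc/x) is traded for R powers of x: three offset the growth
    (C/x)^3 of theta3^6, and N remain.\<close>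
  define R where "R = N + 3"
  define K where "K = \<bar>\<kappa>\<bar> * (C ^ 3 / real j ^ 3 * (real R ^ R * (real j / (b * c)) ^ R))"
  have "\<bar>\<kappa> * theta_product p r s u (exp (- t) ^ j)\<bar> \<le> K * t ^ N" if t: "0 < t" "t \<le> 1" for t
  proof -
    define x where "x = real j * t"
    have x: "0 < x" "x \<le> real j" using t j0 by (auto simp: x_def)
    define q where "q = exp (- x)"
    have q: "0 < q" "q < 1" using x by (auto simp: q_def)
    have C0: "0 \<le> C / x" using order_trans[OF _ C[OF x]] by simp
    have 1: "theta3 q ^ 6 \<le> (C / x) ^ 3"
      using power_mono[OF C[OF x], of 3] by (simp add: q_def flip: power_mult)
    have 2: "modular_lambda q powr (real p / 4) \<le> 1"
      using modular_lambda_pos[OF q] modular_lambda_less_1[OF q] powr_mono2[of "real p / 4" "modular_lambda q" 1] by simp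
    have "(1 - modular_lambda q) powr (real s / 4 + real u / 8) = theta_ratio q powr b"
    proof -
      have "1 - modular_lambda q = theta_ratio q powr 4"
        using theta_ratio_pos[OF q] by (simp add: modular_lambda_def)
      moreover have "4 * (real s / 4 + real u / 8) = b" by (simp add: b_def)
      ultimately show ?thesis by (simp only: powr_powr)
    qed
    also have "\<dots> \<le> exp (- (c / x)) powr b"
      using theta_ratio_pos[OF q] c(2)[OF x] b by (intro powr_mono2) (auto simp: q_def)
    also have "\<dots> = exp (- (b * c / x))"
      by (simp add: powr_def)
    also have "\<dots> \<le> real R ^ R * (x / (b * c)) ^ R"
    proof -
      have "(b * c / x) ^ R \<le> real R ^ R * exp (b * c / x)"
        using b c x by (intro power_le_exp) auto
      thus ?thesis using b c x by (simp add: exp_minus power_divide field_simps)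
    qed
    finally have 3: "(1 - modular_lambda q) powr (real s / 4 + real u / 8) \<le> real R ^ R * (x / (b * c)) ^ R" .
    have "theta_product p r s u q \<le> (C / x) ^ 3 * 1 * (real R ^ R * (x / (b * c)) ^ R)"
      unfolding theta_product_eq[OF q] using 1 2 3 C0 theta3_pos[OF q]
      by (intro mult_mono) auto
    also have "\<dots> = C ^ 3 / real j ^ 3 * (real R ^ R * (real j / (b * c)) ^ R) * t ^ N"
      using t j0 b c by (simp add: x_def R_def power_add power_divide power_mult_distrib)
    finally have "\<bar>\<kappa>\<bar> * theta_product p r s u q \<le> \<bar>\<kappa>\<bar> * (C ^ 3 / real j ^ 3 * (real R ^ R * (real j / (b * c)) ^ R) * t ^ N)"
      by (rule mult_left_mono) simp
    thus ?thesis
      using theta_product_nonneg[OF q]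
      by (simp add: K_def abs_mult exp_minus_power q_def x_def mult_ac)
  qed
  thus ?thesis by blast
qed

lemma theta_product_q_expansion:
  obtains a K where "q_expansion (\<lambda>q. \<kappa> * theta_product p r s u (q ^ j)) a"
    "\<And>n. n \<ge> 1 \<Longrightarrow> \<bar>a n\<bar> \<le> K * real n ^ 3"
proof -
  define P where "P = (\<lambda>q. theta2 q / (2 * q powr (1/4)))"
  define h where "h = (\<lambda>q. \<kappa> * 2 ^ p * (P (q ^ j) ^ p * theta3 (q ^ j) ^ r * theta4 (q ^ j) ^ s * theta4 (q ^ (j * 2)) ^ u))"
  define H where "H = (\<lambda>q. \<bar>\<kappa> * 2 ^ p\<bar> * (P (q ^ j) ^ p * theta3 (q ^ j) ^ r * theta3 (q ^ j) ^ s * theta3 (q ^ (j * 2)) ^ u))"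
  have major: "majorized_powser h H"
    unfolding h_def H_def P_def using j
    by (intro majorized_powser_mult majorized_powser_power majorized_powser_const
        majorized_powser_compose_power[OF majorized_powser_theta2]
        majorized_powser_compose_power[OF majorized_powser_theta3]
        majorized_powser_compose_power[OF majorized_powser_theta4]) auto
  \<comment> \<open>The fractional powers q^(1/4) removed from the p theta2 factors combine to the
    integral power q^m.\<close>
  have P: "q ^ m * (2 ^ p * P (q ^ j) ^ p) = theta2 (q ^ j) ^ p" if "0 < q" for q
  proof -
    have "((q ^ j) powr (1/4)) ^ p = (q ^ j) powr (real p / 4)"
      using that by (simp add: powr_powr flip: powr_realpow)
    also have "\<dots> = q powr (real j * (real p / 4))"
      using that by (simp add: powr_powr flip: powr_realpow)
    also have "real j * (real p / 4) = real m"
      using m(2) by (simp add: field_simps flip: of_nat_mult)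
    also have "q powr real m = q ^ m" using that by (simp add: powr_realpow)
    finally show ?thesis
      using that by (simp add: P_def power_divide power_mult_distrib)
  qed
  have pow01: "0 < q ^ j" "q ^ j < 1" if "0 < q" "q < 1" for q :: real
    using that j by (auto simp: power_less_one_iff)
  have j0: "real j > 0" using j by simp
  obtain C where C: "\<And>t. 0 < t \<Longrightarrow> t \<le> real j \<Longrightarrow> (theta3 (exp (- t)))\<^sup>2 \<le> C / t"
    using theta3_squared_bound[OF j0] by blast
  show ?thesis
  proof (rule majorized_powser_imp_q_expansion[OF major m(1)])
    fix q :: real assume q: "0 < q" "q < 1"
    show "\<kappa> * theta_product p r s u (q ^ j) = q ^ m * h q"
      unfolding h_def theta_product_def P[OF q(1), symmetric] by (simp add: power_mult)
    show "\<bar>\<kappa>\<bar> * (theta2 (q ^ j) ^ p * theta3 (q ^ j) ^ r * theta3 (q ^ j) ^ s * theta3 (q ^ (j * 2)) ^ u) = q ^ m * H q"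
      unfolding H_def P[OF q(1), symmetric] by (simp add: abs_mult)
  next
    fix t :: real assume t: "0 < t" "t \<le> 1"
    define x where "x = real j * t"
    have x: "0 < x" "x \<le> real j" using t j0 by (auto simp: x_def)
    define q where "q = exp (- x)"
    have q: "0 < q" "q < 1" using x by (auto simp: q_def)
    \<comment> \<open>Together with theta3(q^2) <= theta3(q) this bounds the majorant by theta3^6,
      of order t^(-3): the source of the cubic coefficient bound.\<close>
    have t2: "theta2 q \<le> theta3 q"
      using modular_lambda_pos[OF q] modular_lambda_less_1[OF q] theta3_pos[OF q] powr_mono2[of "1/4" "modular_lambda q" 1]
      by (simp add: theta2_eq[OF q] mult_left_le)
    have t3: "theta3 (q\<^sup>2) \<le> theta3 q"
    proof (rule power2_le_imp_le)
      show "(theta3 (q\<^sup>2))\<^sup>2 \<le> (theta3 q)\<^sup>2"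
        unfolding theta3_squared[OF q] by simp
    qed (use theta3_pos[OF q] in simp)
    have pos: "0 \<le> theta2 q" "0 \<le> theta3 q" "0 \<le> theta3 (q\<^sup>2)"
      using theta2_pos[OF q] theta3_pos[OF q] theta3_pos[OF unit_interval_square[OF q]] by auto
    have "theta2 q ^ p * theta3 q ^ r * theta3 q ^ s * theta3 (q\<^sup>2) ^ u \<le>
          theta3 q ^ p * theta3 q ^ r * theta3 q ^ s * theta3 q ^ u"
      using t2 t3 pos by (intro mult_mono power_mono) auto
    also have "\<dots> = theta3 q ^ (p + r + s + u)" by (simp add: power_add)
    also have "\<dots> = ((theta3 q)\<^sup>2) ^ 3" by (simp add: weight flip: power_mult)
    also have "\<dots> \<le> (C / x) ^ 3"
      using C[OF x] by (intro power_mono) (auto simp: q_def)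
    finally have "\<bar>\<kappa>\<bar> * (theta2 q ^ p * theta3 q ^ r * theta3 q ^ s * theta3 (q\<^sup>2) ^ u) \<le> \<bar>\<kappa>\<bar> * (C / x) ^ 3"
      by (rule mult_left_mono) simp
    thus "\<bar>\<kappa>\<bar> * (theta2 (exp (- t) ^ j) ^ p * theta3 (exp (- t) ^ j) ^ r * theta3 (exp (- t) ^ j) ^ s *
              theta3 (exp (- t) ^ (j * 2)) ^ u) \<le> \<bar>\<kappa>\<bar> * (C / real j) ^ 3 / t ^ 3"
      by (simp add: power_mult exp_minus_power q_def x_def power_divide power_mult_distrib)
  qed (use that in blast)
qed

theorem theta_product_L_value:
  defines "A \<equiv> real p / 4" and "B \<equiv> real s / 4 + real u / 8"
  shows "has_L_value 3 (\<lambda>q. \<kappa> * theta_product p r s u (q ^ j)) 1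
           (of_real (\<kappa> / real j * (Beta A B * hypergeo [A, 1/2, 1/2] [A + B, 1] 1)))"
\<comment> \<open>Split off because the integrand is recovered from the nonnegative \<psi> by
  dividing by \<kappa>, whatever its sign.\<close>
proof (cases "\<kappa> = 0")
  case nz: False
  have "p > 0" using m by (auto intro: Nat.gr0I)
  hence A: "A > 0" and B: "B > 0" using cusp by (auto simp: A_def B_def)
  have j0: "real j > 0" using j by simp
  define f where "f = (\<lambda>q. \<kappa> * theta_product p r s u (q ^ j))"
  obtain a K where a: "q_expansion f a" "\<And>n. n \<ge> 1 \<Longrightarrow> \<bar>a n\<bar> \<le> K * real n ^ 3"
    using theta_product_q_expansion unfolding f_def by metis
  have decay: "\<exists>K. \<forall>t. 0 < t \<and> t \<le> 1 \<longrightarrow> \<bar>f (exp (- t))\<bar> \<le> K * t ^ N" for N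
    unfolding f_def by (rule theta_product_decay)
  note L = has_L_value_at_1[OF a decay]
  define I where "I = integral {0<..} (\<lambda>t. f (exp (- t)))"
  have fI: "((\<lambda>t. f (exp (- t))) has_integral I) {0<..}"
    unfolding I_def using L(1) by (rule integrable_integral)
  define \<psi> where "\<psi> = (\<lambda>x. x powr (A - 1) * (1 - x) powr (B - 1) * hypergeo [1/2, 1/2] [1] x)"
  define g where "g = (\<lambda>t. modular_lambda (exp (- (real j * t))))"
  define g' where "g' = (\<lambda>t. - (real j * (g t * (1 - g t) * theta3 (exp (- (real j * t))) ^ 4)))"
  have g: "0 < exp (- (real j * t))" "exp (- (real j * t)) < 1" if "t > 0" for t
    using that j0 by auto
  have g01: "0 < g t" "g t < 1" if "t > 0" for t
    using modular_lambda_pos[OF g[OF that]] modular_lambda_less_1[OF g[OF that]] by (auto simp: g_def)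
  have img: "g ` {0<..} = {0<..<1}"
  proof -
    have "(\<lambda>t. exp (- (real j * t))) ` {0<..} = {0<..<1}"
    proof (intro equalityI subsetI)
      fix x :: real assume "x \<in> {0<..<1}"
      thus "x \<in> (\<lambda>t. exp (- (real j * t))) ` {0<..}"
        using j0 by (intro image_eqI[of _ _ "- ln x / real j"]) (auto simp: field_simps)
    qed (use g in auto)
    moreover have "g ` {0<..} = modular_lambda ` ((\<lambda>t. exp (- (real j * t))) ` {0<..})"
      by (simp add: g_def image_image)
    ultimately show ?thesis using image_modular_lambda by (simp only:)
  qed
  have inj: "inj_on g {0<..}"
  proof (rule inj_onI)
    fix x y :: real assume xy: "x \<in> {0<..}" "y \<in> {0<..}" "g x = g y"
    have "modular_lambda (exp (- (real j * x))) = modular_lambda (exp (- (real j * y)))"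
      using xy(3) unfolding g_def .
    moreover have "exp (- (real j * x)) \<in> {0<..<1}" "exp (- (real j * y)) \<in> {0<..<1}"
      using g[of x] g[of y] xy by simp_all
    ultimately have "exp (- (real j * x)) = exp (- (real j * y))"
      by (rule inj_onD[OF inj_on_modular_lambda])
    thus "x = y" using j0 by simp
  qed
  have deriv: "(g has_real_derivative g' t) (at t within {0<..})" if "t \<in> {0<..}" for t
  proof -
    have "((\<lambda>t. exp (- (real j * t))) has_real_derivative - (real j * exp (- (real j * t)))) (at t)"
      by (auto intro!: derivative_eq_intros)
    from DERIV_chain'[OF this has_real_derivative_modular_lambda[OF g]]
    have "(g has_real_derivative g' t) (at t)"
      using that by (simp add: g_def g'_def mult_ac)
    thus ?thesis by (rule has_field_derivative_at_within)
  qed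
  \<comment> \<open>The derivative of lambda contributes x (1 - x) theta3^4: its first two factors
    lift the beta exponents A - 1 and B - 1 to A and B, and theta3^4 meets theta3^2 from the 2F1 to
    give theta3^6.\<close>
  have eq: "\<bar>g' t\<bar> * \<psi> (g t) = real j / \<kappa> * f (exp (- t))" if "t \<in> {0<..}" for t
  proof -
    define q where "q = exp (- (real j * t))"
    have q: "0 < q" "q < 1" and t: "t > 0" using g that by (auto simp: q_def)
    have gq: "g t = modular_lambda q" by (simp add: g_def q_def)
    have "\<bar>g' t\<bar> = real j * (g t * (1 - g t) * theta3 q ^ 4)"
      using g01[OF t] theta3_pos[OF q] j0 by (simp add: g'_def q_def abs_mult)
    hence "\<bar>g' t\<bar> * \<psi> (g t) = real j * (theta3 q ^ 4 * hypergeo [1/2, 1/2] [1] (g t) *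
        (g t * g t powr (A - 1)) * ((1 - g t) * (1 - g t) powr (B - 1)))"
      by (simp add: \<psi>_def mult_ac)
    also have "hypergeo [1/2, 1/2] [1] (g t) = (theta3 q)\<^sup>2"
      unfolding gq by (rule theta3_squared_hypergeo[OF q, symmetric])
    also have "g t * g t powr (A - 1) = g t powr A"
      using g01[OF t] powr_add[of "g t" 1 "A - 1"] by simp
    also have "(1 - g t) * (1 - g t) powr (B - 1) = (1 - g t) powr B"
      using g01[OF t] powr_add[of "1 - g t" 1 "B - 1"] by simp
    also have "real j * (theta3 q ^ 4 * (theta3 q)\<^sup>2 * g t powr A * (1 - g t) powr B) =
        real j * theta_product p r s u q"
    proof -
      have "theta3 q ^ 4 * (theta3 q)\<^sup>2 = theta3 q ^ 6"
        by (simp flip: power_add)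
      thus ?thesis
        unfolding theta_product_eq[OF q] gq A_def B_def by (simp only:)
    qed
    finally show ?thesis using nz by (simp add: f_def exp_minus_power q_def)
  qed
  have "((\<lambda>t. \<bar>g' t\<bar> * \<psi> (g t)) has_integral real j / \<kappa> * I) {0<..}"
    by (rule has_integral_eq[OF eq[symmetric] has_integral_mult_right[OF fI]])
  moreover have "0 \<le> \<psi> (g t)" if "t \<in> {0<..}" for t
    using hypergeo_2F1_pos[of "1/2" "1/2" 1 "g t"] g01[of t] that by (simp add: \<psi>_def)
  ultimately have "(\<psi> has_integral real j / \<kappa> * I) {0<..<1}"
    using has_integral_change_of_variables_nonneg[OF _ deriv inj, of \<psi>] img by simp
  define c where "c = (\<lambda>n. pochhammer (1/2) n * pochhammer (1/2) n / (pochhammer 1 n * fact n) :: real)"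
  \<comment> \<open>Here the integral is already known to exist, so the equivalence delivers the
    convergence of the 3F2 at 1 together with its value.\<close>
  have "(\<lambda>n. c n * Beta (A + real n) B) sums (real j / \<kappa> * I)"
  proof (subst has_integral_Beta_powser_iff[symmetric])
    show "(\<lambda>n. c n * x ^ n) sums hypergeo [1/2, 1/2] [1] x" if "0 < x" "x < 1" for x
      unfolding c_def using that by (intro hypergeo_2F1_sums) auto
  qed (use A B \<open>(\<psi> has_integral real j / \<kappa> * I) {0<..<1}\<close> in
      \<open>auto simp: c_def \<psi>_def intro!: divide_nonneg_nonneg mult_nonneg_nonneg pochhammer_nonneg\<close>)
  hence "(\<lambda>n. c n * Beta (A + real n) B / Beta A B) sums (real j / \<kappa> * I / Beta A B)"
    by (rule sums_divide)
  also have "(\<lambda>n. c n * Beta (A + real n) B / Beta A B) =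
      (\<lambda>n. pochhammer A n * pochhammer (1/2) n * pochhammer (1/2) n / (pochhammer (A + B) n * pochhammer 1 n) * 1 ^ n / fact n)"
    using Beta_real_pos[OF A B] by (simp add: c_def Beta_real_add_nat[OF A B] mult_ac)
  finally have "hypergeo [A, 1/2, 1/2] [A + B, 1] 1 = real j / \<kappa> * I / Beta A B"
    unfolding hypergeo_3F2 by (simp add: sums_iff)
  hence "I = \<kappa> / real j * (Beta A B * hypergeo [A, 1/2, 1/2] [A + B, 1] 1)"
    using Beta_real_pos[OF A B] nz j0 by (simp add: field_simps)
  thus ?thesis using L(2) by (simp add: f_def I_def)
next
  case True
  obtain a K where "q_expansion (\<lambda>q. \<kappa> * theta_product p r s u (q ^ j)) a" "\<And>n. n \<ge> 1 \<Longrightarrow> \<bar>a n\<bar> \<le> K * real n ^ 3"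
    using theta_product_q_expansion by metis
  from has_L_value_at_1(2)[OF this theta_product_decay] show ?thesis using True by simp
qed

end

section \<open>Special values\<close>

lemma Gamma_reflection_real: "Gamma x * Gamma (1 - x) = pi / sin (pi * x)" for x :: real
proof -
  have 1: "Gamma (1 - complex_of_real x) = of_real (Gamma (1 - x))"
    using Gamma_complex_of_real[of "1 - x"] by simp
  have 2: "sin (of_real pi * complex_of_real x) = of_real (sin (pi * x))"
    using sin_of_real[of "pi * x"] by simp
  have "complex_of_real (Gamma x * Gamma (1 - x)) = of_real (pi / sin (pi * x))"
    using Gamma_reflection_complex[of "of_real x"]
    unfolding 1 2 Gamma_complex_of_real by (simp only: of_real_mult of_real_divide)
  thus ?thesis by (simp only: of_real_eq_iff)
qed

lemma Gamma_duplication_real: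
  assumes "x > (0 :: real)"
  shows "Gamma x * Gamma (x + 1/2) = 2 powr (1 - 2 * x) * sqrt pi * Gamma (2 * x)"
proof -
  have 1: "Gamma (complex_of_real x + 1/2) = of_real (Gamma (x + 1/2))"
    using Gamma_complex_of_real[of "x + 1/2"] by simp
  have 2: "Gamma (2 * complex_of_real x) = of_real (Gamma (2 * x))"
    using Gamma_complex_of_real[of "2 * x"] by simp
  have 3: "exp ((1 - 2 * complex_of_real x) * of_real (ln 2)) = of_real (exp ((1 - 2 * x) * ln 2))"
    using exp_of_real[of "(1 - 2 * x) * ln 2", where 'a = complex] by simp
  have "complex_of_real x \<notin> \<int>\<^sub>\<le>\<^sub>0" "complex_of_real x + 1/2 \<notin> \<int>\<^sub>\<le>\<^sub>0"
    using assms by (auto elim!: nonpos_Ints_cases simp: complex_eq_iff)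
  from Gamma_legendre_duplication[OF this]
  have "complex_of_real (Gamma x * Gamma (x + 1/2)) =
        of_real (exp ((1 - 2 * x) * ln 2) * sqrt pi * Gamma (2 * x))"
    unfolding 1 2 3 Gamma_complex_of_real by (simp only: of_real_mult)
  thus ?thesis by (simp only: of_real_eq_iff powr_def) simp
qed

lemma Gamma_quarter: "Gamma (1/4) * Gamma (3/4 :: real) = pi * sqrt 2"
  "Gamma (5/4 :: real) = Gamma (1/4) / 4" "Gamma (3/2 :: real) = sqrt pi / 2"
proof -
  show "Gamma (1/4) * Gamma (3/4 :: real) = pi * sqrt 2"
  proof -
    have "Gamma (1/4) * Gamma (1 - 1/4 :: real) = pi / (sqrt 2 / 2)"
      unfolding Gamma_reflection_real by (simp add: sin_45)
    also have "pi / (sqrt 2 / 2) = pi * sqrt 2" by (simp add: field_simps)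
    finally show ?thesis by simp
  qed
  have "Gamma (1/4 + 1 :: real) = 1/4 * Gamma (1/4)"
    by (rule Gamma_plus1) (auto elim!: nonpos_Ints_cases)
  thus "Gamma (5/4 :: real) = Gamma (1/4) / 4" by simp
  have "Gamma (1/2 + 1 :: real) = 1/2 * Gamma (1/2)"
    by (rule Gamma_plus1) (auto elim!: nonpos_Ints_cases)
  thus "Gamma (3/2 :: real) = sqrt pi / 2" by (simp add: Gamma_one_half_real)
qed

lemma Gamma_eighth:
  "Gamma (1/8) * Gamma (5/8) = 2 powr (3/4) * sqrt pi * Gamma (1/4 :: real)"
  "Gamma (1/8) * Gamma (7/8) = pi / sin (pi / 8)"
  "Gamma (3/8) * Gamma (5/8) = pi / sin (3 * pi / 8)"
  using Gamma_duplication_real[of "1/8"] Gamma_reflection_real[of "1/8"] Gamma_reflection_real[of "3/8"]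
  by (simp_all add: mult_ac)

text \<open>2^(3/4) comes from the duplication formula at 1/8 and the sines from the reflection
  formula; only these products occur in the final values, and their squares are 2 sqrt 2 times a
  half-angle expression.\<close>

lemma sin_pi_8_times_powr:
  "2 powr (3/4) * sin (pi / 8) = sqrt (sqrt 2 - 1)"
  "2 powr (3/4) * sin (3 * pi / 8) = sqrt (sqrt 2 + 1)"
proof -
  have c: "(2 powr (3/4))\<^sup>2 = 2 * sqrt (2::real)"
    using powr_add[of "2::real" 1 "1/2"] by (simp add: powr_half_sqrt powr_powr flip: powr_numeral)
  have alg: "2 * y * ((1 - y / 2) / 2) = y - 1" "2 * y * ((1 - (- (y / 2))) / 2) = y + 1"
    if "y * y = 2" for y :: real
    using that by (simp_all add: algebra_simps diff_divide_distrib add_divide_distrib)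
  have half: "x = (1 - y) / 2" if "y = 1 - 2 * x" for x y :: real
    using that by simp
  have "cos (pi / 4) = 1 - 2 * (sin (pi / 8))\<^sup>2"
    using cos_double_sin[of "pi / 8"] by simp
  hence s1: "(sin (pi / 8))\<^sup>2 = (1 - sqrt 2 / 2) / 2"
    unfolding cos_45 by (rule half)
  have "cos (3 * pi / 4) = 1 - 2 * (sin (3 * pi / 8))\<^sup>2"
    using cos_double_sin[of "3 * pi / 8"] by simp
  moreover have "cos (3 * pi / 4) = - (sqrt 2 / 2)"
  proof -
    have "pi - pi / 4 = 3 * pi / 4" by simp
    thus ?thesis using cos_pi_minus[of "pi / 4"] by (simp only: cos_45)
  qed
  ultimately have s3: "(sin (3 * pi / 8))\<^sup>2 = (1 - (- (sqrt 2 / 2))) / 2"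
    by (intro half) simp
  have pos: "sin (pi / 8) > 0" "sin (3 * pi / 8) > 0"
    using pi_gt_zero by (intro sin_gt_zero; simp)+
  have "(2 powr (3/4) * sin (pi / 8))\<^sup>2 = sqrt 2 - 1" "(2 powr (3/4) * sin (3 * pi / 8))\<^sup>2 = sqrt 2 + 1"
    unfolding power_mult_distrib c s1 s3 by (rule alg; simp)+
  thus "2 powr (3/4) * sin (pi / 8) = sqrt (sqrt 2 - 1)" "2 powr (3/4) * sin (3 * pi / 8) = sqrt (sqrt 2 + 1)"
    using pos by (auto intro!: real_sqrt_unique[symmetric])
qed

lemma Gamma_ne_0: "x > 0 \<Longrightarrow> Gamma (x :: real) \<noteq> 0"
  using Gamma_real_pos[of x] by linarith

lemma Gamma_3_4: "Gamma (3/4 :: real) = pi * sqrt 2 / Gamma (1/4)"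
  using Gamma_quarter(1) Gamma_ne_0[of "1/4"] by (simp add: field_simps)

lemma Gamma_5_8: "Gamma (5/8 :: real) = 2 powr (3/4) * sqrt pi * Gamma (1/4) / Gamma (1/8)"
  using Gamma_eighth(1) Gamma_ne_0[of "1/8"] by (simp add: field_simps)

lemma Gamma_7_8: "Gamma (7/8 :: real) = pi / (sin (pi / 8) * Gamma (1/8))"
proof -
  have "pi / (sin (pi / 8) * Gamma (1/8)) = Gamma (1/8) * Gamma (7/8) / Gamma (1/8 :: real)"
    unfolding Gamma_eighth(2) by simp
  thus ?thesis using Gamma_ne_0[of "1/8"] by simp
qed

lemma Gamma_3_8: "Gamma (3/8 :: real) = pi / (sin (3 * pi / 8) * Gamma (5/8))"
proof -
  have "pi / (sin (3 * pi / 8) * Gamma (5/8)) = Gamma (3/8) * Gamma (5/8) / Gamma (5/8 :: real)"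
    unfolding Gamma_eighth(3) by simp
  thus ?thesis using Gamma_ne_0[of "5/8"] by simp
qed

text \<open>The lower parameters are free variables tied by equations, so that they can be matched
  with numerals such as 3/2.\<close>

lemma Watson_3F2:
  fixes a b c :: real
  assumes "a > 0" "b > 0" "c > 0" "b < a + 1" "a + b < 2 * c + 1"
    and d: "d = (a + b + 1) / 2" and e: "e = 2 * c"
  shows "hypergeo [a, b, c] [d, e] 1 =
         2 powr (b - 1) * Beta (b / 2) ((a - b + 1) / 2) / Beta b ((a - b + 1) / 2) *
          (Gamma (c + 1/2) * Gamma (c + 1/2 - a / 2 - b / 2) /
             (Gamma (c + 1/2 - a / 2) * Gamma (c + 1/2 - b / 2)))"
  using Watson_3F2_sums[OF assms(1-5)] unfolding hypergeo_3F2 d e by (simp add: sums_iff)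

lemma hypergeo_3F2_swap: "hypergeo [a, b, c] [d, e] z = hypergeo [b, a, c] [d, e] z"
  by (simp add: hypergeo_3F2 mult_ac)

text \<open>B = 3/4 - A/2 is precisely Watson's condition that A + B be (A + 1/2 + 1)/2, with the
  remaining parameters 1/2 over 1. It holds for (A, B) = (1/4, 5/8), (3/4, 3/8) and (5/4,
  1/8).\<close>

lemma Beta_times_Watson_half:
  fixes A :: real
  assumes "0 < A" "A < 3/2" and B: "B = 3/4 - A / 2" and C: "C = A + B"
  shows "Beta A B * hypergeo [A, 1/2, 1/2] [C, 1] 1 =
         2 powr (A - 1) * Gamma (A / 2) * (Gamma B)\<^sup>2 / ((Gamma (3/4))\<^sup>2 * Gamma (1 - A / 2))"
proof -
  \<comment> \<open>With A in the second place the denominator of Watson's value is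
    \<open>Beta A B\<close>, which cancels the prefactor.\<close>
  have "hypergeo [1/2, A, 1/2] [C, 1] 1 =
         2 powr (A - 1) * Beta (A / 2) ((1/2 - A + 1) / 2) / Beta A ((1/2 - A + 1) / 2) *
          (Gamma (1/2 + 1/2) * Gamma (1/2 + 1/2 - (1/2) / 2 - A / 2) /
             (Gamma (1/2 + 1/2 - (1/2) / 2) * Gamma (1/2 + 1/2 - A / 2)))"
    using assms by (intro Watson_3F2) auto
  moreover have "(1/2 - A + 1) / 2 = B" "1/2 + 1/2 - (1/2) / 2 - A / 2 = B" "1/2 + 1/2 - (1/2) / 2 = (3/4 :: real)"
      "1/2 + 1/2 - A / 2 = 1 - A / 2" "1/2 + 1/2 = (1::real)"
    using B by (auto simp: field_simps)
  ultimately have "hypergeo [A, 1/2, 1/2] [C, 1] 1 =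
      2 powr (A - 1) * Beta (A / 2) B / Beta A B * (Gamma B / (Gamma (3/4) * Gamma (1 - A / 2)))"
    by (subst hypergeo_3F2_swap) (simp only: Gamma_1 mult_1_left)
  moreover have "Beta A B > 0" using assms by (intro Beta_real_pos) auto
  moreover have "A / 2 + B = 3/4" using B by simp
  hence "Beta (A / 2) B = Gamma (A / 2) * Gamma B / Gamma (3/4)" by (simp only: Beta_def)
  ultimately show ?thesis by (simp add: power2_eq_square)
qed

lemma has_L_value_theta_productI:
  fixes p r s u j m :: nat
  assumes "p + r + s + u = 6" "s + u > 0" "j > 0" "m > 0" "4 * m = j * p"
    and f: "\<And>q. f q = \<kappa> * (theta2 (q ^ j) ^ p * theta3 (q ^ j) ^ r * theta4 (q ^ j) ^ s * theta4 (q ^ (j * 2)) ^ u)"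
    and A: "A = real p / 4" and B: "B = real s / 4 + real u / 8" and C: "C = A + B"
    and v: "\<kappa> / real j * (Beta A B * hypergeo [A, 1/2, 1/2] [C, 1] 1) = v"
  shows "has_L_value 3 f 1 (of_real v)"
proof -
  have "f = (\<lambda>q. \<kappa> * theta_product p r s u (q ^ j))"
    by (auto simp: f theta_product_def power_mult)
  thus ?thesis
    using theta_product_L_value[OF assms(1-5), of \<kappa>] v unfolding A B C by (simp only:)
qed

text \<open>Reflection at 3/8 followed by duplication at 1/8 expresses Gamma(1/8)/Gamma(3/8) through
  Gamma(1/4) and leaves the factor 2^(3/4) sin(3 pi/8).\<close>

lemma Beta_1_4_1_8: "Beta (1/4) (1/8) = sqrt (sqrt 2 + 1) * (Gamma (1/4))\<^sup>2 / sqrt pi"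
proof -
  have s: "sin (3 * pi / 8) > 0" using pi_gt_zero by (intro sin_gt_zero; simp)
  have "Beta (1/4) (1/8) = Gamma (1/4) * Gamma (1/8) / Gamma (3/8 :: real)"
    by (simp add: Beta_def)
  also have "\<dots> = (2 powr (3/4) * sin (3 * pi / 8)) * (Gamma (1/4))\<^sup>2 * sqrt pi / pi"
    unfolding Gamma_3_8 Gamma_5_8 using s Gamma_ne_0[of "1/8"] by (simp add: field_simps power2_eq_square)
  also have "\<dots> = sqrt (sqrt 2 + 1) * (Gamma (1/4))\<^sup>2 / sqrt pi"
    unfolding sin_pi_8_times_powr by (simp add: field_simps)
  finally show ?thesis .
qed

lemma Beta_quarter_values:
  "Beta (1/4) (1/2) = (Gamma (1/4))\<^sup>2 / sqrt (2 * pi)"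
  "Beta (1/4) (3/4) = pi * sqrt (2::real)"
  "Beta (1/4) (5/4) = (Gamma (1/4))\<^sup>2 / (2 * sqrt pi)"
  "Beta (1/2) (3/4) = 4 * (Gamma (3/4))\<^sup>2 / sqrt (2 * pi)"
  "Beta (1/2) (1::real) = 2"
  "Beta (3/4) (3/4) = 2 * (Gamma (3/4))\<^sup>2 / sqrt pi"
proof -
  have [simp]: "Gamma (1/4 :: real) \<noteq> 0" "Gamma (3/4 :: real) \<noteq> 0" by (auto intro!: Gamma_ne_0)
  have G: "Gamma (1/4) = pi * sqrt 2 / Gamma (3/4 :: real)"
    using Gamma_quarter(1) by (simp add: field_simps)
  show "Beta (1/4) (1/2) = (Gamma (1/4))\<^sup>2 / sqrt (2 * pi)"
    by (simp add: Beta_def Gamma_one_half_real Gamma_3_4 real_sqrt_mult field_simps power2_eq_square)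
  show "Beta (1/4) (3/4) = pi * sqrt (2::real)"
    using Gamma_quarter(1) by (simp add: Beta_def)
  show "Beta (1/4) (5/4) = (Gamma (1/4))\<^sup>2 / (2 * sqrt pi)"
    by (simp add: Beta_def Gamma_quarter(2,3) field_simps power2_eq_square)
  show "Beta (1/2) (3/4) = 4 * (Gamma (3/4))\<^sup>2 / sqrt (2 * pi)"
    by (simp add: Beta_def Gamma_one_half_real Gamma_quarter(2) G real_sqrt_mult field_simps power2_eq_square)
  show "Beta (1/2) (1::real) = 2"
    by (simp add: Beta_def Gamma_one_half_real Gamma_quarter(3))
  show "Beta (3/4) (3/4) = 2 * (Gamma (3/4))\<^sup>2 / sqrt pi"
    by (simp add: Beta_def Gamma_quarter(3) field_simps power2_eq_square)
qed

lemma Beta_times_3F2_values: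
  "Beta (1/4) (5/8) * hypergeo [1/4, 1/2, 1/2] [7/8, 1] 1 = sqrt (sqrt 2 - 1) * Gamma (1/4) ^ 4 / (2 * pi\<^sup>2)"
  "Beta (3/4) (3/8) * hypergeo [3/4, 1/2, 1/2] [9/8, 1] 1 =
     Gamma (1/8) * Gamma (1/4) * Gamma (3/8) ^ 3 / (4 * pi powr (5/2))"
  "Beta (5/4) (1/8) * hypergeo [5/4, 1/2, 1/2] [11/8, 1] 1 = sqrt (sqrt 2 + 1) * Gamma (1/4) ^ 4 / pi\<^sup>2"
  "Beta (3/4) (3/4) * hypergeo [3/4, 1/2, 1/2] [3/2, 1] 1 = pi / sqrt 2"
  "Beta 1 (1/2) * hypergeo [1, 1/2, 1/2] [3/2, 1] 1 = pi"
proof -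
  \<comment> \<open>Both 2^(3/4) and sqrt pi are kept as opaque symbols, so the Gamma quotients
    simplify as rational expressions.\<close>
  define c :: real where "c = 2 powr (3/4)"
  define w where "w = sqrt pi"
  have c: "c > 0" and w: "w > 0" and w2: "pi = w * w" by (auto simp: c_def w_def)
  have s: "sin (pi / 8) > 0" "sin (3 * pi / 8) > 0" using pi_gt_zero by (intro sin_gt_zero; simp)+
  have G: "Gamma (1/8 :: real) \<noteq> 0" "Gamma (1/4 :: real) \<noteq> 0" "Gamma (3/8 :: real) \<noteq> 0" "Gamma (5/8 :: real) \<noteq> 0"
    by (auto intro!: Gamma_ne_0)
  have e: "1/4 - 1 = - (3/4 :: real)" "5/4 - 1 = 1 - (3/4 :: real)" by simp_all
  have p: "2 powr (1/4 - 1) = 1 / c" "2 powr (3/4 - 1) = c / 2" "2 powr (5/4 - 1) = 2 / c"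
    unfolding c_def e by (simp_all only: powr_minus_divide powr_diff powr_one)
  have "Beta (1/4) (5/8) * hypergeo [1/4, 1/2, 1/2] [7/8, 1] 1 =
        2 powr (1/4 - 1) * Gamma (1/4 / 2) * (Gamma (5/8))\<^sup>2 / ((Gamma (3/4))\<^sup>2 * Gamma (1 - 1/4 / 2))"
    by (rule Beta_times_Watson_half) auto
  also have "\<dots> = 1 / c * Gamma (1/8) * (Gamma (5/8))\<^sup>2 / ((Gamma (3/4))\<^sup>2 * Gamma (7/8))"
    unfolding p by simp
  also have "\<dots> = (c * sin (pi / 8)) * Gamma (1/4) ^ 4 / (2 * pi\<^sup>2)"
    unfolding Gamma_5_8 Gamma_7_8 Gamma_3_4 c_def[symmetric] w_def[symmetric] using s c w G
    by (simp add: w2 field_simps power2_eq_square power4_eq_xxxx)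
  finally show "Beta (1/4) (5/8) * hypergeo [1/4, 1/2, 1/2] [7/8, 1] 1 = sqrt (sqrt 2 - 1) * Gamma (1/4) ^ 4 / (2 * pi\<^sup>2)"
    unfolding c_def sin_pi_8_times_powr .
  have "Beta (3/4) (3/8) * hypergeo [3/4, 1/2, 1/2] [9/8, 1] 1 =
        2 powr (3/4 - 1) * Gamma (3/4 / 2) * (Gamma (3/8))\<^sup>2 / ((Gamma (3/4))\<^sup>2 * Gamma (1 - 3/4 / 2))"
    by (rule Beta_times_Watson_half) auto
  also have "\<dots> = c / 2 * Gamma (3/8) * (Gamma (3/8))\<^sup>2 / ((Gamma (3/4))\<^sup>2 * Gamma (5/8))"
    unfolding p by simp
  also have "\<dots> = Gamma (1/8) * Gamma (1/4) * Gamma (3/8) ^ 3 / (4 * (pi\<^sup>2 * w))"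
    unfolding Gamma_5_8 Gamma_3_4 c_def[symmetric] w_def[symmetric] using c w G
    by (simp add: w2 field_simps power2_eq_square power3_eq_cube)
  also have "pi\<^sup>2 * w = pi powr (5/2)"
    using powr_add[of pi 2 "1/2"] by (simp add: w_def powr_half_sqrt)
  finally show "Beta (3/4) (3/8) * hypergeo [3/4, 1/2, 1/2] [9/8, 1] 1 =
     Gamma (1/8) * Gamma (1/4) * Gamma (3/8) ^ 3 / (4 * pi powr (5/2))" .
  have "Beta (5/4) (1/8) * hypergeo [5/4, 1/2, 1/2] [11/8, 1] 1 =
        2 powr (5/4 - 1) * Gamma (5/4 / 2) * (Gamma (1/8))\<^sup>2 / ((Gamma (3/4))\<^sup>2 * Gamma (1 - 5/4 / 2))"
    by (rule Beta_times_Watson_half) auto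
  also have "\<dots> = 2 / c * Gamma (5/8) * (Gamma (1/8))\<^sup>2 / ((Gamma (3/4))\<^sup>2 * Gamma (3/8))"
    unfolding p by simp
  also have "\<dots> = (c * sin (3 * pi / 8)) * Gamma (1/4) ^ 4 / pi\<^sup>2"
    unfolding Gamma_3_8 Gamma_5_8 Gamma_3_4 c_def[symmetric] w_def[symmetric] using s c w G
    by (simp add: w2 field_simps power2_eq_square power4_eq_xxxx)
  finally show "Beta (5/4) (1/8) * hypergeo [5/4, 1/2, 1/2] [11/8, 1] 1 = sqrt (sqrt 2 + 1) * Gamma (1/4) ^ 4 / pi\<^sup>2"
    unfolding c_def sin_pi_8_times_powr .
  \<comment> \<open>B = 3/8 would be needed for the previous pattern, but Watson applies in another
    role: 3/4 is the parameter c, with 2 c = 3/2 and (1/2 + 1/2 + 1)/2 = 1.\<close>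
  have "hypergeo [3/4, 1/2, 1/2] [3/2, 1] 1 = hypergeo [1/2, 1/2, 3/4] [1, 3/2] 1"
    by (simp add: hypergeo_3F2 mult_ac)
  also have "\<dots> = 2 powr (1/2 - 1) * Beta ((1/2) / 2) ((1/2 - 1/2 + 1) / 2) / Beta (1/2) ((1/2 - 1/2 + 1) / 2) *
          (Gamma (3/4 + 1/2) * Gamma (3/4 + 1/2 - (1/2) / 2 - (1/2) / 2) /
             (Gamma (3/4 + 1/2 - (1/2) / 2) * Gamma (3/4 + 1/2 - (1/2) / 2)))"
    by (rule Watson_3F2) auto
  also have "\<dots> = 2 powr (- (1/2)) * Beta (1/4) (1/2) / Beta (1/2) (1/2) * (Gamma (5/4) * Gamma (3/4))"
    by simp
  also have "\<dots> = (Gamma (1/4))\<^sup>2 / (4 * sqrt (2 * pi))"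
    unfolding Beta_quarter_values Gamma_quarter(2) using Gamma_quarter(1)
    by (simp add: powr_minus powr_half_sqrt Beta_def Gamma_one_half_real field_simps)
  finally have h: "hypergeo [3/4, 1/2, 1/2] [3/2, 1] 1 = (Gamma (1/4))\<^sup>2 / (4 * sqrt (2 * pi))" .
  show "Beta (3/4) (3/4) * hypergeo [3/4, 1/2, 1/2] [3/2, 1] 1 = pi / sqrt 2"
    unfolding h Beta_quarter_values Gamma_3_4 real_sqrt_mult w_def[symmetric] using G w
    by (simp add: w2 field_simps power2_eq_square)
  \<comment> \<open>Here the upper and lower parameters 1 cancel, so Gauss's theorem suffices; the
    sum is arcsin 1.\<close>
  have "(\<lambda>n. pochhammer (1/2) n * pochhammer (1/2) n / (pochhammer (3/2) n * fact n)) sums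
          (Gamma (3/2) * Gamma (3/2 - 1/2 - 1/2) / (Gamma (3/2 - 1/2) * Gamma (3/2 - 1/2)) :: real)"
    by (rule Gauss_2F1_sums) auto
  hence "(\<lambda>n. pochhammer (1/2) n * pochhammer (1/2) n / (pochhammer (3/2) n * fact n)) sums (pi / 2 :: real)"
    by (simp add: Gamma_quarter(3) Gamma_one_half_real)
  hence "hypergeo [1, 1/2, 1/2] [3/2, 1] 1 = pi / 2"
    by (simp add: hypergeo_3F2 sums_iff pochhammer_fact[symmetric])
  thus "Beta 1 (1/2) * hypergeo [1, 1/2, 1/2] [3/2, 1] 1 = pi"
    by (simp add: Beta_commute[of 1] Beta_quarter_values)
qed

theorem theorem1:
  shows
    "has_L_value 3 (\<lambda>q. 1/2 * theta2 (q^4) * theta3 (q^4) ^ 4 * theta4 (q^8)) 1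
       (complex_of_real (sqrt (sqrt 2 + 1) * Gamma (1/4) ^ 2 / (8 * sqrt pi) * hypergeo [1/4, 1/2, 1/2] [3/8, 1] 1)) \<and>
     has_L_value 3 (\<lambda>q. 1/2 * theta2 (q^4) * theta3 (q^4) ^ 3 * theta4 (q^4) ^ 2) 1
       (complex_of_real (Gamma (1/4) ^ 2 / (8 * sqrt (2 * pi)) * hypergeo [1/4, 1/2, 1/2] [3/4, 1] 1)) \<and>
     has_L_value 3 (\<lambda>q. 1/2 * theta2 (q^4) * theta3 (q^4) ^ 2 * theta4 (q^4) ^ 3) 1
       (complex_of_real (pi / (4 * sqrt 2) * hypergeo [1/4, 1/2, 1/2] [1, 1] 1)) \<and>
     has_L_value 3 (\<lambda>q. 1/2 * theta2 (q^4) * theta4 (q^4) ^ 5) 1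
       (complex_of_real (Gamma (1/4) ^ 2 / (16 * sqrt pi) * hypergeo [1/4, 1/2, 1/2] [3/2, 1] 1)) \<and>
     has_L_value 3 (\<lambda>q. 1/2 * theta2 (q^4) * theta4 (q^8) ^ 5) 1
       (complex_of_real (sqrt (sqrt 2 - 1) * Gamma (1/4) ^ 4 / (16 * pi ^ 2))) \<and>
     has_L_value 3 (\<lambda>q. 1/4 * theta2 (q^2) ^ 2 * theta3 (q^2) ^ 3 * theta4 (q^2)) 1
       (complex_of_real (Gamma (1/4) ^ 2 / (8 * sqrt (2 * pi)) * hypergeo [1/2, 1/2, 1/2] [3/4, 1] 1)) \<and>
     has_L_value 3 (\<lambda>q. 1/4 * theta2 (q^2) ^ 2 * theta3 (q^2) * theta4 (q^2) ^ 3) 1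
       (complex_of_real (Gamma (3/4) ^ 2 / (2 * sqrt (2 * pi)) * hypergeo [1/2, 1/2, 1/2] [5/4, 1] 1)) \<and>
     has_L_value 3 (\<lambda>q. 1/4 * theta2 (q^2) ^ 2 * theta4 (q^2) ^ 4) 1
       (complex_of_real (1/4 * hypergeo [1/2, 1/2, 1/2] [3/2, 1] 1)) \<and>
     has_L_value 3 (\<lambda>q. 1/8 * theta2 (q^4) ^ 3 * theta3 (q^4) ^ 2 * theta4 (q^4)) 1
       (complex_of_real (pi / (16 * sqrt 2) * hypergeo [3/4, 1/2, 1/2] [1, 1] 1)) \<and>
     has_L_value 3 (\<lambda>q. 1/8 * theta2 (q^4) ^ 3 * theta3 (q^4) * theta4 (q^4) ^ 2) 1
       (complex_of_real (Gamma (3/4) ^ 2 / (8 * sqrt (2 * pi)) * hypergeo [3/4, 1/2, 1/2] [5/4, 1] 1)) \<and>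
     has_L_value 3 (\<lambda>q. 1/8 * theta2 (q^4) ^ 3 * theta4 (q^4) ^ 3) 1
       (complex_of_real (pi / (32 * sqrt 2))) \<and>
     has_L_value 3 (\<lambda>q. 1/8 * theta2 (q^4) ^ 3 * theta4 (q^8) ^ 3) 1
       (complex_of_real (Gamma (1/8) * Gamma (1/4) * Gamma (3/8) ^ 3 / (128 * pi powr (5/2)))) \<and>
     has_L_value 3 (\<lambda>q. 1/16 * theta2 q ^ 4 * theta4 q ^ 2) 1
       (complex_of_real (pi / 16)) \<and>
     has_L_value 3 (\<lambda>q. 1/32 * theta2 (q^4) ^ 5 * theta4 (q^4)) 1
       (complex_of_real (Gamma (1/4) ^ 2 / (256 * sqrt pi) * hypergeo [5/4, 1/2, 1/2] [3/2, 1] 1)) \<and>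
     has_L_value 3 (\<lambda>q. 1/32 * theta2 (q^4) ^ 5 * theta4 (q^8)) 1
       (complex_of_real (sqrt (sqrt 2 + 1) * Gamma (1/4) ^ 4 / (128 * pi ^ 2)))"
proof (intro conjI, goal_cases)
  \<comment> \<open>In every case A = p/4, B = s/4 + u/8 and m = j p/4. Cases 5, 11, 12, 13 and 15
    use a summed 3F2; in the others only the beta prefactor is evaluated.\<close>
  case 1
  show ?case
    by (rule has_L_value_theta_productI[where p = 1 and r = 4 and s = 0 and u = 1 and j = 4 and m = 1
          and \<kappa> = "1/2" and A = "1/4" and B = "1/8" and C = "3/8"])
       (simp_all add: Beta_1_4_1_8)
next
  case 2
  show ?case
    by (rule has_L_value_theta_productI[where p = 1 and r = 3 and s = 2 and u = 0 and j = 4 and m = 1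
          and \<kappa> = "1/2" and A = "1/4" and B = "1/2" and C = "3/4"])
       (simp_all add: Beta_quarter_values)
next
  case 3
  show ?case
    by (rule has_L_value_theta_productI[where p = 1 and r = 2 and s = 3 and u = 0 and j = 4 and m = 1
          and \<kappa> = "1/2" and A = "1/4" and B = "3/4" and C = "1"])
       (simp_all add: Beta_quarter_values field_simps)
next
  case 4
  show ?case
    by (rule has_L_value_theta_productI[where p = 1 and r = 0 and s = 5 and u = 0 and j = 4 and m = 1
          and \<kappa> = "1/2" and A = "1/4" and B = "5/4" and C = "3/2"])
       (simp_all add: Beta_quarter_values)
next
  case 5
  show ?case
    by (rule has_L_value_theta_productI[where p = 1 and r = 0 and s = 0 and u = 5 and j = 4 and m = 1
          and \<kappa> = "1/2" and A = "1/4" and B = "5/8" and C = "7/8"])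
       (simp_all add: Beta_times_3F2_values)
next
  case 6
  show ?case
    by (rule has_L_value_theta_productI[where p = 2 and r = 3 and s = 1 and u = 0 and j = 2 and m = 1
          and \<kappa> = "1/4" and A = "1/2" and B = "1/4" and C = "3/4"])
       (simp_all add: Beta_commute[of "1/2" "1/4"] Beta_quarter_values)
next
  case 7
  show ?case
    by (rule has_L_value_theta_productI[where p = 2 and r = 1 and s = 3 and u = 0 and j = 2 and m = 1
          and \<kappa> = "1/4" and A = "1/2" and B = "3/4" and C = "5/4"])
       (simp_all add: Beta_quarter_values)
next
  case 8
  show ?case
    by (rule has_L_value_theta_productI[where p = 2 and r = 0 and s = 4 and u = 0 and j = 2 and m = 1
          and \<kappa> = "1/4" and A = "1/2" and B = "1" and C = "3/2"])
       (simp_all add: Beta_quarter_values)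
next
  case 9
  show ?case
    by (rule has_L_value_theta_productI[where p = 3 and r = 2 and s = 1 and u = 0 and j = 4 and m = 3
          and \<kappa> = "1/8" and A = "3/4" and B = "1/4" and C = "1"])
       (simp_all add: Beta_commute[of "3/4" "1/4"] Beta_quarter_values field_simps)
next
  case 10
  show ?case
    by (rule has_L_value_theta_productI[where p = 3 and r = 1 and s = 2 and u = 0 and j = 4 and m = 3
          and \<kappa> = "1/8" and A = "3/4" and B = "1/2" and C = "5/4"])
       (simp_all add: Beta_commute[of "3/4" "1/2"] Beta_quarter_values)
next
  case 11
  show ?case
    by (rule has_L_value_theta_productI[where p = 3 and r = 0 and s = 3 and u = 0 and j = 4 and m = 3
          and \<kappa> = "1/8" and A = "3/4" and B = "3/4" and C = "3/2"])
       (simp_all add: Beta_times_3F2_values)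
next
  case 12
  show ?case
    by (rule has_L_value_theta_productI[where p = 3 and r = 0 and s = 0 and u = 3 and j = 4 and m = 3
          and \<kappa> = "1/8" and A = "3/4" and B = "3/8" and C = "9/8"])
       (simp_all add: Beta_times_3F2_values)
next
  case 13
  show ?case
    by (rule has_L_value_theta_productI[where p = 4 and r = 0 and s = 2 and u = 0 and j = 1 and m = 1
          and \<kappa> = "1/16" and A = "1" and B = "1/2" and C = "3/2"])
       (simp_all add: Beta_times_3F2_values)
next
  case 14
  show ?case
    by (rule has_L_value_theta_productI[where p = 5 and r = 0 and s = 1 and u = 0 and j = 4 and m = 5
          and \<kappa> = "1/32" and A = "5/4" and B = "1/4" and C = "3/2"])
       (simp_all add: Beta_commute[of "5/4" "1/4"] Beta_quarter_values)
next
  case 15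
  show ?case
    by (rule has_L_value_theta_productI[where p = 5 and r = 0 and s = 0 and u = 1 and j = 4 and m = 5
          and \<kappa> = "1/32" and A = "5/4" and B = "1/8" and C = "11/8"])
       (simp_all add: Beta_times_3F2_values)
qed

end
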